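(* Let $H:\mathbb{R}^2\to\mathbb{R}$ satisfy one of the following: (A) $H\in C^{0,\alpha}$ for some $\alpha\in(0,1)$, $H(p+n)=H(p)$ for all $p\in\mathbb{R}^2,n\in\mathbb{Z}^2$, $\sup|H|<2\sqrt2$ and $\int_{[0,1]^2}H=0$; or (B) $H\in C^{0,\alpha}$ for some $\alpha\in(0,1)$, $H(p)\to0$ as $|p|\to\infty$, $|H|_{(2,1)}<(2/\pi)^{3/2}$, and there exist nonempty open $\omega_+,\omega_-\subset\mathbb{S}^1$ with $\pm H(sp)<0$ for all $p\in\omega_\pm$, $s>0$. Then: (i) there exist sequences $(H_j)\subset\mathbb{R}$ with $|H_j|\to+\infty$ and $(\tau_j)\subset\mathbb{R}\setminus\{0\}$ with $\tau_j\to0$ such that for each $j$ there exists an $(H_j+H)$-loop of area $\tau_j$; (ii) there exist sequences $(H'_k)\subset\mathbb{R}$ with $|H'_k|\to0$ and $(\tau'_k)\subset\mathbb{R}\setminus\{0\}$ with $|\tau'_k|\to+\infty$ such that for each $k$ there exists an $(H'_k+H)$-loop of area $\tau'_k$.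
   Context: Identify $\mathbb{R}^2$ with $\mathbb{C}$: $ip$ is the counterclockwise rotation of $p$ by $\pi/2$. For a function $G:\mathbb{R}^2\to\mathbb{R}$, a $G$-loop is a map $U\in C^2(\mathbb{R};\mathbb{R}^2)$ with $\dot U(t)\neq0$ for all $t$, such that $U(t+T)=U(t)$ for some $T>0$ and all $t$, and $\frac{i\dot U\cdot\ddot U}{|\dot U|^3}(t)=G(U(t))$ for all $t$. Its area is $\frac12\int_0^T U\cdot i\dot U\,dt$. Here $H_j+H$ denotes the function $p\mapsto H_j+H(p)$. $|f|_{(2,1)}=\int_0^\infty f^*(t)t^{-1/2}dt$ with $f^*$ the decreasing rearrangement of $|f|$. *)

theory Defs
  imports "HOL-Analysis.Analysis"
begin

text \<open>The plane R^2 is identified with the complex numbers; i p is the rotation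
  by pi/2, and the Euclidean dot product is the inner product on complex.\<close>

text \<open>U is a C^2 map R -> R^2 with nonvanishing velocity, T-periodic (T > 0),
  whose signed curvature at time t equals G(U t).\<close>
definition G_loop_with_period :: "(complex \<Rightarrow> real) \<Rightarrow> (real \<Rightarrow> complex) \<Rightarrow> real \<Rightarrow> bool" where
  "G_loop_with_period G U T \<longleftrightarrow>
     (\<exists>U' U''. (\<forall>t. (U has_vector_derivative U' t) (at t))
            \<and> (\<forall>t. (U' has_vector_derivative U'' t) (at t))
            \<and> continuous_on UNIV U''
            \<and> (\<forall>t. U' t \<noteq> 0)
            \<and> T > 0 \<and> (\<forall>t. U (t + T) = U t)
            \<and> (\<forall>t. ((\<i> * U' t) \<bullet> U'' t) / (norm (U' t)) ^ 3 = G (U t)))"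

definition minimal_period :: "(real \<Rightarrow> complex) \<Rightarrow> real \<Rightarrow> bool" where
  "minimal_period U T \<longleftrightarrow> T > 0 \<and> (\<forall>t. U (t + T) = U t) \<and>
     (\<forall>S. 0 < S \<and> S < T \<longrightarrow> \<not> (\<forall>t. U (t + S) = U t))"

definition loop_area :: "(real \<Rightarrow> complex) \<Rightarrow> real \<Rightarrow> real" where
  "loop_area U T = 1/2 * integral {0..T} (\<lambda>t. U t \<bullet> (\<i> * vector_derivative U (at t)))"

definition has_loop_of_area :: "(complex \<Rightarrow> real) \<Rightarrow> real \<Rightarrow> bool" where
  "has_loop_of_area G a \<longleftrightarrow>
     (\<exists>U T. G_loop_with_period G U T \<and> minimal_period U T \<and> loop_area U T = a)"

definition holder :: "real \<Rightarrow> (complex \<Rightarrow> real) \<Rightarrow> bool" where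
  "holder \<alpha> H \<longleftrightarrow> continuous_on UNIV H \<and> bounded (range H) \<and>
     (\<exists>C. \<forall>p q. \<bar>H p - H q\<bar> \<le> C * (dist p q) powr \<alpha>)"

definition decr_rearr :: "(complex \<Rightarrow> real) \<Rightarrow> real \<Rightarrow> real" where
  "decr_rearr f t = Inf {s. s \<ge> 0 \<and> emeasure lborel {p. \<bar>f p\<bar> > s} \<le> ennreal t}"

definition lorentz21 :: "(complex \<Rightarrow> real) \<Rightarrow> ennreal" where
  "lorentz21 f = (\<integral>\<^sup>+ t. ennreal (decr_rearr f t * t powr (-1/2)) * indicator {0<..} t \<partial>lborel)"

definition hypA :: "(complex \<Rightarrow> real) \<Rightarrow> bool" where
  "hypA H \<longleftrightarrow> (\<exists>\<alpha>. 0 < \<alpha> \<and> \<alpha> < 1 \<and> holder \<alpha> H)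
     \<and> (\<forall>p. \<forall>m n :: int. H (p + of_int m + \<i> * of_int n) = H p)
     \<and> (SUP p. \<bar>H p\<bar>) < 2 * sqrt 2
     \<and> integral (cbox 0 (1 + \<i>)) H = 0"

definition hypB :: "(complex \<Rightarrow> real) \<Rightarrow> bool" where
  "hypB H \<longleftrightarrow> (\<exists>\<alpha>. 0 < \<alpha> \<and> \<alpha> < 1 \<and> holder \<alpha> H)
     \<and> (H \<longlongrightarrow> 0) at_infinity
     \<and> lorentz21 H < ennreal ((2 / pi) powr (3/2))
     \<and> (\<exists>\<omega>p \<omega>m. \<omega>p \<noteq> {} \<and> \<omega>m \<noteq> {}
          \<and> openin (top_of_set (sphere 0 1)) \<omega>p \<and> openin (top_of_set (sphere 0 1)) \<omega>m
          \<and> (\<forall>p\<in>\<omega>p. \<forall>s>0. H (of_real s * p) < 0)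
          \<and> (\<forall>p\<in>\<omega>m. \<forall>s>0. - H (of_real s * p) < 0))"

end

theory Submission
  imports Defs
begin

text \<open>
Approximate \<open>H\<close> uniformly by divergences \<open>G = div Q\<close> with \<open>norm Q \<le> q < 1\<close>. For closed polygons with \<open>N\<close> vertices
let \<open>l\<close> be the quadratic-mean length \<open>sqrt (N * sum of squared edges)\<close>, \<open>A\<close> the area and \<open>V\<close> the flux, a discrete
line integral of \<open>Q\<close>. Since \<open>V \<le> q * l\<close>, the energy \<open>l - V + K * (A - a0)\<^sup>2\<close>, with \<open>a0 = pi * r\<^sup>2\<close>, \<open>K\<close> of order \<open>r\<close> to the power \<open>-3\<close>
and a small confining penalty on the vertices, is coercive. Its minimisers satisfy a discrete form of the equation of
curvature \<open>G + lm\<close>, where \<open>lm = - 2 * K * (A - a0)\<close> comes from the area penalty. Comparison with a regular polygon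
gives \<open>l\<close> of order \<open>r\<close>, \<open>A\<close> close to \<open>a0\<close> and \<open>\<bar>lm\<bar> \<le> 16 / r\<close>, while a closed curve of length \<open>l\<close> needs \<open>\<bar>lm\<bar>\<close> at least of
order \<open>1 / l\<close>. As \<open>N\<close> tends to infinity the polygons converge to a loop; \<open>r\<close> tending to 0 gives (i) and \<open>r\<close> tending to
infinity gives (ii).

The limit needs polygons in a bounded region. In case (A) one translates by lattice vectors. In case (B) an escaping
sequence would converge to a circle for \<open>H = 0\<close>, possibly covered several times, whose energy is at least the minimum
over circles; a test polygon in a disc on which \<open>H > 0\<close>, found in a cone, lies strictly below that minimum.

The fields \<open>Q\<close> are explicit: in case (A) an average of \<open>H\<close> and its remainder are integrated against sawtooth functions,
which yields components at most \<open>sup \<bar>H\<bar> / 4\<close>; in case (B) a truncation of \<open>H\<close> is convolved with a regularisation of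
\<open>z / (2 * pi * \<bar>z\<bar>\<^sup>2)\<close>, and the resulting potential is bounded by the Lorentz norm.
\<close>


section \<open>Closed polygons\<close>

text \<open>The quadratic-mean length dominates the perimeter by Cauchy-Schwarz, with equality for
  equal edges. It is differentiable wherever it is positive, even if consecutive vertices coincide,
  and it fixes the parametrisation: limits of minimisers have constant speed. The area is penalised
  and not prescribed, because a Lagrange multiplier would need an estimate of its own, whereas
  \<open>lm\<close> is bounded as soon as the area is. The constant is
  \<open>K = 16 / (pi * r^3)\<close>: then \<open>K * (a0 / 2)^2 = 4 * pi * r\<close>, which is also
  the a priori bound for the energy, so the area stays within \<open>a0 / 2\<close> of
  \<open>a0\<close> and cannot vanish. The condition \<open>q < 1\<close> is the form in which
  smallness of \<open>H\<close> enters. \<open>Q\<close> may become rougher as \<open>G\<close>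
  approaches \<open>H\<close>, so \<open>Q\<close> is fixed first and \<open>N\<close> is chosen
  large in terms of it. A last obstacle is that the limit may run through its image several times,
  while the area counts one minimal period: after \<open>m\<close> coverings of a loop of area
  \<open>B\<close> only \<open>m * B\<close> is controlled. A crude isoperimetric estimate for
  \<open>B\<close> removes \<open>m\<close> from the lower bound.\<close>

definition wedge :: "complex \<Rightarrow> complex \<Rightarrow> real" where
  "wedge x y = Re x * Im y - Im x * Re y"

lemma abs_wedge_le: "\<bar>wedge x y\<bar> \<le> norm x * norm y"
proof -
  have "wedge x y = Im (cnj x * y)"
    by (simp add: wedge_def)
  then show ?thesis
    by (metis abs_Im_le_cmod complex_mod_cnj norm_mult)
qed

lemma bounded_bilinear_wedge: "bounded_bilinear wedge"
proof
  show "\<exists>K. \<forall>a b. norm (wedge a b) \<le> norm a * norm b * K"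
    using abs_wedge_le by (intro exI[of _ 1]) simp
qed (simp_all add: wedge_def algebra_simps)

interpretation wedge: bounded_bilinear wedge
  by (rule bounded_bilinear_wedge)

lemma wedge_eq_inner: "wedge x y = x \<bullet> (- \<i> * y)"
  by (simp add: wedge_def inner_complex_def)

text \<open>Indexing by all integers lets the neighbours \<open>k - 1\<close> and
  \<open>k + 1\<close> be formed without reduction modulo \<open>N\<close>, and a shift of the
  summation index is a translation.\<close>

definition periodic :: "nat \<Rightarrow> (int \<Rightarrow> 'a) \<Rightarrow> bool" where
  "periodic N x \<longleftrightarrow> (\<forall>k. x (k + int N) = x k)"

lemma periodicD: "periodic N x \<Longrightarrow> x (k + int N) = x k"
  by (simp add: periodic_def)

lemma periodic_add_mult:
  assumes "periodic N x"
  shows "x (k + m * int N) = x k"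
proof -
  have *: "x (k + int n * int N) = x k" for n k
  proof (induction n)
    case (Suc n)
    have "x (k + int (Suc n) * int N) = x ((k + int n * int N) + int N)"
      by (simp add: algebra_simps)
    then show ?case
      using Suc periodicD[OF assms] by simp
  qed simp
  show ?thesis
  proof (cases "m \<ge> 0")
    case True
    then show ?thesis
      using *[of k "nat m"] by simp
  next
    case False
    then show ?thesis
      using *[of "k + m * int N" "nat (- m)"] by (simp add: algebra_simps)
  qed
qed

lemma periodic_mod:
  assumes "periodic N x"
  shows "x (k mod int N) = x k"
  using periodic_add_mult[OF assms, of "k mod int N" "k div int N"] by simp

lemma sum_periodic_shift:
  fixes f :: "int \<Rightarrow> 'a::ab_group_add"
  assumes "periodic N f"
  shows "(\<Sum>k\<in>{0..<int N}. f (k + 1)) = (\<Sum>k\<in>{0..<int N}. f k)"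
proof (cases "N = 0")
  case False
  have "(\<Sum>k\<in>{0..<int N}. f (k + 1)) = (\<Sum>k\<in>{1..<int N + 1}. f k)"
    by (rule sum.reindex_bij_witness[of _ "\<lambda>k. k - 1" "\<lambda>k. k + 1"]) auto
  moreover have "f 0 + (\<Sum>k\<in>{1..<int N + 1}. f k) = (\<Sum>k\<in>{0..<int N + 1}. f k)"
  proof -
    have "{0..<int N + 1} = insert 0 {1..<int N + 1}"
      by auto
    then show ?thesis
      by simp
  qed
  moreover have "f (int N) + (\<Sum>k\<in>{0..<int N}. f k) = (\<Sum>k\<in>{0..<int N + 1}. f k)"
  proof -
    have "{0..<int N + 1} = insert (int N) {0..<int N}"
      by auto
    then show ?thesis
      by simp
  qed
  moreover have "f (int N) = f 0"
    using periodicD[OF assms, of 0] by simp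
  ultimately show ?thesis
    by (metis add_left_cancel)
qed simp

text \<open>Summation by parts on a closed polygon. With a suitable \<open>g\<close> it collects at
  vertex \<open>k\<close> all terms that contain the variation of that vertex, and it removes the
  dependence of area sums on the base point.\<close>

lemma sum_periodic_telescope:
  fixes g :: "int \<Rightarrow> 'a::ab_group_add"
  assumes "periodic N g" and "\<And>k. k \<in> {0..<int N} \<Longrightarrow> f k = h k + (g (k + 1) - g k)"
  shows "(\<Sum>k\<in>{0..<int N}. f k) = (\<Sum>k\<in>{0..<int N}. h k)"
proof -
  have "(\<Sum>k\<in>{0..<int N}. f k) = (\<Sum>k\<in>{0..<int N}. h k + (g (k + 1) - g k))"
    using assms(2) by (intro sum.cong) auto
  also have "\<dots> = (\<Sum>k\<in>{0..<int N}. h k)"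
    by (simp add: sum.distrib sum_subtractf sum_periodic_shift[OF assms(1)])
  finally show ?thesis .
qed

section \<open>Length, area and flux of polygons, and their first variations\<close>

definition poly_length :: "nat \<Rightarrow> (int \<Rightarrow> complex) \<Rightarrow> real" where
  "poly_length N x = sqrt (real N * (\<Sum>k\<in>{0..<int N}. (norm (x (k + 1) - x k))\<^sup>2))"

definition poly_area :: "nat \<Rightarrow> (int \<Rightarrow> complex) \<Rightarrow> real" where
  "poly_area N x = 1/2 * (\<Sum>k\<in>{0..<int N}. wedge (x k) (x (k + 1)))"

text \<open>Trapezoidal rule for the line integral of \<open>Re Q dy - Im Q dx\<close>, the outward
  flux of \<open>Q\<close> when the polygon runs counterclockwise. Averaging \<open>Q\<close> over
  both ends of an edge treats the two neighbours of a vertex alike, which produces the symmetric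
  difference \<open>x (k + 1) - x (k - 1)\<close> in the first variation.\<close>

definition poly_flux :: "(complex \<Rightarrow> complex) \<Rightarrow> nat \<Rightarrow> (int \<Rightarrow> complex) \<Rightarrow> real" where
  "poly_flux Q N x = 1/2 * (\<Sum>k\<in>{0..<int N}. wedge (Q (x k) + Q (x (k + 1))) (x (k + 1) - x k))"

text \<open>\<open>a\<close> and \<open>b\<close> are the two partial derivatives of \<open>Q\<close>; the remainder is uniform in the point.\<close>

definition unif_div :: "(complex \<Rightarrow> complex) \<Rightarrow> (complex \<Rightarrow> real) \<Rightarrow> bool" where
  "unif_div Q G \<longleftrightarrow> (\<exists>a b. (\<forall>p. G p = Re (a p) + Im (b p)) \<and>
     (\<forall>\<epsilon>>0. \<exists>\<delta>>0. \<forall>p h. norm h \<le> \<delta> \<longrightarrow>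
        norm (Q (p + h) - Q p - (Re h *\<^sub>R a p + Im h *\<^sub>R b p)) \<le> \<epsilon> * norm h))"

text \<open>Derivative at the identity of \<open>wedge (L h) (L d) = det L * wedge h d\<close>,
  where the determinant turns into the trace. With the derivative of \<open>Q\<close> in place of
  the linear map, this is how the divergence enters the first variation of the flux.\<close>

lemma trace_wedge:
  "wedge (Re h *\<^sub>R a + Im h *\<^sub>R b) d + wedge h (Re d *\<^sub>R a + Im d *\<^sub>R b) = (Re a + Im b) * wedge h d"
  by (simp add: wedge_def algebra_simps)

lemma has_derivative_of_unif:
  fixes Q :: "complex \<Rightarrow> complex"
  assumes "\<And>\<epsilon>. \<epsilon> > 0 \<Longrightarrow> \<exists>\<delta>>0. \<forall>p h. norm h \<le> \<delta> \<longrightarrow>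
        norm (Q (p + h) - Q p - (Re h *\<^sub>R a p + Im h *\<^sub>R b p)) \<le> \<epsilon> * norm h"
  shows "(Q has_derivative (\<lambda>h. Re h *\<^sub>R a p + Im h *\<^sub>R b p)) (at p)"
  unfolding has_derivative_at_alt
proof (intro conjI allI impI)
  show "bounded_linear (\<lambda>h. Re h *\<^sub>R a p + Im h *\<^sub>R b p)"
    by (intro bounded_linear_add bounded_linear_scaleR_const bounded_linear_Re bounded_linear_Im)
next
  fix e :: real
  assume "0 < e"
  then obtain \<delta> where \<delta>: "\<delta> > 0" "\<And>p h. norm h \<le> \<delta> \<Longrightarrow>
        norm (Q (p + h) - Q p - (Re h *\<^sub>R a p + Im h *\<^sub>R b p)) \<le> e * norm h"
    using assms by blast
  show "\<exists>d>0. \<forall>y. norm (y - p) < d \<longrightarrow>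
      norm (Q y - Q p - (Re (y - p) *\<^sub>R a p + Im (y - p) *\<^sub>R b p)) \<le> e * norm (y - p)"
  proof (intro exI[of _ \<delta>] conjI allI impI \<delta>(1))
    fix y
    assume "norm (y - p) < \<delta>"
    then show "norm (Q y - Q p - (Re (y - p) *\<^sub>R a p + Im (y - p) *\<^sub>R b p)) \<le> e * norm (y - p)"
      using \<delta>(2)[of "y - p" p] by simp
  qed
qed

text \<open>The threshold \<open>\<delta>\<close> depends on \<open>Q\<close> and
  \<open>\<epsilon>\<close> alone, so that it can be fixed before \<open>N\<close> and the polygon.
  A curve \<open>X\<close> of polygons is allowed, because displaced vertices and homotheties are
  both inserted later.\<close>

lemma poly_flux_derivative:
  assumes "unif_div Q G" and "\<epsilon> > 0"
  obtains \<delta> where "\<delta> > 0"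
    and "\<And>N X \<phi> s0. periodic N (X s0) \<Longrightarrow> periodic N \<phi>
       \<Longrightarrow> (\<And>k. norm (X s0 (k + 1) - X s0 k) \<le> \<delta>)
       \<Longrightarrow> (\<And>k. ((\<lambda>s. X s k) has_vector_derivative \<phi> k) (at s0))
       \<Longrightarrow> \<exists>D. ((\<lambda>s. poly_flux Q N (X s)) has_real_derivative D) (at s0) \<and>
             \<bar>D - 1/2 * (\<Sum>k\<in>{0..<int N}. G (X s0 k) * wedge (\<phi> k) (X s0 (k + 1) - X s0 (k - 1)))\<bar>
             \<le> \<epsilon> / 2 * (\<Sum>k\<in>{0..<int N}. norm (\<phi> k) *
                   (norm (X s0 (k + 1) - X s0 k) + norm (X s0 k - X s0 (k - 1))))"
proof -
  obtain a b where G: "\<And>p. G p = Re (a p) + Im (b p)"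
    and ab: "\<And>\<epsilon>. \<epsilon> > 0 \<Longrightarrow> \<exists>\<delta>>0. \<forall>p h. norm h \<le> \<delta> \<longrightarrow>
        norm (Q (p + h) - Q p - (Re h *\<^sub>R a p + Im h *\<^sub>R b p)) \<le> \<epsilon> * norm h"
    using assms(1) unfolding unif_div_def by blast
  define L where "L p h = Re h *\<^sub>R a p + Im h *\<^sub>R b p" for p h
  have Ladd: "L p (h - h') = L p h - L p h'" for p h h'
    by (simp add: L_def algebra_simps)
  obtain \<delta> where \<delta>: "\<delta> > 0" "\<And>p h. norm h \<le> \<delta> \<Longrightarrow> norm (Q (p + h) - Q p - L p h) \<le> \<epsilon> * norm h"
    using ab[OF assms(2)] unfolding L_def by blast
  have dQ: "(Q has_derivative L p) (at p)" for p
    using has_derivative_of_unif[OF ab] unfolding L_def by blast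
  show ?thesis
  proof (rule that[OF \<delta>(1)])
    fix N :: nat and X :: "real \<Rightarrow> int \<Rightarrow> complex" and \<phi> s0
    assume perX: "periodic N (X s0)" and per\<phi>: "periodic N \<phi>"
      and small: "\<And>k. norm (X s0 (k + 1) - X s0 k) \<le> \<delta>"
      and dX: "\<And>k. ((\<lambda>s. X s k) has_vector_derivative \<phi> k) (at s0)"
    define x where "x = X s0"
    define l where "l k = L (x k) (\<phi> k)" for k
    have dQX: "((\<lambda>s. Q (X s k)) has_vector_derivative l k) (at s0)" for k
    proof -
      have "L (x k) (s *\<^sub>R \<phi> k) = s *\<^sub>R l k" for s
        by (simp add: l_def L_def algebra_simps)
      then show ?thesis
        using has_derivative_compose[OF dX[of k, unfolded has_vector_derivative_def], of Q "L (x k)"] dQ[of "x k"]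
        by (simp add: has_vector_derivative_def x_def)
    qed
    \<comment> \<open>\<open>Dk\<close> is the product rule edge by edge. Removing the telescoping
      term \<open>g\<close> leaves \<open>Tk\<close>, in which only the variation
      \<open>\<phi> k\<close> of the vertex \<open>k\<close> occurs.\<close>
    define Dk where "Dk k = wedge (Q (x k) + Q (x (k + 1))) (\<phi> (k + 1) - \<phi> k)
        + wedge (l k + l (k + 1)) (x (k + 1) - x k)" for k
    define Tk where "Tk k = wedge (l k) (x (k + 1) - x (k - 1)) + wedge (Q (x (k - 1)) - Q (x (k + 1))) (\<phi> k)" for k
    define g where "g k = wedge (l k) (x k - x (k - 1)) + wedge (Q (x (k - 1)) + Q (x k)) (\<phi> k)" for k
    have deriv: "((\<lambda>s. poly_flux Q N (X s)) has_vector_derivative 1/2 * (\<Sum>k\<in>{0..<int N}. Dk k)) (at s0)"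
      unfolding poly_flux_def Dk_def x_def
      by (intro has_vector_derivative_mult_right has_vector_derivative_sum
          wedge.has_vector_derivative has_vector_derivative_add has_vector_derivative_diff dQX dX)
    have pg: "periodic N g"
    proof -
      have "g (k + int N) = g k" for k
      proof -
        have "X s0 (k + int N - 1) = X s0 (k - 1)"
          using periodicD[OF perX, of "k - 1"] by (simp add: algebra_simps)
        then show ?thesis
          using periodicD[OF perX, of k] periodicD[OF per\<phi>, of k]
          by (simp add: g_def l_def x_def)
      qed
      then show ?thesis
        by (simp add: periodic_def)
    qed
    have DT: "(\<Sum>k\<in>{0..<int N}. Dk k) = (\<Sum>k\<in>{0..<int N}. Tk k)"
    proof (rule sum_periodic_telescope[OF pg])
      fix k
      show "Dk k = Tk k + (g (k + 1) - g k)"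
        by (simp add: Dk_def Tk_def g_def wedge.add_left wedge.add_right wedge.diff_left wedge.diff_right)
    qed
    have T: "\<bar>Tk k - G (x k) * wedge (\<phi> k) (x (k + 1) - x (k - 1))\<bar>
        \<le> \<epsilon> * (norm (\<phi> k) * (norm (x (k + 1) - x k) + norm (x k - x (k - 1))))" for k
    proof -
      \<comment> \<open>The two Taylor remainders of \<open>Q\<close> at \<open>x k\<close>, one for
        each neighbour. The rest of the difference of \<open>Q\<close> is linear, and
        \<open>trace_wedge\<close> combines it with the term that contains
        \<open>l k\<close>.\<close>
      define E where "E = (Q (x (k - 1)) - Q (x k) - L (x k) (x (k - 1) - x k))
          - (Q (x (k + 1)) - Q (x k) - L (x k) (x (k + 1) - x k))"
      have "Q (x (k - 1)) - Q (x (k + 1)) = E - L (x k) (x (k + 1) - x (k - 1))"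
        by (simp add: E_def Ladd)
      then have "Tk k = wedge (l k) (x (k + 1) - x (k - 1)) + wedge E (\<phi> k)
          + wedge (\<phi> k) (L (x k) (x (k + 1) - x (k - 1)))"
        by (simp add: Tk_def wedge.diff_left) (simp add: wedge_def algebra_simps)
      also have "\<dots> = G (x k) * wedge (\<phi> k) (x (k + 1) - x (k - 1)) + wedge E (\<phi> k)"
        using trace_wedge[of "\<phi> k" "a (x k)" "b (x k)" "x (k + 1) - x (k - 1)"]
        by (simp add: l_def L_def G)
      finally have "\<bar>Tk k - G (x k) * wedge (\<phi> k) (x (k + 1) - x (k - 1))\<bar> \<le> norm E * norm (\<phi> k)"
        using abs_wedge_le by simp
      also have "norm E \<le> \<epsilon> * norm (x (k - 1) - x k) + \<epsilon> * norm (x (k + 1) - x k)"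
      proof -
        have "norm (x k - x (k - 1)) \<le> \<delta>" "norm (x (k + 1) - x k) \<le> \<delta>"
          using small[of "k - 1"] small[of k] by (simp_all add: x_def)
        then have "norm (Q (x (k - 1)) - Q (x k) - L (x k) (x (k - 1) - x k)) \<le> \<epsilon> * norm (x (k - 1) - x k)"
          "norm (Q (x (k + 1)) - Q (x k) - L (x k) (x (k + 1) - x k)) \<le> \<epsilon> * norm (x (k + 1) - x k)"
          using \<delta>(2)[of "x (k - 1) - x k" "x k"] \<delta>(2)[of "x (k + 1) - x k" "x k"]
          by (simp_all add: norm_minus_commute)
        then show ?thesis
          unfolding E_def by (rule order_trans[OF norm_triangle_ineq4 add_mono])
      qed
      finally show ?thesis
        by (simp add: algebra_simps norm_minus_commute mult_left_mono mult_right_mono)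
    qed
    have "\<bar>(\<Sum>k\<in>{0..<int N}. Tk k) - (\<Sum>k\<in>{0..<int N}. G (x k) * wedge (\<phi> k) (x (k + 1) - x (k - 1)))\<bar>
        \<le> (\<Sum>k\<in>{0..<int N}. \<epsilon> * (norm (\<phi> k) * (norm (x (k + 1) - x k) + norm (x k - x (k - 1)))))"
      unfolding sum_subtractf[symmetric] by (rule order_trans[OF sum_abs sum_mono[OF T]])
    then have "\<bar>1/2 * (\<Sum>k\<in>{0..<int N}. Tk k)
          - 1/2 * (\<Sum>k\<in>{0..<int N}. G (x k) * wedge (\<phi> k) (x (k + 1) - x (k - 1)))\<bar>
        \<le> \<epsilon> / 2 * (\<Sum>k\<in>{0..<int N}. norm (\<phi> k) * (norm (x (k + 1) - x k) + norm (x k - x (k - 1))))"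
      unfolding sum_distrib_left[symmetric] abs_le_iff by linarith
    then show "\<exists>D. ((\<lambda>s. poly_flux Q N (X s)) has_real_derivative D) (at s0) \<and>
             \<bar>D - 1/2 * (\<Sum>k\<in>{0..<int N}. G (X s0 k) * wedge (\<phi> k) (X s0 (k + 1) - X s0 (k - 1)))\<bar>
             \<le> \<epsilon> / 2 * (\<Sum>k\<in>{0..<int N}. norm (\<phi> k) *
                   (norm (X s0 (k + 1) - X s0 k) + norm (X s0 k - X s0 (k - 1))))"
      using deriv unfolding DT has_real_derivative_iff_has_vector_derivative[symmetric] x_def by blast
  qed
qed

lemma poly_area_derivative:
  assumes "periodic N (X s0)" and "periodic N \<phi>"
    and dX: "\<And>k. ((\<lambda>s. X s k) has_vector_derivative \<phi> k) (at s0)"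
  shows "((\<lambda>s. poly_area N (X s)) has_real_derivative
      1/2 * (\<Sum>k\<in>{0..<int N}. wedge (\<phi> k) (X s0 (k + 1) - X s0 (k - 1)))) (at s0)"
proof -
  have "((\<lambda>s. poly_area N (X s)) has_vector_derivative
      1/2 * (\<Sum>k\<in>{0..<int N}. wedge (X s0 k) (\<phi> (k + 1)) + wedge (\<phi> k) (X s0 (k + 1)))) (at s0)"
    unfolding poly_area_def
    by (intro has_vector_derivative_mult_right has_vector_derivative_sum wedge.has_vector_derivative dX)
  moreover have "(\<Sum>k\<in>{0..<int N}. wedge (X s0 k) (\<phi> (k + 1)) + wedge (\<phi> k) (X s0 (k + 1)))
      = (\<Sum>k\<in>{0..<int N}. wedge (\<phi> k) (X s0 (k + 1) - X s0 (k - 1)))"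
  proof (rule sum_periodic_telescope)
    show "periodic N (\<lambda>k. wedge (X s0 (k - 1)) (\<phi> k))"
      using assms(1,2) unfolding periodic_def by (metis diff_add_eq)
    show "wedge (X s0 k) (\<phi> (k + 1)) + wedge (\<phi> k) (X s0 (k + 1)) =
      wedge (\<phi> k) (X s0 (k + 1) - X s0 (k - 1)) +
      (wedge (X s0 (k + 1 - 1)) (\<phi> (k + 1)) - wedge (X s0 (k - 1)) (\<phi> k))" for k
      by (simp add: wedge_def algebra_simps)
  qed
  ultimately show ?thesis
    by (simp add: has_real_derivative_iff_has_vector_derivative)
qed

lemma poly_length_derivative:
  assumes perX: "periodic N (X s0)" and per\<phi>: "periodic N \<phi>"
    and dX: "\<And>k. ((\<lambda>s. X s k) has_vector_derivative \<phi> k) (at s0)"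
    and pos: "poly_length N (X s0) > 0"
  shows "((\<lambda>s. poly_length N (X s)) has_real_derivative
      real N / poly_length N (X s0) * (\<Sum>k\<in>{0..<int N}. \<phi> k \<bullet> ((X s0 k - X s0 (k - 1)) - (X s0 (k + 1) - X s0 k)))) (at s0)"
proof -
  define S where "S = (\<Sum>k\<in>{0..<int N}. \<phi> k \<bullet> ((X s0 k - X s0 (k - 1)) - (X s0 (k + 1) - X s0 k)))"
  define f where "f s = real N * (\<Sum>k\<in>{0..<int N}. (norm (X s (k + 1) - X s k))\<^sup>2)" for s
  have f: "f s = real N * (\<Sum>k\<in>{0..<int N}. (X s (k + 1) - X s k) \<bullet> (X s (k + 1) - X s k))" for s
    unfolding f_def by (simp add: power2_norm_eq_inner)
  have "(f has_vector_derivative real N * (\<Sum>k\<in>{0..<int N}.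
      (X s0 (k + 1) - X s0 k) \<bullet> (\<phi> (k + 1) - \<phi> k) + (\<phi> (k + 1) - \<phi> k) \<bullet> (X s0 (k + 1) - X s0 k))) (at s0)"
    unfolding f
    by (intro has_vector_derivative_mult_right has_vector_derivative_sum
        bounded_bilinear.has_vector_derivative[OF bounded_bilinear_inner] has_vector_derivative_diff dX)
  moreover have "(\<Sum>k\<in>{0..<int N}.
      (X s0 (k + 1) - X s0 k) \<bullet> (\<phi> (k + 1) - \<phi> k) + (\<phi> (k + 1) - \<phi> k) \<bullet> (X s0 (k + 1) - X s0 k))
     = (\<Sum>k\<in>{0..<int N}. 2 * (\<phi> k \<bullet> ((X s0 k - X s0 (k - 1)) - (X s0 (k + 1) - X s0 k))))"
  proof (rule sum_periodic_telescope)
    show "periodic N (\<lambda>k. 2 * (\<phi> k \<bullet> (X s0 k - X s0 (k - 1))))"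
      using assms(1,2) unfolding periodic_def by (metis diff_add_eq)
    show "(X s0 (k + 1) - X s0 k) \<bullet> (\<phi> (k + 1) - \<phi> k) + (\<phi> (k + 1) - \<phi> k) \<bullet> (X s0 (k + 1) - X s0 k) =
      2 * (\<phi> k \<bullet> ((X s0 k - X s0 (k - 1)) - (X s0 (k + 1) - X s0 k))) +
      (2 * (\<phi> (k + 1) \<bullet> (X s0 (k + 1) - X s0 (k + 1 - 1))) - 2 * (\<phi> k \<bullet> (X s0 k - X s0 (k - 1))))" for k
      by (simp add: inner_complex_def algebra_simps)
  qed
  ultimately have df: "(f has_real_derivative 2 * (real N * S)) (at s0)"
    by (simp add: has_real_derivative_iff_has_vector_derivative S_def sum_distrib_left mult.left_commute)
  have fpos: "f s0 > 0"
    using pos unfolding poly_length_def f_def by simp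
  have "((\<lambda>s. sqrt (f s)) has_real_derivative (2 * (real N * S)) * (inverse (sqrt (f s0)) / 2)) (at s0)"
    using DERIV_chain2[OF DERIV_real_sqrt[OF fpos] df] by (simp add: mult.commute)
  moreover have "(\<lambda>s. sqrt (f s)) = (\<lambda>s. poly_length N (X s))"
    by (simp add: f_def poly_length_def)
  moreover have "sqrt (f s0) = poly_length N (X s0)"
    by (simp add: f_def poly_length_def)
  ultimately show ?thesis
    by (simp add: S_def field_simps)
qed


section \<open>Bounds by the quadratic-mean length\<close>

lemma sum_edges_le_poly_length:
  "(\<Sum>k\<in>{0..<int N}. norm (x (k + 1) - x k)) \<le> poly_length N x"
  unfolding poly_length_def
  using sum_squared_le_sum_of_squares[of "\<lambda>k. norm (x (k + 1) - x k)" "{0..<int N}"]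
  by (intro real_le_rsqrt) (simp add: mult.commute)

lemma sum_previous_edges:
  assumes "periodic N x"
  shows "(\<Sum>k\<in>{0..<int N}. norm (x k - x (k - 1))) = (\<Sum>k\<in>{0..<int N}. norm (x (k + 1) - x k))"
proof -
  have "periodic N (\<lambda>k. norm (x k - x (k - 1)))"
    using assms unfolding periodic_def by (metis diff_add_eq)
  from sum_periodic_shift[OF this] show ?thesis
    by simp
qed

lemma poly_length_nonneg: "poly_length N x \<ge> 0"
  by (simp add: poly_length_def sum_nonneg)

lemma poly_length_square:
  "(poly_length N x)\<^sup>2 = real N * (\<Sum>k\<in>{0..<int N}. (norm (x (k + 1) - x k))\<^sup>2)"
  by (simp add: poly_length_def sum_nonneg)

lemma periodic_edge_mod:
  assumes "periodic N x"
  shows "x (k mod int N + j) = x (k + j)"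
proof -
  have "k mod int N + j + k div int N * int N = (k div int N * int N + k mod int N) + j"
    by (simp only: ac_simps)
  also have "\<dots> = k + j"
    by (simp only: div_mult_mod_eq)
  finally have *: "k mod int N + j + k div int N * int N = k + j" .
  show ?thesis
    using periodic_add_mult[OF assms, of "k mod int N + j" "k div int N"] unfolding * by (rule sym)
qed

text \<open>One squared edge is at most the sum of all, so bounded length alone forces edges of
  order \<open>1 / sqrt N\<close>. This brings them below the thresholds of the flux estimates
  before anything is known about the regularity of the polygon.\<close>

lemma edge_le_poly_length:
  assumes "periodic N x" and "N > 0"
  shows "norm (x (k + 1) - x k) \<le> poly_length N x / sqrt (real N)"
proof -
  define j where "j = k mod int N"
  have j: "j \<in> {0..<int N}"
    using assms(2) by (simp add: j_def)
  have "norm (x (k + 1) - x k) = norm (x (j + 1) - x j)"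
    using periodic_edge_mod[OF assms(1), of k 1] periodic_mod[OF assms(1), of k] by (simp add: j_def)
  moreover have "(norm (x (j + 1) - x j))\<^sup>2 \<le> (\<Sum>k\<in>{0..<int N}. (norm (x (k + 1) - x k))\<^sup>2)"
    by (rule member_le_sum[OF j]) auto
  ultimately have "real N * (norm (x (k + 1) - x k))\<^sup>2 \<le> (poly_length N x)\<^sup>2"
    unfolding poly_length_square by (simp add: mult_left_mono)
  then have "(sqrt (real N) * norm (x (k + 1) - x k))\<^sup>2 \<le> (poly_length N x)\<^sup>2"
    by (simp add: power_mult_distrib)
  then have "sqrt (real N) * norm (x (k + 1) - x k) \<le> poly_length N x"
    using poly_length_nonneg by (rule power2_le_imp_le)
  then show ?thesis
    using assms(2) by (simp add: field_simps)
qed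

lemma abs_poly_flux_le:
  assumes "\<And>p. norm (Q p) \<le> q"
  shows "\<bar>poly_flux Q N x\<bar> \<le> q * poly_length N x"
proof -
  have q: "q \<ge> 0"
    using assms[of 0] norm_ge_zero order_trans by blast
  have "\<bar>wedge (Q (x k) + Q (x (k + 1))) (x (k + 1) - x k)\<bar> \<le> 2 * q * norm (x (k + 1) - x k)" for k
  proof -
    have "norm (Q (x k) + Q (x (k + 1))) \<le> 2 * q"
      using norm_triangle_ineq[of "Q (x k)" "Q (x (k + 1))"] assms[of "x k"] assms[of "x (k + 1)"] by simp
    then show ?thesis
      by (rule order_trans[OF abs_wedge_le mult_right_mono]) simp
  qed
  then have "\<bar>\<Sum>k\<in>{0..<int N}. wedge (Q (x k) + Q (x (k + 1))) (x (k + 1) - x k)\<bar>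
      \<le> (\<Sum>k\<in>{0..<int N}. 2 * q * norm (x (k + 1) - x k))"
    by (intro order_trans[OF sum_abs sum_mono])
  also have "\<dots> \<le> 2 * q * poly_length N x"
    unfolding sum_distrib_left[symmetric] using q sum_edges_le_poly_length[of x N]
    by (intro mult_left_mono) auto
  finally show ?thesis
    by (simp add: poly_flux_def)
qed

text \<open>Serves minimality in the presence of the confining penalty, which is Lipschitz but not
  differentiable: the smooth part of the energy can decrease at most at the rate
  \<open>c\<close>.\<close>

lemma one_sided_derivative_bound:
  fixes f :: "real \<Rightarrow> real"
  assumes "(f has_real_derivative D) (at 0)" and "\<And>s. f s \<ge> f 0 - c * \<bar>s\<bar>"
  shows "D \<ge> - c"
proof -
  have "((\<lambda>s. (f s - f 0) / (s - 0)) \<longlongrightarrow> D) (at 0)"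
    using assms(1) by (simp add: has_field_derivative_iff)
  then have lim: "((\<lambda>s. (f s - f 0) / (s - 0)) \<longlongrightarrow> D) (at_right 0)"
    by (rule filterlim_mono[OF _ order_refl]) (simp add: at_within_le_at)
  have "eventually (\<lambda>s. - c \<le> (f s - f 0) / (s - 0)) (at_right 0)"
    unfolding eventually_at_right_field
  proof (intro exI[of _ 1] conjI allI impI)
    fix s :: real
    assume "0 < s" "s < 1"
    then show "- c \<le> (f s - f 0) / (s - 0)"
      using assms(2)[of s] by (simp add: field_simps)
  qed simp
  from tendsto_lowerbound[OF lim this] show ?thesis
    by simp
qed

section \<open>The penalised energy: Euler-Lagrange inequality and existence of minimisers\<close>

definition poly_energy :: "(complex \<Rightarrow> complex) \<Rightarrow> real \<Rightarrow> real \<Rightarrow> nat \<Rightarrow> (int \<Rightarrow> complex) \<Rightarrow> real" where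
  "poly_energy Q K a0 N x = poly_length N x - poly_flux Q N x + K * (poly_area N x - a0)\<^sup>2"

text \<open>The confining penalty. It grows linearly and not quadratically: moving one vertex by
  \<open>h\<close> changes it by at most \<open>norm h / N\<close> wherever the polygon lies, so its
  effect on the Euler-Lagrange equation does not grow with the distance from the origin.\<close>

definition mean_norm :: "nat \<Rightarrow> (int \<Rightarrow> complex) \<Rightarrow> real" where
  "mean_norm N x = (\<Sum>k\<in>{0..<int N}. norm (x k)) / real N"

text \<open>Difference quotient for the parameter step \<open>1 / N\<close>: a polygon is regarded
  as a curve over the unit interval.\<close>

definition velocity :: "nat \<Rightarrow> (int \<Rightarrow> complex) \<Rightarrow> int \<Rightarrow> complex" where
  "velocity N x k = of_nat N * (x (k + 1) - x k)"

lemma velocity_periodic: "periodic N x \<Longrightarrow> periodic N (velocity N x)"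
  unfolding periodic_def velocity_def by (metis add.assoc add.commute)

lemma sum_periodic_delta:
  fixes f :: "int \<Rightarrow> real"
  assumes "periodic N f" and "N > 0" and "\<And>j. j mod int N \<noteq> k mod int N \<Longrightarrow> f j = 0"
  shows "(\<Sum>j\<in>{0..<int N}. f j) = f k"
proof -
  have "(\<Sum>j\<in>{0..<int N}. f j) = (\<Sum>j\<in>{k mod int N}. f j)"
  proof (rule sum.mono_neutral_right)
    show "\<forall>i\<in>{0..<int N} - {k mod int N}. f i = 0"
      using assms(3) by (metis DiffD1 DiffD2 atLeastLessThan_iff insertI1 mod_pos_pos_trivial)
  qed (use assms(2) in auto)
  then show ?thesis
    using periodic_mod[OF assms(1)] by simp
qed

text \<open>Only the residue class of one vertex is moved, in an arbitrary direction. The gradient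
  of the area is a multiple of \<open>\<i> * (x (k + 1) - x (k - 1))\<close>, hence the average of
  two consecutive velocities; \<open>\<mu>\<close> and \<open>\<epsilon>\<close> are the costs of
  the penalty and of discretising the flux.\<close>

lemma euler_lagrange:
  assumes "unif_div Q G" and "\<epsilon> > 0"
  obtains \<delta> where "\<delta> > 0"
    and "\<And>N x K a0 \<mu> k. N > 0 \<Longrightarrow> periodic N x \<Longrightarrow> \<mu> \<ge> 0 \<Longrightarrow> poly_length N x > 0
      \<Longrightarrow> (\<And>k. norm (x (k + 1) - x k) \<le> \<delta>)
      \<Longrightarrow> (\<And>y. periodic N y \<Longrightarrow> poly_energy Q K a0 N x + \<mu> * mean_norm N x
              \<le> poly_energy Q K a0 N y + \<mu> * mean_norm N y)
      \<Longrightarrow> norm (velocity N x k - velocity N x (k - 1)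
            - (poly_length N x / real N * (G (x k) - 2 * K * (poly_area N x - a0)))
                *\<^sub>R (\<i> * (velocity N x k + velocity N x (k - 1)) / 2))
          \<le> poly_length N x / real N *
              (\<mu> + \<epsilon> / 2 * (norm (velocity N x k) + norm (velocity N x (k - 1))))"
proof -
  obtain \<delta> where \<delta>: "\<delta> > 0"
    and flux: "\<And>N X \<phi> s0. periodic N (X s0) \<Longrightarrow> periodic N \<phi>
       \<Longrightarrow> (\<And>k. norm (X s0 (k + 1) - X s0 k) \<le> \<delta>)
       \<Longrightarrow> (\<And>k. ((\<lambda>s. X s k) has_vector_derivative \<phi> k) (at s0))
       \<Longrightarrow> \<exists>D. ((\<lambda>s. poly_flux Q N (X s)) has_real_derivative D) (at s0) \<and>
             \<bar>D - 1/2 * (\<Sum>k\<in>{0..<int N}. G (X s0 k) * wedge (\<phi> k) (X s0 (k + 1) - X s0 (k - 1)))\<bar>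
             \<le> \<epsilon> / 2 * (\<Sum>k\<in>{0..<int N}. norm (\<phi> k) *
                   (norm (X s0 (k + 1) - X s0 k) + norm (X s0 k - X s0 (k - 1))))"
    by (rule poly_flux_derivative[OF assms]) blast
  show ?thesis
  proof (rule that[OF \<delta>])
    fix N :: nat and x K a0 \<mu> k
    assume N: "N > 0" and per: "periodic N x" and \<mu>: "\<mu> \<ge> 0" and pos: "poly_length N x > 0"
      and small: "\<And>k. norm (x (k + 1) - x k) \<le> \<delta>"
      and min: "\<And>y. periodic N y \<Longrightarrow> poly_energy Q K a0 N x + \<mu> * mean_norm N x
              \<le> poly_energy Q K a0 N y + \<mu> * mean_norm N y"
    define lm where "lm = - 2 * K * (poly_area N x - a0)"
    define e where "e = norm (x (k + 1) - x k) + norm (x k - x (k - 1))"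
    define d where "d = x (k + 1) - x (k - 1)"
    \<comment> \<open>Up to the discretisation error of the flux, the gradient of the energy without
      penalty with respect to \<open>x k\<close>.\<close>
    define w where "w = (real N / poly_length N x) *\<^sub>R ((x k - x (k - 1)) - (x (k + 1) - x k))
        + ((G (x k) + lm) / 2) *\<^sub>R (\<i> * d)"
    have main: "h \<bullet> w \<ge> - ((\<mu> / real N + \<epsilon> / 2 * e) * norm h)" for h
    proof -
      define \<phi> where "\<phi> j = (if j mod int N = k mod int N then h else 0)" for j
      have per\<phi>: "periodic N \<phi>"
        by (simp add: periodic_def \<phi>_def)
      have \<phi>k: "\<phi> k = h"
        by (simp add: \<phi>_def)
      define X where "X s j = x j + s *\<^sub>R \<phi> j" for s j
      have X0: "X 0 = x"
        by (simp add: X_def fun_eq_iff)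
      have perX: "periodic N (X s)" for s
        using per per\<phi> by (simp add: periodic_def X_def)
      have dX: "((\<lambda>s. X s j) has_vector_derivative \<phi> j) (at 0)" for j
        unfolding X_def by (auto intro!: derivative_eq_intros)
      have shift: "x (j + int N - 1) = x (j - 1)" "x (j + int N + 1) = x (j + 1)" for j
        using periodicD[OF per, of "j - 1"] periodicD[OF per, of "j + 1"] by (simp_all add: algebra_simps)
      have sum_delta: "(\<Sum>j\<in>{0..<int N}. F j (\<phi> j)) = F k h"
        if "\<And>j z. F (j + int N) z = F j z" "\<And>j. F j 0 = 0" for F :: "int \<Rightarrow> complex \<Rightarrow> real"
        using sum_periodic_delta[of N "\<lambda>j. F j (\<phi> j)" k] that N per\<phi>
        by (auto simp: periodic_def \<phi>_def)
      obtain D where D: "((\<lambda>s. poly_flux Q N (X s)) has_real_derivative D) (at 0)"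
        and D': "\<bar>D - 1/2 * (\<Sum>j\<in>{0..<int N}. G (x j) * wedge (\<phi> j) (x (j + 1) - x (j - 1)))\<bar>
             \<le> \<epsilon> / 2 * (\<Sum>j\<in>{0..<int N}. norm (\<phi> j) * (norm (x (j + 1) - x j) + norm (x j - x (j - 1))))"
        using flux[of N X 0 \<phi>] per per\<phi> dX small unfolding X0 by blast
      have s1: "(\<Sum>j\<in>{0..<int N}. G (x j) * wedge (\<phi> j) (x (j + 1) - x (j - 1))) = G (x k) * wedge h d"
        unfolding d_def by (rule sum_delta) (simp_all add: periodicD[OF per] shift wedge.zero_left)
      have s2: "(\<Sum>j\<in>{0..<int N}. norm (\<phi> j) * (norm (x (j + 1) - x j) + norm (x j - x (j - 1)))) = norm h * e"
        unfolding e_def by (rule sum_delta) (simp_all add: periodicD[OF per] shift)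
      have s3: "(\<Sum>j\<in>{0..<int N}. wedge (\<phi> j) (x (j + 1) - x (j - 1))) = wedge h d"
        unfolding d_def by (rule sum_delta) (simp_all add: periodicD[OF per] shift wedge.zero_left)
      have s4: "(\<Sum>j\<in>{0..<int N}. \<phi> j \<bullet> ((x j - x (j - 1)) - (x (j + 1) - x j)))
          = h \<bullet> ((x k - x (k - 1)) - (x (k + 1) - x k))"
        by (rule sum_delta) (simp_all add: periodicD[OF per] shift)
      have s5: "(\<Sum>j\<in>{0..<int N}. norm (\<phi> j)) = norm h"
        by (rule sum_delta) simp_all
      have DA: "((\<lambda>s. poly_area N (X s)) has_real_derivative 1/2 * wedge h d) (at 0)"
        using poly_area_derivative[of N X 0 \<phi>] per per\<phi> dX unfolding X0 s3 by blast
      have DL: "((\<lambda>s. poly_length N (X s)) has_real_derivative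
          real N / poly_length N x * (h \<bullet> ((x k - x (k - 1)) - (x (k + 1) - x k)))) (at 0)"
        using poly_length_derivative[of N X 0 \<phi>] per per\<phi> dX pos unfolding X0 s4 by blast
      have DE: "((\<lambda>s. poly_energy Q K a0 N (X s)) has_real_derivative
          real N / poly_length N x * (h \<bullet> ((x k - x (k - 1)) - (x (k + 1) - x k))) - D
           + K * (2 * (poly_area N x - a0) * (1/2 * wedge h d))) (at 0)"
        unfolding poly_energy_def
        by (rule derivative_eq_intros DL D DA refl)+ (simp add: X0)
      have "poly_energy Q K a0 N (X s) \<ge> poly_energy Q K a0 N (X 0) - \<mu> / real N * norm h * \<bar>s\<bar>" for s
      proof -
        have "mean_norm N (X s) \<le> mean_norm N x + norm h * \<bar>s\<bar> / real N"
        proof -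
          have "(\<Sum>j\<in>{0..<int N}. norm (X s j)) \<le> (\<Sum>j\<in>{0..<int N}. norm (x j) + \<bar>s\<bar> * norm (\<phi> j))"
            unfolding X_def by (intro sum_mono) (metis norm_scaleR norm_triangle_ineq)
          also have "\<dots> = (\<Sum>j\<in>{0..<int N}. norm (x j)) + \<bar>s\<bar> * norm h"
            by (simp add: sum.distrib sum_distrib_left[symmetric] s5)
          finally show ?thesis
            unfolding mean_norm_def using N by (simp add: field_simps)
        qed
        then have "\<mu> * mean_norm N (X s) \<le> \<mu> * (mean_norm N x + norm h * \<bar>s\<bar> / real N)"
          using \<mu> by (rule mult_left_mono)
        then show ?thesis
          using min[OF perX[of s]] unfolding X0 by (simp add: algebra_simps)
      qed
      then have "real N / poly_length N x * (h \<bullet> ((x k - x (k - 1)) - (x (k + 1) - x k))) - D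
           + K * (2 * (poly_area N x - a0) * (1/2 * wedge h d)) \<ge> - (\<mu> / real N * norm h)"
        using one_sided_derivative_bound[OF DE] by blast
      moreover have "D \<ge> 1/2 * (G (x k) * wedge h d) - \<epsilon> / 2 * (norm h * e)"
        using D' unfolding s1 s2 by linarith
      moreover have "h \<bullet> w = real N / poly_length N x * (h \<bullet> ((x k - x (k - 1)) - (x (k + 1) - x k)))
          - 1/2 * (G (x k) * wedge h d) + K * (2 * (poly_area N x - a0) * (1/2 * wedge h d))"
        by (simp add: w_def lm_def wedge_eq_inner inner_add_right algebra_simps add_divide_distrib diff_divide_distrib)
      ultimately show ?thesis
        by (simp add: algebra_simps)
    qed
    have "norm w \<le> \<mu> / real N + \<epsilon> / 2 * e"
    proof (cases "w = 0")
      case True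
      then show ?thesis
        using \<mu> assms(2) by (simp add: e_def)
    next
      case False
      \<comment> \<open>The choice \<open>h = - w\<close> turns the one-sided bound in every
        direction into a bound on the norm.\<close>
      have "norm w * norm w \<le> (\<mu> / real N + \<epsilon> / 2 * e) * norm w"
        using main[of "- w"] by (simp add: power2_norm_eq_inner[symmetric] power2_eq_square)
      then show ?thesis
        using False by simp
    qed
    then have "poly_length N x * norm w \<le> poly_length N x * (\<mu> / real N + \<epsilon> / 2 * e)"
      using pos by (intro mult_left_mono) auto
    moreover have "poly_length N x * norm w = norm (velocity N x k - velocity N x (k - 1)
            - (poly_length N x / real N * (G (x k) + lm)) *\<^sub>R (\<i> * (velocity N x k + velocity N x (k - 1)) / 2))"
    proof -
      have "poly_length N x *\<^sub>R w = - (velocity N x k - velocity N x (k - 1)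
            - (poly_length N x / real N * (G (x k) + lm)) *\<^sub>R (\<i> * (velocity N x k + velocity N x (k - 1)) / 2))"
        using pos N by (simp add: w_def d_def velocity_def scaleR_conv_of_real field_simps)
      then show ?thesis
        using poly_length_nonneg[of N x] by (metis abs_of_nonneg norm_minus_cancel norm_scaleR)
    qed
    moreover have "e = (norm (velocity N x k) + norm (velocity N x (k - 1))) / real N"
      using N unfolding e_def velocity_def norm_mult by (simp add: distrib_left[symmetric])
    ultimately show "norm (velocity N x k - velocity N x (k - 1)
            - (poly_length N x / real N * (G (x k) - 2 * K * (poly_area N x - a0)))
                *\<^sub>R (\<i> * (velocity N x k + velocity N x (k - 1)) / 2))
          \<le> poly_length N x / real N *
              (\<mu> + \<epsilon> / 2 * (norm (velocity N x k) + norm (velocity N x (k - 1))))"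
      by (simp add: lm_def algebra_simps add_divide_distrib)
  qed
qed

lemma minimiser_exists:
  assumes Q: "continuous_on UNIV Q" "\<And>p. norm (Q p) \<le> q" and "q < 1" "K \<ge> 0" "\<mu> > 0" "N > 0"
  obtains x where "periodic N x"
    and "\<And>y. periodic N y \<Longrightarrow> poly_energy Q K a0 N x + \<mu> * mean_norm N x
              \<le> poly_energy Q K a0 N y + \<mu> * mean_norm N y"
proof -
  define f where "f y = poly_energy Q K a0 N y + \<mu> * mean_norm N y" for y
  define M where "M = f (\<lambda>_. 0)"
  \<comment> \<open>A vertex of norm above \<open>R\<close> makes the penalty alone at least
    \<open>M\<close>, the value of \<open>f\<close> at the polygon collapsed to 0.\<close>
  define R where "R = real N * M / \<mu>"
  \<comment> \<open>Compact by Tychonoff in the space of all integer sequences, where the periodic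
    ones form a closed set.\<close>
  define C where "C = {y. periodic N y} \<inter> PiE UNIV (\<lambda>_::int. cball (0::complex) R)"
  have E0: "poly_energy Q K a0 N y \<ge> 0" for y
  proof -
    have "poly_flux Q N y \<le> q * poly_length N y"
      using abs_poly_flux_le[of Q q N y, OF Q(2)] by simp
    also have "\<dots> \<le> 1 * poly_length N y"
      using assms(3) poly_length_nonneg by (intro mult_right_mono) auto
    finally show ?thesis
      using assms(4) by (simp add: poly_energy_def)
  qed
  have M: "M \<ge> 0"
    using E0[of "\<lambda>_. 0"] by (simp add: M_def f_def mean_norm_def)
  have "compactin (product_topology (\<lambda>_. euclidean) UNIV) (PiE UNIV (\<lambda>_::int. cball (0::complex) R))"
    by (simp add: compactin_PiE)
  then have "compact (PiE UNIV (\<lambda>_::int. cball (0::complex) R))"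
    by (simp add: euclidean_product_topology)
  moreover have "closed {y::int \<Rightarrow> complex. periodic N y}"
    unfolding periodic_def by (intro closed_Collect_all closed_Collect_eq) (auto intro!: continuous_intros)
  ultimately have C: "compact C"
    unfolding C_def by (simp add: closed_Int_compact)
  have "continuous_on UNIV f"
    unfolding f_def poly_energy_def mean_norm_def poly_length_def poly_flux_def poly_area_def
    using assms(6)
    by (intro continuous_intros wedge.continuous_on continuous_on_compose2[OF Q(1)]) auto
  then have cf: "continuous_on C f"
    using continuous_on_subset by blast
  have 0: "(\<lambda>_. 0) \<in> C"
    using M assms(5) by (auto simp: C_def periodic_def R_def)
  obtain x where x: "x \<in> C" "\<And>y. y \<in> C \<Longrightarrow> f x \<le> f y"
    using continuous_attains_inf[OF C _ cf] 0 by blast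
  show ?thesis
  proof (rule that[of x])
    show "periodic N x"
      using x(1) by (simp add: C_def)
    fix y :: "int \<Rightarrow> complex"
    assume y: "periodic N y"
    have "f x \<le> f y"
    proof (cases "y \<in> C")
      case False
      have "\<not> (\<forall>k. norm (y k) \<le> R)"
      proof
        assume "\<forall>k. norm (y k) \<le> R"
        then have "y \<in> C"
          using y by (auto simp: C_def)
        then show False
          using False by blast
      qed
      then obtain k where k: "norm (y k) > R"
        by (auto simp: not_le)
      have "norm (y (k mod int N)) \<le> (\<Sum>j\<in>{0..<int N}. norm (y j))"
        using assms(6) by (intro member_le_sum) auto
      then have "R < (\<Sum>j\<in>{0..<int N}. norm (y j))"
        using k periodic_mod[OF y, of k] by simp
      then have "M \<le> \<mu> * mean_norm N y"
        using assms(5,6) by (simp add: R_def mean_norm_def field_simps)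
      then have "M \<le> f y"
        using E0[of y] by (simp add: f_def)
      then show ?thesis
        using x(2)[OF 0] by (simp add: M_def)
    qed (use x(2) in blast)
    then show "poly_energy Q K a0 N x + \<mu> * mean_norm N x \<le> poly_energy Q K a0 N y + \<mu> * mean_norm N y"
      by (simp add: f_def)
  qed
qed


section \<open>Flux of polygons shrunk to a point\<close>

lemma flux_homothety_derivative:
  assumes "unif_div Q G" and "\<epsilon> > 0"
  obtains \<delta> where "\<delta> > 0"
    and "\<And>N x c R s. periodic N x \<Longrightarrow> (\<And>k. norm (x (k + 1) - x k) \<le> \<delta>)
       \<Longrightarrow> (\<And>k. norm (x k - c) \<le> R) \<Longrightarrow> 0 \<le> s \<Longrightarrow> s \<le> 1
       \<Longrightarrow> \<exists>D. ((\<lambda>s. poly_flux Q N (\<lambda>k. c + s *\<^sub>R (x k - c))) has_real_derivative D) (at s) \<and>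
             \<bar>D - s / 2 * (\<Sum>k\<in>{0..<int N}. G (c + s *\<^sub>R (x k - c)) * wedge (x k - c) (x (k + 1) - x (k - 1)))\<bar>
             \<le> s * \<epsilon> * R * poly_length N x"
proof -
  obtain \<delta> where \<delta>: "\<delta> > 0"
    and flux: "\<And>N X \<phi> s0. periodic N (X s0) \<Longrightarrow> periodic N \<phi>
       \<Longrightarrow> (\<And>k. norm (X s0 (k + 1) - X s0 k) \<le> \<delta>)
       \<Longrightarrow> (\<And>k. ((\<lambda>s. X s k) has_vector_derivative \<phi> k) (at s0))
       \<Longrightarrow> \<exists>D. ((\<lambda>s. poly_flux Q N (X s)) has_real_derivative D) (at s0) \<and>
             \<bar>D - 1/2 * (\<Sum>k\<in>{0..<int N}. G (X s0 k) * wedge (\<phi> k) (X s0 (k + 1) - X s0 (k - 1)))\<bar>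
             \<le> \<epsilon> / 2 * (\<Sum>k\<in>{0..<int N}. norm (\<phi> k) *
                   (norm (X s0 (k + 1) - X s0 k) + norm (X s0 k - X s0 (k - 1))))"
    by (rule poly_flux_derivative[OF assms]) blast
  show ?thesis
  proof (rule that[OF \<delta>])
    fix N :: nat and x :: "int \<Rightarrow> complex" and c R and s :: real
    assume per: "periodic N x" and small: "\<And>k. norm (x (k + 1) - x k) \<le> \<delta>"
      and R: "\<And>k. norm (x k - c) \<le> R" and s: "0 \<le> s" "s \<le> 1"
    define X where "X s k = c + s *\<^sub>R (x k - c)" for s k
    define \<phi> where "\<phi> k = x k - c" for k
    have dX: "X s k - X s j = s *\<^sub>R (x k - x j)" for k j
      by (simp add: X_def algebra_simps)
    have nX: "norm (X s k - X s j) = s * norm (x k - x j)" for k j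
      using s unfolding dX by simp
    have R0: "R \<ge> 0"
      using R[of 0] norm_ge_zero order_trans by blast
    have 1: "periodic N (X s)" and 2: "periodic N \<phi>"
      using per by (simp_all add: periodic_def X_def \<phi>_def)
    have 3: "norm (X s (k + 1) - X s k) \<le> \<delta>" for k
    proof -
      have "norm (X s (k + 1) - X s k) \<le> 1 * norm (x (k + 1) - x k)"
        using s unfolding nX by (intro mult_right_mono) auto
      then show ?thesis
        using small[of k] by simp
    qed
    have 4: "((\<lambda>s. X s k) has_vector_derivative \<phi> k) (at s)" for k
      unfolding X_def \<phi>_def by (auto intro!: derivative_eq_intros)
    obtain D where D: "((\<lambda>s. poly_flux Q N (X s)) has_real_derivative D) (at s)"
      "\<bar>D - 1/2 * (\<Sum>k\<in>{0..<int N}. G (X s k) * wedge (\<phi> k) (X s (k + 1) - X s (k - 1)))\<bar>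
             \<le> \<epsilon> / 2 * (\<Sum>k\<in>{0..<int N}. norm (\<phi> k) * (norm (X s (k + 1) - X s k) + norm (X s k - X s (k - 1))))"
      using flux[of N X s \<phi>, OF 1 2 3 4] by blast
    have e1: "1/2 * (\<Sum>k\<in>{0..<int N}. G (X s k) * wedge (\<phi> k) (X s (k + 1) - X s (k - 1)))
       = s / 2 * (\<Sum>k\<in>{0..<int N}. G (X s k) * wedge (\<phi> k) (x (k + 1) - x (k - 1)))"
      unfolding dX wedge.scaleR_right sum_distrib_left by (intro sum.cong) auto
    have "(\<Sum>k\<in>{0..<int N}. norm (\<phi> k) * (norm (X s (k + 1) - X s k) + norm (X s k - X s (k - 1))))
        \<le> (\<Sum>k\<in>{0..<int N}. (R * s) * (norm (x (k + 1) - x k) + norm (x k - x (k - 1))))"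
    proof (rule sum_mono)
      fix k
      have "norm (\<phi> k) * (s * (norm (x (k + 1) - x k) + norm (x k - x (k - 1))))
          \<le> R * (s * (norm (x (k + 1) - x k) + norm (x k - x (k - 1))))"
        using R s by (intro mult_right_mono) (auto simp: \<phi>_def)
      then show "norm (\<phi> k) * (norm (X s (k + 1) - X s k) + norm (X s k - X s (k - 1)))
          \<le> (R * s) * (norm (x (k + 1) - x k) + norm (x k - x (k - 1)))"
        unfolding nX by (simp add: algebra_simps)
    qed
    also have "\<dots> = (R * s) * (2 * (\<Sum>k\<in>{0..<int N}. norm (x (k + 1) - x k)))"
      unfolding sum_distrib_left[symmetric] sum.distrib sum_previous_edges[OF per] by simp
    also have "\<dots> \<le> (R * s) * (2 * poly_length N x)"
      using s R0 sum_edges_le_poly_length[of x N] by (intro mult_left_mono) auto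
    finally have "\<epsilon> / 2 * (\<Sum>k\<in>{0..<int N}. norm (\<phi> k) * (norm (X s (k + 1) - X s k) + norm (X s k - X s (k - 1))))
       \<le> \<epsilon> / 2 * ((R * s) * (2 * poly_length N x))"
      using assms(2) by (intro mult_left_mono) auto
    then have "\<bar>D - s / 2 * (\<Sum>k\<in>{0..<int N}. G (X s k) * wedge (\<phi> k) (x (k + 1) - x (k - 1)))\<bar>
         \<le> s * \<epsilon> * R * poly_length N x"
      using D(2) unfolding e1 by (simp add: mult_ac)
    then show "\<exists>D. ((\<lambda>s. poly_flux Q N (\<lambda>k. c + s *\<^sub>R (x k - c))) has_real_derivative D) (at s) \<and>
             \<bar>D - s / 2 * (\<Sum>k\<in>{0..<int N}. G (c + s *\<^sub>R (x k - c)) * wedge (x k - c) (x (k + 1) - x (k - 1)))\<bar>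
             \<le> s * \<epsilon> * R * poly_length N x"
      using D(1) unfolding X_def \<phi>_def by blast
  qed
qed

lemma poly_flux_const: "poly_flux Q N (\<lambda>k. c) = 0"
  by (simp add: poly_flux_def wedge.zero_right)

text \<open>Each edge is seen from both of its ends, hence the factor 4 in place of 2; the centre
  drops out because the polygon closes.\<close>

lemma sum_wedge_centred:
  assumes "periodic N x"
  shows "(\<Sum>k\<in>{0..<int N}. wedge (x k - c) (x (k + 1) - x (k - 1))) = 4 * poly_area N x"
proof -
  have "(\<Sum>k\<in>{0..<int N}. wedge (x k - c) (x (k + 1) - x (k - 1))) = (\<Sum>k\<in>{0..<int N}. 2 * wedge (x k) (x (k + 1)))"
  proof (rule sum_periodic_telescope)
    have "x (k + int N - 1) = x (k - 1)" for k
      using periodicD[OF assms, of "k - 1"] by (simp add: algebra_simps)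
    then show "periodic N (\<lambda>k. - wedge (x (k - 1)) (x k) - wedge c (x k) - wedge c (x (k - 1)))"
      using assms by (simp add: periodic_def)
  qed (simp add: wedge_def algebra_simps)
  then show ?thesis
    by (simp add: poly_area_def sum_distrib_left)
qed

lemma poly_area_translate:
  assumes "periodic N x"
  shows "poly_area N (\<lambda>k. x k - c) = poly_area N x"
proof -
  have "(\<Sum>k\<in>{0..<int N}. wedge (x k) (x (k + 1))) = (\<Sum>k\<in>{0..<int N}. wedge (x k - c) (x (k + 1) - c))"
  proof (rule sum_periodic_telescope)
    show "periodic N (\<lambda>k. wedge c (x k))"
      using assms by (simp add: periodic_def)
  qed (simp add: wedge_def algebra_simps)
  then show ?thesis
    by (simp add: poly_area_def)
qed

text \<open>A substitute for the divergence theorem that needs neither simple polygons nor an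
  enclosed region: the flux vanishes at the polygon collapsed to \<open>c\<close>, and the mean
  value theorem is applied along the homothety. The first bound serves polygons far out, where
  \<open>H\<close> is small, the second the test polygon, which turns counterclockwise around
  \<open>c\<close>.\<close>

lemma poly_flux_bounds:
  assumes "unif_div Q G" and "\<epsilon> > 0"
  obtains \<delta> where "\<delta> > 0"
    and "\<And>N x c R \<eta>. periodic N x \<Longrightarrow> (\<And>k. norm (x (k + 1) - x k) \<le> \<delta>)
       \<Longrightarrow> (\<And>k. norm (x k - c) \<le> R) \<Longrightarrow> (\<And>p. p \<in> cball c R \<Longrightarrow> \<bar>G p\<bar> \<le> \<eta>)
       \<Longrightarrow> \<bar>poly_flux Q N x\<bar> \<le> (\<eta> + \<epsilon>) * R * poly_length N x"
    and "\<And>N x c R g. periodic N x \<Longrightarrow> (\<And>k. norm (x (k + 1) - x k) \<le> \<delta>)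
       \<Longrightarrow> (\<And>k. norm (x k - c) \<le> R) \<Longrightarrow> (\<And>p. p \<in> cball c R \<Longrightarrow> g \<le> G p)
       \<Longrightarrow> (\<And>k. wedge (x k - c) (x (k + 1) - x (k - 1)) \<ge> 0)
       \<Longrightarrow> poly_flux Q N x \<ge> g * poly_area N x - \<epsilon> * R * poly_length N x"
proof -
  obtain \<delta> where \<delta>: "\<delta> > 0"
    and hom: "\<And>N x c R s. periodic N x \<Longrightarrow> (\<And>k. norm (x (k + 1) - x k) \<le> \<delta>)
       \<Longrightarrow> (\<And>k. norm (x k - c) \<le> R) \<Longrightarrow> 0 \<le> s \<Longrightarrow> s \<le> 1
       \<Longrightarrow> \<exists>D. ((\<lambda>s. poly_flux Q N (\<lambda>k. c + s *\<^sub>R (x k - c))) has_real_derivative D) (at s) \<and>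
             \<bar>D - s / 2 * (\<Sum>k\<in>{0..<int N}. G (c + s *\<^sub>R (x k - c)) * wedge (x k - c) (x (k + 1) - x (k - 1)))\<bar>
             \<le> s * \<epsilon> * R * poly_length N x"
    by (rule flux_homothety_derivative[OF assms]) blast
  show ?thesis
  proof (rule that[OF \<delta>])
    fix N :: nat and x c R \<eta>
    assume per: "periodic N x" and small: "\<And>k. norm (x (k + 1) - x k) \<le> \<delta>"
      and R: "\<And>k. norm (x k - c) \<le> R" and \<eta>: "\<And>p. p \<in> cball c R \<Longrightarrow> \<bar>G p\<bar> \<le> \<eta>"
    define f where "f s = poly_flux Q N (\<lambda>k. c + s *\<^sub>R (x k - c))" for s
    define S where "S s = (\<Sum>k\<in>{0..<int N}. G (c + s *\<^sub>R (x k - c)) * wedge (x k - c) (x (k + 1) - x (k - 1)))" for s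
    have R0: "R \<ge> 0"
      using R[of 0] norm_ge_zero order_trans by blast
    then have \<eta>0: "\<eta> \<ge> 0"
      using \<eta>[of c] by (simp add: order_trans[OF abs_ge_zero])
    obtain D where D: "\<And>s. 0 \<le> s \<Longrightarrow> s \<le> 1 \<Longrightarrow> (f has_real_derivative D s) (at s)"
      "\<And>s. 0 \<le> s \<Longrightarrow> s \<le> 1 \<Longrightarrow> \<bar>D s - s / 2 * S s\<bar> \<le> s * \<epsilon> * R * poly_length N x"
    proof -
      have "\<forall>s. \<exists>D. 0 \<le> s \<and> s \<le> 1 \<longrightarrow> (f has_real_derivative D) (at s) \<and>
          \<bar>D - s / 2 * S s\<bar> \<le> s * \<epsilon> * R * poly_length N x"
        using hom[OF per small R] unfolding f_def S_def by blast
      from choice[OF this] show ?thesis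
        using that by blast
    qed
    obtain s where s: "0 < s" "s < 1" "f 1 - f 0 = D s"
      using MVT2[of 0 1 f D] D(1) by auto
    have "\<bar>S s\<bar> \<le> (\<Sum>k\<in>{0..<int N}. (\<eta> * R) * (norm (x (k + 1) - x k) + norm (x k - x (k - 1))))"
      unfolding S_def
    proof (rule order_trans[OF sum_abs sum_mono])
      fix k
      have "norm (s *\<^sub>R (x k - c)) \<le> 1 * R"
        unfolding norm_scaleR using s R[of k] by (intro mult_mono) auto
      then have 1: "\<bar>G (c + s *\<^sub>R (x k - c))\<bar> \<le> \<eta>"
        by (intro \<eta>) (simp add: dist_norm)
      have "norm (x (k + 1) - x (k - 1)) \<le> norm (x (k + 1) - x k) + norm (x k - x (k - 1))"
        by norm
      then have "\<bar>wedge (x k - c) (x (k + 1) - x (k - 1))\<bar> \<le> R * (norm (x (k + 1) - x k) + norm (x k - x (k - 1)))"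
        using R[of k] R0 by (intro order_trans[OF abs_wedge_le mult_mono]) auto
      with 1 have "\<bar>G (c + s *\<^sub>R (x k - c))\<bar> * \<bar>wedge (x k - c) (x (k + 1) - x (k - 1))\<bar>
          \<le> \<eta> * (R * (norm (x (k + 1) - x k) + norm (x k - x (k - 1))))"
        using \<eta>0 by (intro mult_mono) auto
      then show "\<bar>G (c + s *\<^sub>R (x k - c)) * wedge (x k - c) (x (k + 1) - x (k - 1))\<bar>
          \<le> (\<eta> * R) * (norm (x (k + 1) - x k) + norm (x k - x (k - 1)))"
        by (simp add: abs_mult mult.assoc)
    qed
    also have "\<dots> = (\<eta> * R) * (2 * (\<Sum>k\<in>{0..<int N}. norm (x (k + 1) - x k)))"
      unfolding sum_distrib_left[symmetric] sum.distrib sum_previous_edges[OF per] by simp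
    also have "\<dots> \<le> (\<eta> * R) * (2 * poly_length N x)"
      using \<eta>0 R0 sum_edges_le_poly_length[of x N] by (intro mult_left_mono) auto
    finally have "s / 2 * \<bar>S s\<bar> \<le> s / 2 * ((\<eta> * R) * (2 * poly_length N x))"
      using s by (intro mult_left_mono) auto
    moreover have "\<bar>s / 2 * S s\<bar> = s / 2 * \<bar>S s\<bar>"
      using s by (simp add: abs_mult)
    moreover have "\<bar>D s - s / 2 * S s\<bar> \<le> s * \<epsilon> * R * poly_length N x"
      using D(2)[of s] s by simp
    ultimately have "\<bar>D s\<bar> \<le> s / 2 * ((\<eta> * R) * (2 * poly_length N x)) + s * \<epsilon> * R * poly_length N x"
      by linarith
    also have "\<dots> = s * ((\<eta> + \<epsilon>) * R * poly_length N x)"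
      by (simp add: algebra_simps)
    also have "\<dots> \<le> 1 * ((\<eta> + \<epsilon>) * R * poly_length N x)"
      using s \<eta>0 R0 assms(2) poly_length_nonneg[of N x] by (intro mult_right_mono) auto
    finally show "\<bar>poly_flux Q N x\<bar> \<le> (\<eta> + \<epsilon>) * R * poly_length N x"
      using s(3) by (simp add: f_def poly_flux_const)
  next
    fix N :: nat and x c R g
    assume per: "periodic N x" and small: "\<And>k. norm (x (k + 1) - x k) \<le> \<delta>"
      and R: "\<And>k. norm (x k - c) \<le> R" and g: "\<And>p. p \<in> cball c R \<Longrightarrow> g \<le> G p"
      and conv: "\<And>k. wedge (x k - c) (x (k + 1) - x (k - 1)) \<ge> 0"
    define f where "f s = poly_flux Q N (\<lambda>k. c + s *\<^sub>R (x k - c))" for s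
    define S where "S s = (\<Sum>k\<in>{0..<int N}. G (c + s *\<^sub>R (x k - c)) * wedge (x k - c) (x (k + 1) - x (k - 1)))" for s
    define B where "B = 2 * (g * poly_area N x) - \<epsilon> * R * poly_length N x"
    have R0: "R \<ge> 0"
      using R[of 0] norm_ge_zero order_trans by blast
    obtain D where D: "\<And>s. 0 \<le> s \<Longrightarrow> s \<le> 1 \<Longrightarrow> (f has_real_derivative D s) (at s)"
      "\<And>s. 0 \<le> s \<Longrightarrow> s \<le> 1 \<Longrightarrow> \<bar>D s - s / 2 * S s\<bar> \<le> s * \<epsilon> * R * poly_length N x"
    proof -
      have "\<forall>s. \<exists>D. 0 \<le> s \<and> s \<le> 1 \<longrightarrow> (f has_real_derivative D) (at s) \<and>
          \<bar>D - s / 2 * S s\<bar> \<le> s * \<epsilon> * R * poly_length N x"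
        using hom[OF per small R] unfolding f_def S_def by blast
      from choice[OF this] show ?thesis
        using that by blast
    qed
    \<comment> \<open>The derivative of the flux is bounded below by \<open>B * s\<close>, and the
      position of the intermediate \<open>s\<close> is unknown. Subtracting
      \<open>B * s^2 / 2\<close> first makes the sign of the derivative sufficient.\<close>
    have "\<exists>s. 0 < s \<and> s < 1 \<and> (f 1 - B * 1\<^sup>2 / 2) - (f 0 - B * 0\<^sup>2 / 2) = (1 - 0) * (D s - B * s)"
    proof (rule MVT2)
      fix s :: real
      assume "0 \<le> s" "s \<le> 1"
      then show "((\<lambda>s. f s - B * s\<^sup>2 / 2) has_real_derivative D s - B * s) (at s)"
        by (auto intro!: derivative_eq_intros D(1))
    qed simp
    then obtain s where s: "0 < s" "s < 1" "f 1 - B / 2 - f 0 = D s - B * s"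
      by auto
    have "g * (4 * poly_area N x) \<le> S s"
      unfolding S_def sum_wedge_centred[OF per, of c, symmetric] sum_distrib_left
    proof (rule sum_mono)
      fix k
      have "norm (s *\<^sub>R (x k - c)) \<le> 1 * R"
        unfolding norm_scaleR using s R[of k] by (intro mult_mono) auto
      then have "g \<le> G (c + s *\<^sub>R (x k - c))"
        by (intro g) (simp add: dist_norm)
      then show "g * wedge (x k - c) (x (k + 1) - x (k - 1))
          \<le> G (c + s *\<^sub>R (x k - c)) * wedge (x k - c) (x (k + 1) - x (k - 1))"
        using conv by (rule mult_right_mono)
    qed
    then have "s / 2 * (g * (4 * poly_area N x)) \<le> s / 2 * S s"
      using s by (intro mult_left_mono) auto
    moreover have "\<bar>D s - s / 2 * S s\<bar> \<le> s * \<epsilon> * R * poly_length N x"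
      using D(2)[of s] s by simp
    moreover have "B * s = s / 2 * (g * (4 * poly_area N x)) - s * \<epsilon> * R * poly_length N x"
      by (simp add: B_def algebra_simps)
    ultimately have "D s \<ge> B * s"
      by linarith
    then have "f 1 - f 0 \<ge> B / 2"
      using s(3) by linarith
    moreover have "\<epsilon> * R * poly_length N x \<ge> 0"
      using assms(2) R0 poly_length_nonneg by simp
    ultimately show "poly_flux Q N x \<ge> g * poly_area N x - \<epsilon> * R * poly_length N x"
      by (simp add: f_def poly_flux_const B_def)
  qed
qed

section \<open>Regular polygons as comparison curves\<close>

definition regular_polygon :: "nat \<Rightarrow> complex \<Rightarrow> real \<Rightarrow> int \<Rightarrow> complex" where
  "regular_polygon N c r k = c + of_real r * cis (2 * pi * of_int k / real N)"

lemma norm_cis_minus_1_le: "norm (cis t - 1) \<le> \<bar>t\<bar>"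
proof -
  have "(norm (cis t - 1))\<^sup>2 = (cos t - 1)\<^sup>2 + (sin t)\<^sup>2"
    by (simp add: cmod_power2)
  also have "\<dots> = 2 - 2 * cos t"
    using sin_cos_squared_add[of t] by (simp add: power2_eq_square algebra_simps)
  also have "\<dots> = (2 * sin (t / 2))\<^sup>2"
    using cos_double_sin[of "t / 2"] by (simp add: power2_eq_square)
  also have "\<dots> \<le> t\<^sup>2"
  proof -
    have "\<bar>2 * sin (t / 2)\<bar> \<le> \<bar>t\<bar>"
      using abs_sin_x_le_abs_x[of "t / 2"] by simp
    then show ?thesis
      by (simp add: abs_le_square_iff)
  qed
  finally show ?thesis
    by (metis abs_le_square_iff abs_norm_cancel)
qed

lemma regular_polygon_periodic:
  assumes "N > 0"
  shows "periodic N (regular_polygon N c r)"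
  unfolding periodic_def regular_polygon_def
proof
  fix k
  have "2 * pi * of_int (k + int N) / real N = 2 * pi * of_int k / real N + 2 * pi"
    using assms by (simp add: field_simps)
  then show "c + of_real r * cis (2 * pi * of_int (k + int N) / real N) = c + of_real r * cis (2 * pi * of_int k / real N)"
    by (simp add: cis.ctr)
qed

lemma regular_polygon_step:
  "regular_polygon N c r (k + 1) - c = (regular_polygon N c r k - c) * cis (2 * pi / real N)"
  by (simp add: regular_polygon_def cis_mult ring_distribs add_divide_distrib)

lemma norm_regular_polygon_centred: "r \<ge> 0 \<Longrightarrow> norm (regular_polygon N c r k - c) = r"
  by (simp add: regular_polygon_def norm_mult)

lemma regular_polygon_edge:
  assumes "r \<ge> 0"
  shows "norm (regular_polygon N c r (k + 1) - regular_polygon N c r k) \<le> 2 * pi * r / real N"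
proof -
  have "regular_polygon N c r (k + 1) - regular_polygon N c r k
      = (regular_polygon N c r k - c) * (cis (2 * pi / real N) - 1)"
    using regular_polygon_step[of N c r k] by (simp add: algebra_simps)
  then have "norm (regular_polygon N c r (k + 1) - regular_polygon N c r k) = r * norm (cis (2 * pi / real N) - 1)"
    by (simp add: norm_mult norm_regular_polygon_centred[OF assms])
  also have "\<dots> \<le> r * \<bar>2 * pi / real N\<bar>"
    using assms by (intro mult_left_mono norm_cis_minus_1_le)
  finally show ?thesis
    by (simp add: mult_ac)
qed

lemma poly_length_regular_polygon:
  assumes "r \<ge> 0" and "N > 0"
  shows "poly_length N (regular_polygon N c r) \<le> 2 * pi * r"
proof (rule power2_le_imp_le)
  have "(\<Sum>k\<in>{0..<int N}. (norm (regular_polygon N c r (k + 1) - regular_polygon N c r k))\<^sup>2)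
      \<le> (\<Sum>k\<in>{0..<int N}. (2 * pi * r / real N)\<^sup>2)"
    by (intro sum_mono power_mono regular_polygon_edge assms) simp
  then have "real N * (\<Sum>k\<in>{0..<int N}. (norm (regular_polygon N c r (k + 1) - regular_polygon N c r k))\<^sup>2)
      \<le> real N * (real N * (2 * pi * r / real N)\<^sup>2)"
    by (intro mult_left_mono) auto
  then show "(poly_length N (regular_polygon N c r))\<^sup>2 \<le> (2 * pi * r)\<^sup>2"
    using assms(2) unfolding poly_length_square by (simp add: power2_eq_square)
qed (use assms in auto)

lemma wedge_mult_cis: "wedge z (z * cis t) = (norm z)\<^sup>2 * sin t"
  by (simp add: wedge_def cmod_power2) (simp add: power2_eq_square algebra_simps)

lemma regular_polygon_convex:
  assumes "r \<ge> 0" and "N \<ge> 2"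
  shows "wedge (regular_polygon N c r k - c) (regular_polygon N c r (k + 1) - regular_polygon N c r (k - 1)) \<ge> 0"
proof -
  define z where "z = regular_polygon N c r k - c"
  define w where "w = regular_polygon N c r (k - 1) - c"
  have z: "z = w * cis (2 * pi / real N)"
    using regular_polygon_step[of N c r "k - 1"] by (simp add: z_def w_def)
  have "regular_polygon N c r (k + 1) - regular_polygon N c r (k - 1) = z * cis (2 * pi / real N) - w"
  proof -
    have "regular_polygon N c r (k + 1) - regular_polygon N c r (k - 1) = (regular_polygon N c r (k + 1) - c) - w"
      by (simp add: w_def)
    then show ?thesis
      unfolding regular_polygon_step z_def .
  qed
  moreover have "wedge z (z * cis (2 * pi / real N) - w)
      = (norm z)\<^sup>2 * sin (2 * pi / real N) + wedge w (w * cis (2 * pi / real N))"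
  proof -
    have "- wedge z w = wedge w (w * cis (2 * pi / real N))"
      by (simp add: z wedge_def algebra_simps)
    then show ?thesis
      by (simp add: wedge.diff_right wedge_mult_cis)
  qed
  \<comment> \<open>For \<open>N \<ge> 2\<close> the central angle is at most
    \<open>pi\<close>.\<close>
  moreover have "sin (2 * pi / real N) \<ge> 0"
    using assms(2) by (intro sin_ge_zero) (auto simp: field_simps)
  ultimately show ?thesis
    by (simp add: wedge_mult_cis z_def[symmetric])
qed

lemma poly_area_regular_polygon:
  assumes "r \<ge> 0" and "N > 0"
  shows "poly_area N (regular_polygon N c r) = r\<^sup>2 / 2 * (real N * sin (2 * pi / real N))"
proof -
  have "poly_area N (regular_polygon N c r) = poly_area N (\<lambda>k. regular_polygon N c r k - c)"
    by (rule poly_area_translate[symmetric, OF regular_polygon_periodic[OF assms(2)]])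
  also have "\<dots> = 1/2 * (\<Sum>k\<in>{0..<int N}. r\<^sup>2 * sin (2 * pi / real N))"
    unfolding poly_area_def regular_polygon_step wedge_mult_cis norm_regular_polygon_centred[OF assms(1)] ..
  finally show ?thesis
    by simp
qed

lemma poly_area_regular_polygon_tendsto:
  assumes "r \<ge> 0"
  shows "(\<lambda>N. poly_area N (regular_polygon N c r)) \<longlonglongrightarrow> pi * r\<^sup>2"
proof -
  have "((\<lambda>h::real. sin h / h) \<longlongrightarrow> 1) (at 0)"
    using DERIV_sin[of 0] by (simp add: DERIV_def)
  moreover have "filterlim (\<lambda>N. 2 * pi / real N) (at 0) sequentially"
    unfolding filterlim_at
    by (auto intro: lim_const_over_n eventually_mono[OF eventually_gt_at_top[of 0]])
  ultimately have "(\<lambda>N. sin (2 * pi / real N) / (2 * pi / real N)) \<longlonglongrightarrow> 1"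
    by (rule filterlim_compose)
  then have "(\<lambda>N. pi * r\<^sup>2 * (sin (2 * pi / real N) / (2 * pi / real N))) \<longlonglongrightarrow> pi * r\<^sup>2 * 1"
    by (intro tendsto_mult tendsto_const)
  moreover have "\<forall>\<^sub>F N in sequentially. pi * r\<^sup>2 * (sin (2 * pi / real N) / (2 * pi / real N))
      = poly_area N (regular_polygon N c r)"
    using eventually_gt_at_top[of 0] by eventually_elim (simp add: poly_area_regular_polygon[OF assms])
  ultimately show ?thesis
    using Lim_transform_eventually by fastforce
qed


section \<open>Limits of polygons\<close>

text \<open>Tychonoff in place of Arzela-Ascoli. The index type may be the real line, and no
  diagonal sequence is extracted: convergence at every \<open>t\<close> holds along one filter
  \<open>F\<close> finer than \<open>sequentially\<close>.\<close>

lemma pointwise_cluster_filter: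
  fixes f :: "nat \<Rightarrow> 'a \<Rightarrow> 'b::heine_borel"
  assumes "\<And>t. bounded (range (\<lambda>n. f n t))"
  obtains F g where "F \<noteq> bot" "F \<le> sequentially" "\<And>t. ((\<lambda>n. f n t) \<longlongrightarrow> g t) F"
proof -
  define K where "K t = closure (range (\<lambda>n. f n t))" for t
  define U where "U = PiE UNIV K"
  have "compact (K t)" for t
    using bounded_closure[OF assms] by (simp add: K_def compact_eq_bounded_closed)
  then have "compactin (product_topology (\<lambda>_. euclidean) UNIV) U"
    by (simp add: U_def compactin_PiE)
  then have U: "compact U"
    by (simp add: euclidean_product_topology)
  have fU: "f n \<in> U" for n
    using closure_subset by (fastforce simp: U_def K_def PiE_def)
  have "filtermap f sequentially \<noteq> bot"
    by (simp add: filtermap_bot_iff)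
  moreover have "eventually (\<lambda>x. x \<in> U) (filtermap f sequentially)"
    by (simp add: eventually_filtermap fU)
  ultimately obtain g where g: "inf (nhds g) (filtermap f sequentially) \<noteq> bot"
    using U unfolding compact_filter by meson
  \<comment> \<open>Large indices \<open>n\<close> for which \<open>f n\<close> is close to
    \<open>g\<close>; the filter is proper because \<open>g\<close> is a cluster point.\<close>
  define F where "F = inf (filtercomap f (nhds g)) sequentially"
  have "F \<noteq> bot"
  proof
    assume "F = bot"
    then have "eventually (\<lambda>_. False) F"
      by simp
    then obtain P Q where P: "eventually P (filtercomap f (nhds g))" and Q: "eventually Q sequentially"
      and PQ: "\<And>n. P n \<Longrightarrow> Q n \<Longrightarrow> False"
      unfolding F_def eventually_inf by auto
    obtain P' where P': "eventually P' (nhds g)" "\<And>n. P' (f n) \<Longrightarrow> P n"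
      using P unfolding eventually_filtercomap by auto
    have "eventually (\<lambda>x. \<not> P' x) (filtermap f sequentially)"
      unfolding eventually_filtermap using Q by eventually_elim (use P'(2) PQ in blast)
    with P'(1) have "eventually (\<lambda>_. False) (inf (nhds g) (filtermap f sequentially))"
      unfolding eventually_inf by blast
    then show False
      using g by (simp add: trivial_limit_def)
  qed
  moreover have "F \<le> sequentially"
    by (simp add: F_def)
  moreover have "((\<lambda>n. f n t) \<longlongrightarrow> g t) F" for t
  proof -
    have "filterlim f (nhds g) F"
      unfolding F_def by (rule filterlim_mono[OF filterlim_filtercomap]) auto
    then have lim: "(f \<longlongrightarrow> g) F" .
    show ?thesis
    proof (rule topological_tendstoI)
      fix S :: "'b set"
      assume S: "open S" "g t \<in> S"
      have "open ((\<lambda>x::'a \<Rightarrow> 'b. x t) -` S)"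
        using continuous_on_product_coordinates[of t] S(1) by (rule open_vimage[rotated])
      then have "eventually (\<lambda>n. f n \<in> (\<lambda>x. x t) -` S) F"
        using S(2) by (intro topological_tendstoD[OF lim]) auto
      then show "eventually (\<lambda>n. f n t \<in> S) F"
        by simp
    qed
  qed
  ultimately show ?thesis
    by (rule that)
qed

text \<open>The pairs \<open>(n, j)\<close> such that \<open>n\<close> tends to infinity along \<open>F\<close> and the grid point \<open>j / N n\<close> tends to \<open>s\<close>.\<close>

definition grid_filter :: "(nat \<Rightarrow> nat) \<Rightarrow> nat filter \<Rightarrow> real \<Rightarrow> (nat \<times> int) filter" where
  "grid_filter N F s = inf (filtercomap fst F) (filtercomap (\<lambda>p. of_int (snd p) / real (N (fst p))) (nhds s))"

lemma filterlim_fst_grid: "filterlim fst F (grid_filter N F s)"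
  unfolding grid_filter_def by (rule filterlim_mono[OF filterlim_filtercomap]) auto

lemma tendsto_grid: "((\<lambda>p. of_int (snd p) / real (N (fst p))) \<longlongrightarrow> s) (grid_filter N F s)"
  unfolding grid_filter_def by (rule filterlim_mono[OF filterlim_filtercomap]) auto

lemma eventually_grid:
  assumes "eventually P (grid_filter N F s)"
  obtains \<delta> where "\<delta> > 0"
    and "eventually (\<lambda>n. \<forall>j. \<bar>of_int j / real (N n) - s\<bar> < \<delta> \<longrightarrow> P (n, j)) F"
proof -
  obtain A B where A: "eventually A (filtercomap fst F)"
    and B: "eventually B (filtercomap (\<lambda>p. of_int (snd p) / real (N (fst p))) (nhds s))"
    and AB: "\<And>p. A p \<Longrightarrow> B p \<Longrightarrow> P p"
    using assms unfolding grid_filter_def eventually_inf by blast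
  obtain A' where A': "eventually A' F" "\<And>p. A' (fst p) \<Longrightarrow> A p"
    using A unfolding eventually_filtercomap by blast
  obtain B' where B': "eventually B' (nhds s)" "\<And>p. B' (of_int (snd p) / real (N (fst p))) \<Longrightarrow> B p"
    using B unfolding eventually_filtercomap by blast
  obtain \<delta> where \<delta>: "\<delta> > 0" "\<And>t. dist t s < \<delta> \<Longrightarrow> B' t"
    using B'(1) unfolding eventually_nhds_metric by blast
  show ?thesis
  proof (rule that[OF \<delta>(1)])
    show "eventually (\<lambda>n. \<forall>j. \<bar>of_int j / real (N n) - s\<bar> < \<delta> \<longrightarrow> P (n, j)) F"
      using A'(1)
    proof eventually_elim
      case (elim n)
      show ?case
        using elim A'(2) B'(2) \<delta>(2) AB by (metis dist_real_def fst_conv snd_conv)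
    qed
  qed
qed

locale grid_limit =
  fixes N :: "nat \<Rightarrow> nat" and F :: "nat filter"
  assumes Nlim: "filterlim N at_top F"
begin

lemma inverse_tendsto_0: "((\<lambda>n. 1 / real (N n)) \<longlongrightarrow> 0) F"
proof -
  have "filterlim (\<lambda>n. real (N n)) at_top F"
    by (rule filterlim_compose[OF filterlim_real_sequentially Nlim])
  then show ?thesis
    using tendsto_inverse_0_at_top by (simp add: inverse_eq_divide[symmetric])
qed

lemma N_pos: "eventually (\<lambda>n. N n > 0) F"
  by (rule eventually_compose_filterlim[OF eventually_gt_at_top Nlim])

lemma floor_tendsto: "((\<lambda>n. of_int \<lfloor>real (N n) * t\<rfloor> / real (N n)) \<longlongrightarrow> t) F"
proof (rule tendsto_sandwich)
  show "eventually (\<lambda>n. t - 1 / real (N n) \<le> of_int \<lfloor>real (N n) * t\<rfloor> / real (N n)) F"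
    using N_pos
  proof eventually_elim
    case (elim n)
    have "real (N n) * t - 1 \<le> of_int \<lfloor>real (N n) * t\<rfloor>"
      by linarith
    then have "(real (N n) * t - 1) / real (N n) \<le> of_int \<lfloor>real (N n) * t\<rfloor> / real (N n)"
      by (rule divide_right_mono) simp
    then show ?case
      using elim by (simp add: diff_divide_distrib)
  qed
  show "eventually (\<lambda>n. of_int \<lfloor>real (N n) * t\<rfloor> / real (N n) \<le> t) F"
    using N_pos
  proof eventually_elim
    case (elim n)
    have "of_int \<lfloor>real (N n) * t\<rfloor> \<le> real (N n) * t"
      by linarith
    then show ?case
      using elim by (simp add: field_simps)
  qed
  show "((\<lambda>n. t - 1 / real (N n)) \<longlongrightarrow> t) F"
    using tendsto_diff[OF tendsto_const inverse_tendsto_0] by simp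
qed simp

lemma grid_shift: "filterlim (\<lambda>p. (fst p, snd p + 1)) (grid_filter N F s) (grid_filter N F s)"
proof -
  have 1: "filterlim (\<lambda>p. (fst p, snd p + 1)) (filtercomap fst F) (grid_filter N F s)"
    unfolding filterlim_filtercomap_iff by (simp add: o_def filterlim_fst_grid)
  have "((\<lambda>p. of_int (snd p) / real (N (fst p)) + 1 / real (N (fst p))) \<longlongrightarrow> s + 0) (grid_filter N F s)"
    by (intro tendsto_add tendsto_grid filterlim_compose[OF inverse_tendsto_0 filterlim_fst_grid])
  then have 2: "filterlim (\<lambda>p. (fst p, snd p + 1)) (filtercomap (\<lambda>p. of_int (snd p) / real (N (fst p))) (nhds s)) (grid_filter N F s)"
    unfolding filterlim_filtercomap_iff by (simp add: o_def add_divide_distrib)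
  have "filterlim (\<lambda>p. (fst p, snd p + 1)) (inf (filtercomap fst F)
      (filtercomap (\<lambda>p. of_int (snd p) / real (N (fst p))) (nhds s))) (grid_filter N F s)"
    using 1 2 by (simp add: filterlim_inf)
  then show ?thesis
    unfolding grid_filter_def .
qed

end

section \<open>Differentiability of limits of grid functions\<close>

lemma increments_bound_upward:
  fixes y :: "int \<Rightarrow> 'b::real_normed_vector"
  assumes "j \<le> k" and "\<And>i. j \<le> i \<Longrightarrow> i < k \<Longrightarrow> norm (c *\<^sub>R (y (i + 1) - y i) - D) \<le> \<epsilon>"
  shows "norm (c *\<^sub>R (y k - y j) - of_int (k - j) *\<^sub>R D) \<le> \<epsilon> * of_int (k - j)"
  using assms
proof (induction k rule: int_ge_induct)
  case (step i)
  have "c *\<^sub>R (y (i + 1) - y j) - of_int (i + 1 - j) *\<^sub>R D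
      = (c *\<^sub>R (y i - y j) - of_int (i - j) *\<^sub>R D) + (c *\<^sub>R (y (i + 1) - y i) - D)"
    by (simp add: algebra_simps)
  also have "norm \<dots> \<le> \<epsilon> * of_int (i - j) + \<epsilon>"
    using step by (intro norm_triangle_le add_mono) auto
  finally show ?case
    by (simp add: algebra_simps)
qed simp

text \<open>Discrete mean value inequality. With \<open>D = 0\<close> it gives Lipschitz bounds,
  with \<open>D\<close> a limit of difference quotients it gives differentiability of the
  limit.\<close>

lemma increments_bound:
  fixes y :: "int \<Rightarrow> 'b::real_normed_vector"
  assumes "\<And>i. min j k \<le> i \<Longrightarrow> i < max j k \<Longrightarrow> norm (c *\<^sub>R (y (i + 1) - y i) - D) \<le> \<epsilon>"
  shows "norm (c *\<^sub>R (y k - y j) - of_int (k - j) *\<^sub>R D) \<le> \<epsilon> * \<bar>of_int (k - j)\<bar>"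
proof (cases "j \<le> k")
  case True
  then show ?thesis
    using increments_bound_upward[of j k c y D \<epsilon>] assms by (simp add: min_def max_def)
next
  case False
  then have "norm (c *\<^sub>R (y j - y k) - of_int (j - k) *\<^sub>R D) \<le> \<epsilon> * of_int (j - k)"
    using increments_bound_upward[of k j c y D \<epsilon>] assms by (simp add: min_def max_def)
  moreover have "c *\<^sub>R (y j - y k) - of_int (j - k) *\<^sub>R D = - (c *\<^sub>R (y k - y j) - of_int (k - j) *\<^sub>R D)"
    by (simp add: algebra_simps)
  ultimately show ?thesis
    using False by (metis abs_minus_commute abs_of_nonneg diff_ge_0_iff_ge linear norm_minus_cancel of_int_0_le_iff of_int_diff)
qed

lemma lipschitz_increments:
  fixes y :: "int \<Rightarrow> 'b::real_normed_vector"
  assumes "\<And>i. norm (real N *\<^sub>R (y (i + 1) - y i)) \<le> C" and "N > 0"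
  shows "norm (y k - y j) \<le> C * \<bar>of_int k / real N - of_int j / real N\<bar>"
proof -
  have "real N * norm (y k - y j) \<le> C * \<bar>of_int (k - j)\<bar>"
    using increments_bound[of j k "real N" y 0 C] assms(1) by simp
  moreover have "\<bar>of_int k / real N - of_int j / real N\<bar> = \<bar>of_int (k - j)\<bar> / real N"
    using assms(2) by (simp add: diff_divide_distrib[symmetric])
  ultimately show ?thesis
    using assms(2) by (simp add: field_simps)
qed

context grid_limit
begin

text \<open>Uniform Lipschitz bounds upgrade convergence along the one index
  \<open>floor (N * s)\<close> to continuous convergence: all choices of grid points that tend to
  \<open>s\<close> give the same limit.\<close>

lemma lipschitz_tendsto_grid:
  fixes y :: "nat \<Rightarrow> int \<Rightarrow> 'b::real_normed_vector"
  assumes "((\<lambda>n. y n \<lfloor>real (N n) * s\<rfloor>) \<longlongrightarrow> Y) F"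
    and "eventually (\<lambda>n. \<forall>j. norm (real (N n) *\<^sub>R (y n (j + 1) - y n j)) \<le> C) F"
  shows "((\<lambda>p. y (fst p) (snd p)) \<longlongrightarrow> Y) (grid_filter N F s)"
proof -
  let ?G = "grid_filter N F s"
  have ev: "eventually (\<lambda>n. N n > 0 \<and> (\<forall>j. norm (real (N n) *\<^sub>R (y n (j + 1) - y n j)) \<le> C)) F"
    using N_pos assms(2) by eventually_elim auto
  have "((\<lambda>p. y (fst p) (snd p) - y (fst p) \<lfloor>real (N (fst p)) * s\<rfloor>) \<longlongrightarrow> 0) ?G"
  proof (rule Lim_null_comparison)
    show "eventually (\<lambda>p. norm (y (fst p) (snd p) - y (fst p) \<lfloor>real (N (fst p)) * s\<rfloor>)
        \<le> C * \<bar>of_int (snd p) / real (N (fst p)) - of_int \<lfloor>real (N (fst p)) * s\<rfloor> / real (N (fst p))\<bar>) ?G"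
      using eventually_compose_filterlim[OF ev filterlim_fst_grid]
      by eventually_elim (auto intro!: lipschitz_increments)
    have "((\<lambda>p. C * \<bar>of_int (snd p) / real (N (fst p)) - of_int \<lfloor>real (N (fst p)) * s\<rfloor> / real (N (fst p))\<bar>)
        \<longlongrightarrow> C * \<bar>s - s\<bar>) ?G"
      by (intro tendsto_intros tendsto_grid filterlim_compose[OF floor_tendsto filterlim_fst_grid])
    then show "((\<lambda>p. C * \<bar>of_int (snd p) / real (N (fst p)) - of_int \<lfloor>real (N (fst p)) * s\<rfloor> / real (N (fst p))\<bar>)
        \<longlongrightarrow> 0) ?G"
      by simp
  qed
  from tendsto_add[OF this filterlim_compose[OF assms(1) filterlim_fst_grid]] show ?thesis
    by simp
qed

text \<open>Neither interpolation nor integrals are used: difference quotients that converge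
  continuously at \<open>s\<close> are within \<open>e\<close> of \<open>D\<close> on a whole
  neighbourhood, and summing them between the indices of \<open>s\<close> and \<open>t\<close>
  controls the increment of the limit.\<close>

lemma limit_has_vector_derivative:
  fixes y :: "nat \<Rightarrow> int \<Rightarrow> 'b::real_normed_vector"
  assumes F: "F \<noteq> bot" and lim: "\<And>t. ((\<lambda>n. y n \<lfloor>real (N n) * t\<rfloor>) \<longlongrightarrow> Y t) F"
    and D: "((\<lambda>p. real (N (fst p)) *\<^sub>R (y (fst p) (snd p + 1) - y (fst p) (snd p))) \<longlongrightarrow> D) (grid_filter N F s)"
  shows "(Y has_vector_derivative D) (at s)"
  unfolding has_vector_derivative_def has_derivative_at_alt
proof (intro conjI allI impI bounded_linear_scaleR_left)
  fix e :: real
  assume e: "0 < e"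
  have "eventually (\<lambda>p. dist (real (N (fst p)) *\<^sub>R (y (fst p) (snd p + 1) - y (fst p) (snd p))) D < e) (grid_filter N F s)"
    using D e by (rule tendstoD)
  then obtain \<delta> where \<delta>: "\<delta> > 0"
    and ev: "eventually (\<lambda>n. \<forall>j. \<bar>of_int j / real (N n) - s\<bar> < \<delta> \<longrightarrow> dist (real (N n) *\<^sub>R (y n (j + 1) - y n j)) D < e) F"
    by (rule eventually_grid) auto
  show "\<exists>d>0. \<forall>t. norm (t - s) < d \<longrightarrow> norm (Y t - Y s - (t - s) *\<^sub>R D) \<le> e * norm (t - s)"
  proof (intro exI[of _ "\<delta> / 2"] conjI allI impI)
    fix t :: real
    assume t: "norm (t - s) < \<delta> / 2"
    \<comment> \<open>An index may miss its parameter by one grid step, which adds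
      \<open>1 / N\<close> to the distance from \<open>s\<close>.\<close>
    have close: "eventually (\<lambda>n. 1 / real (N n) < \<delta> / 2) F"
      using inverse_tendsto_0 \<delta> by (intro order_tendstoD) auto
    let ?j = "\<lambda>n. \<lfloor>real (N n) * s\<rfloor>" and ?k = "\<lambda>n. \<lfloor>real (N n) * t\<rfloor>"
    have "eventually (\<lambda>n. norm (y n (?k n) - y n (?j n) - (of_int (?k n) / real (N n) - of_int (?j n) / real (N n)) *\<^sub>R D)
        \<le> e * \<bar>of_int (?k n) / real (N n) - of_int (?j n) / real (N n)\<bar>) F"
      using ev close N_pos
    proof eventually_elim
      case (elim n)
      have "norm (real (N n) *\<^sub>R (y n (?k n) - y n (?j n)) - of_int (?k n - ?j n) *\<^sub>R D) \<le> e * \<bar>of_int (?k n - ?j n)\<bar>"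
      proof (rule increments_bound)
        fix i
        assume i: "min (?j n) (?k n) \<le> i" "i < max (?j n) (?k n)"
        have "\<bar>of_int i - real (N n) * s\<bar> \<le> real (N n) * \<bar>t - s\<bar> + 1"
        proof -
          have "\<bar>real (N n) * t - real (N n) * s\<bar> = real (N n) * \<bar>t - s\<bar>"
            by (simp add: right_diff_distrib[symmetric] abs_mult)
          then show ?thesis
            using i by linarith
        qed
        then have "\<bar>of_int i / real (N n) - s\<bar> \<le> \<bar>t - s\<bar> + 1 / real (N n)"
        proof -
          have "of_int i / real (N n) - s = (of_int i - real (N n) * s) / real (N n)"
            using elim by (simp add: field_simps)
          then have "\<bar>of_int i / real (N n) - s\<bar> = \<bar>of_int i - real (N n) * s\<bar> / real (N n)"
            by simp
          also have "\<dots> \<le> (real (N n) * \<bar>t - s\<bar> + 1) / real (N n)"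
            using \<open>\<bar>of_int i - real (N n) * s\<bar> \<le> real (N n) * \<bar>t - s\<bar> + 1\<close> by (rule divide_right_mono) simp
          finally show ?thesis
            using elim by (simp add: add_divide_distrib)
        qed
        then have "\<bar>of_int i / real (N n) - s\<bar> < \<delta>"
          using t elim(2) by simp
        then show "norm (real (N n) *\<^sub>R (y n (i + 1) - y n i) - D) \<le> e"
          using elim(1) by (simp add: dist_norm less_imp_le)
      qed
      moreover have "real (N n) *\<^sub>R (y n (?k n) - y n (?j n) - (of_int (?k n) / real (N n) - of_int (?j n) / real (N n)) *\<^sub>R D)
          = real (N n) *\<^sub>R (y n (?k n) - y n (?j n)) - of_int (?k n - ?j n) *\<^sub>R D"
        using elim(3) by (simp add: scaleR_diff_right scaleR_diff_left right_diff_distrib)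
      moreover have "e * \<bar>of_int (?k n - ?j n)\<bar>
          = real (N n) * (e * \<bar>of_int (?k n) / real (N n) - of_int (?j n) / real (N n)\<bar>)"
        using elim(3) by (simp add: diff_divide_distrib[symmetric])
      ultimately have "norm (real (N n) *\<^sub>R (y n (?k n) - y n (?j n) - (of_int (?k n) / real (N n) - of_int (?j n) / real (N n)) *\<^sub>R D))
          \<le> real (N n) * (e * \<bar>of_int (?k n) / real (N n) - of_int (?j n) / real (N n)\<bar>)"
        by (simp only:)
      then have "real (N n) * norm (y n (?k n) - y n (?j n) - (of_int (?k n) / real (N n) - of_int (?j n) / real (N n)) *\<^sub>R D)
          \<le> real (N n) * (e * \<bar>of_int (?k n) / real (N n) - of_int (?j n) / real (N n)\<bar>)"
        by (simp only: norm_scaleR abs_of_nat)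
      then show ?case
        using elim(3) by simp
    qed
    moreover have "((\<lambda>n. norm (y n (?k n) - y n (?j n) - (of_int (?k n) / real (N n) - of_int (?j n) / real (N n)) *\<^sub>R D))
        \<longlongrightarrow> norm (Y t - Y s - (t - s) *\<^sub>R D)) F"
      by (intro tendsto_intros lim floor_tendsto)
    moreover have "((\<lambda>n. e * \<bar>of_int (?k n) / real (N n) - of_int (?j n) / real (N n)\<bar>) \<longlongrightarrow> e * \<bar>t - s\<bar>) F"
      by (intro tendsto_intros floor_tendsto)
    ultimately show "norm (Y t - Y s - (t - s) *\<^sub>R D) \<le> e * norm (t - s)"
      using tendsto_le[OF F] by (simp only: real_norm_def)
  qed (use \<delta> in simp)
qed

end

section \<open>Almost stationary polygons and their limits\<close>

definition partial_sum :: "(int \<Rightarrow> 'a::ab_group_add) \<Rightarrow> int \<Rightarrow> 'a" where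
  "partial_sum f k = (if k \<ge> 0 then sum f {0..<k} else - sum f {k..<0})"

lemma partial_sum_step: "partial_sum f (k + 1) - partial_sum f k = f k"
proof (cases "k \<ge> 0")
  case True
  then have "{0..<k + 1} = insert k {0..<k}"
    by auto
  then show ?thesis
    using True by (simp add: partial_sum_def)
next
  case False
  then have "{k..<0} = insert k {k + 1..<0}"
    by auto
  then show ?thesis
    using False by (auto simp: partial_sum_def)
qed


text \<open>Multiplied by \<open>N\<close>, this is a midpoint scheme for the equation
  \<open>V' = l * (h + lm) * i V\<close>. The single error \<open>e\<close> absorbs the penalty, the
  discretised flux and the replacement of \<open>G\<close> by \<open>H\<close>.\<close>

definition discrete_EL :: "real \<Rightarrow> (complex \<Rightarrow> real) \<Rightarrow> real \<Rightarrow> nat \<Rightarrow> (int \<Rightarrow> complex) \<Rightarrow> bool" where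
  "discrete_EL e h lm N x \<longleftrightarrow> N > 0 \<and> periodic N x \<and>
     (\<forall>k. norm (velocity N x k - velocity N x (k - 1)
            - (poly_length N x / real N * (h (x k) + lm)) *\<^sub>R (\<i> * (velocity N x k + velocity N x (k - 1)) / 2))
        \<le> poly_length N x / real N * (e * (1 + norm (velocity N x k) + norm (velocity N x (k - 1)))))"

lemma sum_velocity_square:
  "(\<Sum>k\<in>{0..<int N}. (norm (velocity N x k))\<^sup>2) = real N * (poly_length N x)\<^sup>2"
  unfolding poly_length_square velocity_def norm_mult power_mult_distrib sum_distrib_left[symmetric]
  by (simp add: power2_eq_square)

lemma exists_velocity_le:
  assumes "N > 0"
  shows "\<exists>j\<in>{0..<int N}. norm (velocity N x j) \<le> poly_length N x"
proof (rule ccontr)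
  assume "\<not> ?thesis"
  then have "(poly_length N x)\<^sup>2 < (norm (velocity N x j))\<^sup>2" if "j \<in> {0..<int N}" for j
    using that poly_length_nonneg by (intro power_strict_mono) (auto simp: not_le)
  then have "(\<Sum>k\<in>{0..<int N}. (poly_length N x)\<^sup>2) < (\<Sum>k\<in>{0..<int N}. (norm (velocity N x k))\<^sup>2)"
    using assms by (intro sum_strict_mono) auto
  then show False
    unfolding sum_velocity_square by simp
qed

lemma periodic_dist_le_poly_length:
  assumes "periodic N x" and "N > 0"
  shows "norm (x k - x 0) \<le> poly_length N x"
proof -
  have *: "norm (x j - x 0) \<le> (\<Sum>i\<in>{0..<j}. norm (x (i + 1) - x i))" if "j \<ge> 0" for j
    using that
  proof (induction j rule: int_ge_induct)
    case (step i)
    have "{0..<i + 1} = insert i {0..<i}"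
      using step(1) by auto
    moreover have "norm (x (i + 1) - x 0) \<le> norm (x i - x 0) + norm (x (i + 1) - x i)"
      by norm
    ultimately show ?case
      using step by simp
  qed simp
  define j where "j = k mod int N"
  have j: "0 \<le> j" "j < int N"
    using assms(2) by (simp_all add: j_def)
  have "norm (x j - x 0) \<le> (\<Sum>i\<in>{0..<j}. norm (x (i + 1) - x i))"
    using * j by blast
  also have "\<dots> \<le> (\<Sum>i\<in>{0..<int N}. norm (x (i + 1) - x i))"
    using j by (intro sum_mono2) auto
  also have "\<dots> \<le> poly_length N x"
    by (rule sum_edges_le_poly_length)
  finally show ?thesis
    using periodic_mod[OF assms(1), of k] by (simp add: j_def)
qed

lemma discrete_EL_increment:
  assumes "discrete_EL e h lm N x" and "\<And>p. \<bar>h p\<bar> \<le> M" and "\<bar>lm\<bar> \<le> \<Lambda>" and "poly_length N x \<le> L" and "e \<le> 1"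
  shows "norm (velocity N x k - velocity N x (k - 1))
      \<le> L * (M + \<Lambda> + 1) / real N * (1 + norm (velocity N x k) + norm (velocity N x (k - 1)))"
proof -
  define v where "v = velocity N x"
  define l where "l = poly_length N x / real N"
  define s where "s = 1 + norm (v k) + norm (v (k - 1))"
  have l: "0 \<le> l" "l \<le> L / real N"
    using assms(4) by (simp_all add: l_def poly_length_nonneg divide_right_mono)
  have s: "s \<ge> 0"
    by (simp add: s_def)
  have "norm ((l * (h (x k) + lm)) *\<^sub>R (\<i> * (v k + v (k - 1)) / 2)) = l * \<bar>h (x k) + lm\<bar> * (norm (v k + v (k - 1)) / 2)"
    using l by (simp add: norm_mult abs_mult)
  also have "\<dots> \<le> l * (M + \<Lambda>) * s"
  proof (intro mult_mono)
    show "\<bar>h (x k) + lm\<bar> \<le> M + \<Lambda>"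
      using assms(2)[of "x k"] assms(3) by linarith
    show "norm (v k + v (k - 1)) / 2 \<le> s"
      using norm_triangle_ineq[of "v k" "v (k - 1)"] norm_ge_zero[of "v k"] norm_ge_zero[of "v (k - 1)"]
      unfolding s_def by linarith
    show "0 \<le> l * (M + \<Lambda>)"
      using l assms(2)[of 0] assms(3) by (intro mult_nonneg_nonneg) linarith+
  qed (use l in auto)
  finally have 1: "norm ((l * (h (x k) + lm)) *\<^sub>R (\<i> * (v k + v (k - 1)) / 2)) \<le> l * (M + \<Lambda>) * s" .
  have "norm (v k - v (k - 1) - (l * (h (x k) + lm)) *\<^sub>R (\<i> * (v k + v (k - 1)) / 2)) \<le> l * (e * s)"
    using assms(1) by (simp add: discrete_EL_def v_def l_def s_def)
  also have "\<dots> \<le> l * (1 * s)"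
    using l s assms(5) by (intro mult_left_mono mult_right_mono) auto
  finally have "norm (v k - v (k - 1)) \<le> l * s + l * (M + \<Lambda>) * s"
    using 1 norm_triangle_sub[of "v k - v (k - 1)" "(l * (h (x k) + lm)) *\<^sub>R (\<i> * (v k + v (k - 1)) / 2)"]
    by simp
  also have "\<dots> = l * ((M + \<Lambda> + 1) * s)"
    by (simp add: algebra_simps)
  also have "\<dots> \<le> L / real N * ((M + \<Lambda> + 1) * s)"
  proof (intro mult_right_mono mult_nonneg_nonneg)
    show "0 \<le> M + \<Lambda> + 1"
      using assms(2)[of 0] assms(3) by linarith
  qed (use l s in auto)
  finally show ?thesis
    by (simp add: v_def s_def)
qed

text \<open>A discrete Gronwall argument, started at an edge whose velocity is at most the root mean square.\<close>

lemma velocity_bound: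
  assumes "discrete_EL e h lm N x" and "\<And>p. \<bar>h p\<bar> \<le> M" and "\<bar>lm\<bar> \<le> \<Lambda>" and "poly_length N x \<le> L" and "e \<le> 1"
    and "real N \<ge> 2 * (L * (M + \<Lambda> + 1))"
  shows "norm (velocity N x k) \<le> exp (4 * (L * (M + \<Lambda> + 1))) * (1 + 2 * L)"
proof -
  define v where "v = velocity N x"
  define B where "B = L * (M + \<Lambda> + 1)"
  \<comment> \<open>With this \<open>w\<close> the factor
    \<open>1 + norm (v (k + 1)) + norm (v k)\<close> is the mean of \<open>w (k + 1)\<close> and
    \<open>w k\<close>, so the recursion becomes homogeneous.\<close>
  define w where "w k = 1 + 2 * norm (v k)" for k
  have N: "N > 0" and per: "periodic N v"
    using assms(1) velocity_periodic unfolding discrete_EL_def v_def by blast+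
  have L: "L \<ge> 0"
    using assms(4) poly_length_nonneg order_trans by blast
  then have B: "B \<ge> 0"
    using assms(2)[of 0] assms(3) unfolding B_def by (intro mult_nonneg_nonneg) linarith+
  define b where "b = B / real N"
  have b: "0 \<le> b" "b \<le> 1 / 2"
    using B N assms(6) by (auto simp: b_def B_def field_simps)
  have step: "w (k + 1) \<le> (1 + 4 * b) * w k" for k
  proof -
    have "norm (v (k + 1) - v k) \<le> b * (1 + norm (v (k + 1)) + norm (v k))"
      using discrete_EL_increment[OF assms(1-5), of "k + 1"] by (simp add: v_def b_def B_def)
    moreover have "norm (v (k + 1)) \<le> norm (v k) + norm (v (k + 1) - v k)"
      by norm
    ultimately have "norm (v (k + 1)) \<le> norm (v k) + b * (1 + norm (v (k + 1)) + norm (v k))"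
      by linarith
    then have "(1 - b) * w (k + 1) \<le> (1 + b) * w k"
      by (simp add: w_def algebra_simps)
    \<comment> \<open>For nonnegative \<open>b\<close> this is equivalent to \<open>b = 0\<close> or
      \<open>b \<le> 1 / 2\<close>.\<close>
    also have "1 + b \<le> (1 - b) * (1 + 4 * b)"
      using mult_left_mono[OF b(2), of "4 * b"] b(1) by (simp add: algebra_simps)
    then have "(1 + b) * w k \<le> (1 - b) * (1 + 4 * b) * w k"
      by (rule mult_right_mono) (simp add: w_def)
    finally have "(1 - b) * w (k + 1) \<le> (1 - b) * ((1 + 4 * b) * w k)"
      by (simp add: mult.assoc)
    then show ?thesis
      using b by simp
  qed
  have steps: "w (j + int m) \<le> exp (4 * b * real m) * w j" for j m
  proof (induction m)
    case (Suc m)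
    have "w (j + int (Suc m)) \<le> (1 + 4 * b) * w (j + int m)"
      using step[of "j + int m"] by (simp add: ac_simps)
    also have "\<dots> \<le> exp (4 * b) * (exp (4 * b * real m) * w j)"
      using b Suc by (intro mult_mono exp_ge_add_one_self) (auto simp: w_def)
    also have "\<dots> = exp (4 * b * real (Suc m)) * w j"
      by (simp add: exp_add[symmetric] algebra_simps)
    finally show ?case .
  qed simp
  obtain j where j: "norm (v j) \<le> L"
    using exists_velocity_le[OF N, of x] assms(4) unfolding v_def by (meson order_trans)
  \<comment> \<open>Every residue class is reached from \<open>j\<close> in fewer than
    \<open>N\<close> forward steps, so the total growth factor is at most
    \<open>exp (4 * B)\<close>.\<close>
  define m where "m = nat ((k - j) mod int N)"
  have "int m \<le> int N"
    using N pos_mod_bound[of "int N" "k - j"] pos_mod_sign[of "int N" "k - j"] unfolding m_def by linarith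
  then have m: "real m \<le> real N"
    by simp
  have "w k = w (j + int m)"
  proof -
    have "v (j + int m + (k - j) div int N * int N) = v (j + int m)"
      using per by (rule periodic_add_mult)
    moreover have "j + int m + (k - j) div int N * int N = j + ((k - j) div int N * int N + (k - j) mod int N)"
      using N by (simp add: m_def)
    then have "j + int m + (k - j) div int N * int N = k"
      by (simp only: div_mult_mod_eq)
    ultimately show ?thesis
      by (simp add: w_def)
  qed
  also have "\<dots> \<le> exp (4 * b * real m) * w j"
    by (rule steps)
  also have "\<dots> \<le> exp (4 * B) * (1 + 2 * L)"
  proof (intro mult_mono)
    have "b * real m \<le> b * real N"
      using m b by (intro mult_left_mono) auto
    then show "exp (4 * b * real m) \<le> exp (4 * B)"
      using N by (simp add: b_def)
  qed (use j in \<open>auto simp: w_def\<close>)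
  finally have "w k \<le> exp (4 * B) * (1 + 2 * L)" .
  then show ?thesis
    using norm_ge_zero[of "v k"] unfolding w_def v_def B_def by linarith
qed

lemma bounded_range_eventually:
  fixes f :: "nat \<Rightarrow> 'b::real_normed_vector"
  assumes "eventually (\<lambda>n. norm (f n) \<le> C) sequentially"
  shows "bounded (range f)"
  using BfunI[OF assms] by (simp add: Bseq_eq_bounded)

text \<open>The curvature \<open>h n\<close> may vary with \<open>n\<close>, because escaping
  polygons are translated back and \<open>H\<close> with them. All quantities whose limits are
  needed are combined into one state \<open>st\<close>, so that a single filter serves for position,
  velocity, area, length and multiplier.\<close>

theorem polygon_limit:
  fixes N :: "nat \<Rightarrow> nat" and x :: "nat \<Rightarrow> int \<Rightarrow> complex" and h :: "nat \<Rightarrow> complex \<Rightarrow> real"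
  assumes Nlim: "filterlim N at_top sequentially"
    and EL: "\<And>n. discrete_EL (e n) (h n) (lm n) (N n) (x n)"
    and e: "e \<longlonglongrightarrow> 0" "\<And>n. 0 \<le> e n" "\<And>n. e n \<le> 1"
    and x0: "\<And>n. norm (x n 0) \<le> R" and L: "\<And>n. poly_length (N n) (x n) \<le> L"
    and lm: "\<And>n. \<bar>lm n\<bar> \<le> \<Lambda>" and M: "\<And>n p. \<bar>h n p\<bar> \<le> M"
    and equi: "\<And>\<epsilon>. \<epsilon> > 0 \<Longrightarrow> \<exists>\<delta>>0. \<forall>n p q. dist p q < \<delta> \<longrightarrow> \<bar>h n p - h n q\<bar> \<le> \<epsilon>"
    and hg: "\<And>p. (\<lambda>n. h n p) \<longlonglongrightarrow> g p"
  obtains F U V ell lm0 A where "F \<noteq> bot" "F \<le> sequentially"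
    "\<And>t. (U has_vector_derivative V t) (at t)"
    "\<And>t. (V has_vector_derivative (ell * (g (U t) + lm0)) *\<^sub>R (\<i> * V t)) (at t)"
    "\<And>t. norm (V t) = ell" "\<And>t. U (t + 1) = U t"
    "((\<lambda>n. poly_length (N n) (x n)) \<longlongrightarrow> ell) F" "(lm \<longlongrightarrow> lm0) F"
    "((\<lambda>n. poly_area (N n) (x n)) \<longlongrightarrow> A) F"
    "((\<lambda>t. 1/2 * wedge (U t) (V t)) has_integral A) {0..1}"
proof -
  define l where "l n = poly_length (N n) (x n)" for n
  define v where "v n = velocity (N n) (x n)" for n
  \<comment> \<open>Partial areas. Their limit is an antiderivative of
    \<open>1/2 * wedge (U t) (V t)\<close>, so the area passes to the limit by the fundamental
    theorem of calculus.\<close>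
  define a where "a n = partial_sum (\<lambda>k. 1/2 * wedge (x n k) (x n (k + 1)))" for n
  \<comment> \<open>Partial sums of squared speeds, kept in order to identify the constant speed of
    the limit with the limit of the lengths.\<close>
  define b where "b n = partial_sum (\<lambda>k. (norm (v n k))\<^sup>2 / real (N n))" for n
  define B where "B = L * (M + \<Lambda> + 1)"
  define C where "C = exp (4 * B) * (1 + 2 * L)"
  define X where "X = R + L"
  have N: "N n > 0" and per: "periodic (N n) (x n)" for n
    using EL unfolding discrete_EL_def by blast+
  have L0: "L \<ge> 0"
    using L[of 0] poly_length_nonneg order_trans by blast
  have R0: "R \<ge> 0"
    using x0[of 0] norm_ge_zero order_trans by blast
  have B: "B \<ge> 0"
    using L0 M[of 0 0] lm[of 0] unfolding B_def by (intro mult_nonneg_nonneg) linarith+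
  have C: "C \<ge> 0"
    using L0 by (simp add: C_def)
  have X0: "X \<ge> 0"
    using L0 R0 by (simp add: X_def)
  have xX: "norm (x n k) \<le> X" for n k
  proof -
    have "norm (x n k) \<le> norm (x n 0) + norm (x n k - x n 0)"
      by norm
    then show ?thesis
      using periodic_dist_le_poly_length[OF per N, of n k] L[of n] x0[of n] by (simp add: X_def)
  qed
  have evN: "eventually (\<lambda>n. real (N n) \<ge> 2 * B) sequentially"
    using filterlim_compose[OF filterlim_real_sequentially Nlim] by (simp add: filterlim_at_top)
  have evv: "eventually (\<lambda>n. \<forall>k. norm (v n k) \<le> C) sequentially"
    using evN
  proof eventually_elim
    case (elim n)
    show ?case
      using velocity_bound[OF EL M lm L e(3)] elim unfolding v_def C_def B_def by blast
  qed
  have dx: "real (N n) *\<^sub>R (x n (k + 1) - x n k) = v n k" for n k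
    by (simp add: v_def velocity_def scaleR_conv_of_real)
  have da: "real (N n) *\<^sub>R (a n (k + 1) - a n k) = 1/2 * wedge (x n k) (v n k)" for n k
    unfolding a_def partial_sum_step dx[symmetric]
    by (simp add: wedge.scaleR_right wedge.diff_right) (simp add: wedge_def algebra_simps)
  have db: "real (N n) *\<^sub>R (b n (k + 1) - b n k) = (norm (v n k))\<^sup>2" for n k
    using N[of n] by (simp add: b_def partial_sum_step)
  have evdv: "eventually (\<lambda>n. \<forall>k. norm (real (N n) *\<^sub>R (v n (k + 1) - v n k)) \<le> B * (1 + 2 * C)) sequentially"
    using evv
  proof eventually_elim
    case (elim n)
    show ?case
    proof
      fix k
      have "norm (v n (k + 1) - v n k) \<le> B / real (N n) * (1 + norm (v n (k + 1)) + norm (v n k))"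
        using discrete_EL_increment[OF EL M lm L e(3), of n "k + 1"] by (simp add: v_def B_def)
      also have "\<dots> \<le> B / real (N n) * (1 + 2 * C)"
        using B elim[rule_format, of k] elim[rule_format, of "k + 1"] by (intro mult_left_mono) auto
      finally show "norm (real (N n) *\<^sub>R (v n (k + 1) - v n k)) \<le> B * (1 + 2 * C)"
        using N[of n] unfolding norm_scaleR by (simp add: field_simps)
    qed
  qed
  have eva: "eventually (\<lambda>n. \<forall>k. norm (real (N n) *\<^sub>R (a n (k + 1) - a n k)) \<le> X * C) sequentially"
    using evv
  proof eventually_elim
    case (elim n)
    show ?case
    proof
      fix k
      have "\<bar>wedge (x n k) (v n k)\<bar> \<le> X * C"
        using xX elim X0 C by (intro order_trans[OF abs_wedge_le mult_mono]) auto
      then show "norm (real (N n) *\<^sub>R (a n (k + 1) - a n k)) \<le> X * C"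
        unfolding da by simp
    qed
  qed
  have evb: "eventually (\<lambda>n. \<forall>k. norm (real (N n) *\<^sub>R (b n (k + 1) - b n k)) \<le> C\<^sup>2) sequentially"
    using evv unfolding db by eventually_elim (simp add: power_mono)
  define st where "st n t = (x n \<lfloor>real (N n) * t\<rfloor>, v n \<lfloor>real (N n) * t\<rfloor>, a n \<lfloor>real (N n) * t\<rfloor>,
      b n \<lfloor>real (N n) * t\<rfloor>, l n, lm n)" for n t
  have partial_bounded: "eventually (\<lambda>n. norm (y n \<lfloor>real (N n) * t\<rfloor>) \<le> D * (\<bar>t\<bar> + 1)) sequentially"
    if "eventually (\<lambda>n. \<forall>k. norm (real (N n) *\<^sub>R (y n (k + 1) - y n k)) \<le> D) sequentially" "\<And>n. y n 0 = 0" "D \<ge> 0"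
    for y :: "nat \<Rightarrow> int \<Rightarrow> real" and D t
    using that(1)
  proof eventually_elim
    case (elim n)
    let ?k = "\<lfloor>real (N n) * t\<rfloor>"
    have "norm (y n ?k - y n 0) \<le> D * \<bar>of_int ?k / real (N n) - of_int 0 / real (N n)\<bar>"
      using elim N by (intro lipschitz_increments) auto
    moreover have "\<bar>of_int ?k / real (N n)\<bar> \<le> \<bar>t\<bar> + 1"
    proof -
      have "\<bar>of_int ?k\<bar> \<le> \<bar>real (N n) * t\<bar> + 1"
        by linarith
      also have "\<dots> \<le> real (N n) * \<bar>t\<bar> + real (N n)"
        using N[of n] by (simp add: abs_mult Suc_le_eq)
      finally show ?thesis
        using N[of n] by (simp add: field_simps)
    qed
    then have "D * \<bar>of_int ?k / real (N n)\<bar> \<le> D * (\<bar>t\<bar> + 1)"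
      using that(3) by (rule mult_left_mono)
    ultimately show ?case
      by (simp add: that(2))
  qed
  have bdd: "bounded (range (\<lambda>n. st n t))" for t
  proof (rule bounded_range_eventually)
    have a0: "a n 0 = 0" "b n 0 = 0" for n
      by (simp_all add: a_def b_def partial_sum_def)
    have XC: "0 \<le> X * C"
      using X0 C by simp
    show "eventually (\<lambda>n. norm (st n t) \<le> X + (C + (X * C * (\<bar>t\<bar> + 1) + (C\<^sup>2 * (\<bar>t\<bar> + 1) + (L + \<Lambda>))))) sequentially"
      using evv partial_bounded[of a "X * C" t, OF eva a0(1) XC]
        partial_bounded[of b "C\<^sup>2" t, OF evb a0(2) zero_le_power2]
    proof eventually_elim
      case (elim n)
      show ?case
        unfolding st_def
      proof (intro order_trans[OF norm_Pair_le add_mono])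
        show "norm (l n) \<le> L"
          using L[of n] by (simp add: l_def poly_length_nonneg)
      qed (use xX elim lm in auto)
    qed
  qed
  obtain F G where F: "F \<noteq> bot" "F \<le> sequentially" and lim: "\<And>t. ((\<lambda>n. st n t) \<longlongrightarrow> G t) F"
    using pointwise_cluster_filter[of st, OF bdd] by blast
  define U where "U t = fst (G t)" for t
  define V where "V t = fst (snd (G t))" for t
  define Al where "Al t = fst (snd (snd (G t)))" for t
  define Bl where "Bl t = fst (snd (snd (snd (G t))))" for t
  define ell where "ell = fst (snd (snd (snd (snd (G 0)))))"
  define lm0 where "lm0 = snd (snd (snd (snd (snd (G 0)))))"
  have limU: "((\<lambda>n. x n \<lfloor>real (N n) * t\<rfloor>) \<longlongrightarrow> U t) F" for t
    using tendsto_fst[OF lim[of t]] by (simp add: st_def U_def)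
  have limV: "((\<lambda>n. v n \<lfloor>real (N n) * t\<rfloor>) \<longlongrightarrow> V t) F" for t
    using tendsto_fst[OF tendsto_snd[OF lim[of t]]] by (simp add: st_def V_def)
  have limA: "((\<lambda>n. a n \<lfloor>real (N n) * t\<rfloor>) \<longlongrightarrow> Al t) F" for t
    using tendsto_fst[OF tendsto_snd[OF tendsto_snd[OF lim[of t]]]] by (simp add: st_def Al_def)
  have limB: "((\<lambda>n. b n \<lfloor>real (N n) * t\<rfloor>) \<longlongrightarrow> Bl t) F" for t
    using tendsto_fst[OF tendsto_snd[OF tendsto_snd[OF tendsto_snd[OF lim[of t]]]]] by (simp add: st_def Bl_def)
  have liml: "(l \<longlongrightarrow> ell) F"
    using tendsto_fst[OF tendsto_snd[OF tendsto_snd[OF tendsto_snd[OF tendsto_snd[OF lim[of 0]]]]]] by (simp add: st_def ell_def)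
  have limlm: "(lm \<longlongrightarrow> lm0) F"
    using tendsto_snd[OF tendsto_snd[OF tendsto_snd[OF tendsto_snd[OF tendsto_snd[OF lim[of 0]]]]]] by (simp add: st_def lm0_def)
  interpret grid_limit N F
    by unfold_locales (rule filterlim_mono[OF Nlim order_refl F(2)])
  have toF: "eventually P F" if "eventually P sequentially" for P
    using that F(2) by (auto simp: le_filter_def)
  have gU: "((\<lambda>p. x (fst p) (snd p)) \<longlongrightarrow> U s) (grid_filter N F s)" for s
    using limU by (rule lipschitz_tendsto_grid[where C=C]) (use toF[OF evv] dx in simp)
  have gV: "((\<lambda>p. v (fst p) (snd p)) \<longlongrightarrow> V s) (grid_filter N F s)" for s
    using limV toF[OF evdv] by (rule lipschitz_tendsto_grid)
  have dU: "(U has_vector_derivative V s) (at s)" for s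
    using F(1) limU by (rule limit_has_vector_derivative) (simp add: dx gV)
  have dA: "(Al has_vector_derivative 1/2 * wedge (U s) (V s)) (at s)" for s
    using F(1) limA by (rule limit_has_vector_derivative)
      (unfold da, intro tendsto_intros wedge.tendsto gU gV)
  have dB: "(Bl has_vector_derivative (norm (V s))\<^sup>2) (at s)" for s
    using F(1) limB by (rule limit_has_vector_derivative) (unfold db, intro tendsto_intros gV)
  have dV: "(V has_vector_derivative (ell * (g (U s) + lm0)) *\<^sub>R (\<i> * V s)) (at s)" for s
    using F(1) limV
  proof (rule limit_has_vector_derivative)
    let ?G = "grid_filter N F s"
    have gU': "((\<lambda>p. x (fst p) (snd p + 1)) \<longlongrightarrow> U s) ?G"
      using filterlim_compose[OF gU grid_shift] by simp
    have gV': "((\<lambda>p. v (fst p) (snd p + 1)) \<longlongrightarrow> V s) ?G"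
      using filterlim_compose[OF gV grid_shift] by simp
    have gh: "((\<lambda>p. h (fst p) (x (fst p) (snd p + 1))) \<longlongrightarrow> g (U s)) ?G"
    proof -
      \<comment> \<open>Equicontinuity replaces the moving argument by \<open>U s\<close>, where the
        pointwise convergence of \<open>h n\<close> applies.\<close>
      have "((\<lambda>p. h (fst p) (x (fst p) (snd p + 1)) - h (fst p) (U s)) \<longlongrightarrow> 0) ?G"
      proof (rule tendstoI)
        fix \<epsilon> :: real
        assume "\<epsilon> > 0"
        then obtain \<delta> where \<delta>: "\<delta> > 0" "\<And>n p q. dist p q < \<delta> \<Longrightarrow> \<bar>h n p - h n q\<bar> \<le> \<epsilon> / 2"
          using equi[of "\<epsilon> / 2"] by auto
        show "eventually (\<lambda>p. dist (h (fst p) (x (fst p) (snd p + 1)) - h (fst p) (U s)) 0 < \<epsilon>) ?G"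
          using tendstoD[OF gU' \<delta>(1)]
        proof eventually_elim
          case (elim p)
          show ?case
            using \<delta>(2)[OF elim, of "fst p"] \<open>\<epsilon> > 0\<close> by simp
        qed
      qed
      moreover have "((\<lambda>p. h (fst p) (U s)) \<longlongrightarrow> g (U s)) ?G"
        by (rule filterlim_compose[OF filterlim_mono[OF hg order_refl F(2)] filterlim_fst_grid])
      ultimately show ?thesis
        using tendsto_add by fastforce
    qed
    note gfst = filterlim_compose[OF _ filterlim_fst_grid]
    define W where "W p = (l (fst p) * (h (fst p) (x (fst p) (snd p + 1)) + lm (fst p)))
        *\<^sub>R (\<i> * (v (fst p) (snd p + 1) + v (fst p) (snd p)) / 2)" for p
    have "((\<lambda>p. real (N (fst p)) *\<^sub>R (v (fst p) (snd p + 1) - v (fst p) (snd p)) - W p) \<longlongrightarrow> 0) ?G"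
    proof (rule Lim_null_comparison)
      show "eventually (\<lambda>p. norm (real (N (fst p)) *\<^sub>R (v (fst p) (snd p + 1) - v (fst p) (snd p)) - W p)
          \<le> l (fst p) * (e (fst p) * (1 + norm (v (fst p) (snd p + 1)) + norm (v (fst p) (snd p))))) ?G"
      proof (rule always_eventually, rule allI)
        fix p :: "nat \<times> int"
        obtain n k where p: "p = (n, k)"
          by (cases p)
        have "norm (v n (k + 1) - v n k - (l n / real (N n) * (h n (x n (k + 1)) + lm n)) *\<^sub>R (\<i> * (v n (k + 1) + v n k) / 2))
            \<le> l n / real (N n) * (e n * (1 + norm (v n (k + 1)) + norm (v n k)))"
          using EL[of n] unfolding discrete_EL_def v_def l_def by (metis add_diff_cancel_right')
        then have "real (N n) * norm (v n (k + 1) - v n k - (l n / real (N n) * (h n (x n (k + 1)) + lm n)) *\<^sub>R (\<i> * (v n (k + 1) + v n k) / 2))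
            \<le> real (N n) * (l n / real (N n) * (e n * (1 + norm (v n (k + 1)) + norm (v n k))))"
          by (rule mult_left_mono) simp
        moreover have "real (N n) *\<^sub>R (v n (k + 1) - v n k) - W p
            = real (N n) *\<^sub>R (v n (k + 1) - v n k - (l n / real (N n) * (h n (x n (k + 1)) + lm n)) *\<^sub>R (\<i> * (v n (k + 1) + v n k) / 2))"
          using N[of n] by (simp add: W_def p scaleR_diff_right)
        ultimately show "norm (real (N (fst p)) *\<^sub>R (v (fst p) (snd p + 1) - v (fst p) (snd p)) - W p)
          \<le> l (fst p) * (e (fst p) * (1 + norm (v (fst p) (snd p + 1)) + norm (v (fst p) (snd p))))"
          using N[of n] by (simp add: p)
      qed
      have "((\<lambda>p. l (fst p) * (e (fst p) * (1 + norm (v (fst p) (snd p + 1)) + norm (v (fst p) (snd p)))))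
          \<longlongrightarrow> ell * (0 * (1 + norm (V s) + norm (V s)))) ?G"
        by (intro tendsto_intros gV gV' gfst[OF liml] gfst[OF filterlim_mono[OF e(1) order_refl F(2)]])
      then show "((\<lambda>p. l (fst p) * (e (fst p) * (1 + norm (v (fst p) (snd p + 1)) + norm (v (fst p) (snd p)))))
          \<longlongrightarrow> 0) ?G"
        by simp
    qed
    moreover have "(W \<longlongrightarrow> (ell * (g (U s) + lm0)) *\<^sub>R (\<i> * (V s + V s) / 2)) ?G"
      unfolding W_def by (intro tendsto_intros gV gV' gh gfst[OF liml] gfst[OF limlm]) simp
    ultimately show "((\<lambda>p. real (N (fst p)) *\<^sub>R (v (fst p) (snd p + 1) - v (fst p) (snd p)))
        \<longlongrightarrow> (ell * (g (U s) + lm0)) *\<^sub>R (\<i> * V s)) ?G"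
      using tendsto_add by fastforce
  qed
  have ell0: "ell \<ge> 0"
    by (rule tendsto_lowerbound[OF liml _ F(1)]) (simp add: l_def poly_length_nonneg)
  \<comment> \<open>The acceleration is orthogonal to \<open>V\<close>, so the speed is
    constant.\<close>
  have "((\<lambda>t. V t \<bullet> V t) has_vector_derivative 0) (at s)" for s
  proof -
    have "((\<lambda>t. V t \<bullet> V t) has_vector_derivative
        V s \<bullet> ((ell * (g (U s) + lm0)) *\<^sub>R (\<i> * V s)) + ((ell * (g (U s) + lm0)) *\<^sub>R (\<i> * V s)) \<bullet> V s) (at s)"
      by (rule bounded_bilinear.has_vector_derivative[OF bounded_bilinear_inner dV dV])
    moreover have "V s \<bullet> (\<i> * V s) = 0" "(\<i> * V s) \<bullet> V s = 0"
      by (simp_all add: inner_complex_def)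
    ultimately show ?thesis
      by simp
  qed
  then have "\<And>s. V s \<bullet> V s = V 0 \<bullet> V 0"
    unfolding has_real_derivative_iff_has_vector_derivative[symmetric]
    using DERIV_isconst_all[of "\<lambda>t. V t \<bullet> V t"] by blast
  then have Vc: "norm (V s) = norm (V 0)" for s
    by (simp add: norm_eq_sqrt_inner)
  have Nfloor: "\<lfloor>real (N n) * 1\<rfloor> = int (N n)" "\<lfloor>real (N n) * 0\<rfloor> = 0" for n
    by simp_all
  \<comment> \<open>\<open>Bl\<close> grows at the constant rate \<open>(norm (V 0))^2\<close>, and
    over one period it grows by the limit \<open>ell^2\<close> of the squared lengths.\<close>
  have "((\<lambda>t. Bl t - (norm (V 0))\<^sup>2 * t) has_real_derivative 0) (at s)" for s
    using DERIV_diff[OF dB[of s, folded has_real_derivative_iff_has_vector_derivative] DERIV_cmult_Id[of "(norm (V 0))\<^sup>2"]]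
    by (simp add: Vc[of s])
  then have "Bl 1 - (norm (V 0))\<^sup>2 * 1 = Bl 0 - (norm (V 0))\<^sup>2 * 0"
    using DERIV_isconst_all[of "\<lambda>t. Bl t - (norm (V 0))\<^sup>2 * t" 1 0] by blast
  moreover have "Bl 0 = 0"
    by (rule tendsto_unique[OF F(1) limB]) (simp add: b_def partial_sum_def)
  moreover have "Bl 1 = ell\<^sup>2"
  proof (rule tendsto_unique[OF F(1) limB])
    have "b n (int (N n)) = (l n)\<^sup>2" for n
      using N[of n] sum_velocity_square[of "N n" "x n"]
      by (simp add: b_def partial_sum_def v_def l_def sum_divide_distrib[symmetric])
    then show "((\<lambda>n. b n \<lfloor>real (N n) * 1\<rfloor>) \<longlongrightarrow> ell\<^sup>2) F"
      unfolding Nfloor by (simp add: tendsto_power liml)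
  qed
  ultimately have "(norm (V 0))\<^sup>2 = ell\<^sup>2"
    by simp
  then have Vell: "norm (V t) = ell" for t
    using ell0 Vc by (metis norm_ge_zero power2_eq_iff_nonneg)
  have Uper: "U (t + 1) = U t" for t
  proof (rule tendsto_unique[OF F(1) limU])
    have "\<lfloor>real (N n) * (t + 1)\<rfloor> = \<lfloor>real (N n) * t\<rfloor> + int (N n)" for n
      by (simp add: distrib_left floor_add_int[symmetric])
    then show "((\<lambda>n. x n \<lfloor>real (N n) * (t + 1)\<rfloor>) \<longlongrightarrow> U t) F"
      by (simp only: periodicD[OF per] limU)
  qed
  have Al: "Al 0 = 0"
    by (rule tendsto_unique[OF F(1) limA]) (simp add: a_def partial_sum_def)
  have "a n (int (N n)) = poly_area (N n) (x n)" for n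
    by (simp add: a_def partial_sum_def poly_area_def sum_distrib_left)
  then have areaA: "((\<lambda>n. poly_area (N n) (x n)) \<longlongrightarrow> Al 1) F"
    using limA[of 1] unfolding Nfloor by simp
  have "((\<lambda>t. 1/2 * wedge (U t) (V t)) has_integral (Al 1 - Al 0)) {0..1}"
    by (rule fundamental_theorem_of_calculus) (simp, rule has_vector_derivative_at_within[OF dA])
  then have "((\<lambda>t. 1/2 * wedge (U t) (V t)) has_integral Al 1) {0..1}"
    by (simp add: Al)
  with that[OF F dU dV Vell Uper liml[unfolded l_def] limlm areaA] show ?thesis
    by blast
qed


section \<open>Almost stationary minimisers\<close>

text \<open>\<open>q\<close> does not depend on \<open>e\<close>, whereas the modulus of
  differentiability of \<open>Q\<close> may. Uniform closeness of \<open>G\<close> to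
  \<open>H\<close> is enough, since the Euler-Lagrange equation contains only values of
  \<open>G\<close>.\<close>

definition approximable :: "(complex \<Rightarrow> real) \<Rightarrow> real \<Rightarrow> bool" where
  "approximable H q \<longleftrightarrow> (\<forall>e>0. \<exists>Q G. (\<forall>p. norm (Q p) \<le> q) \<and> unif_div Q G \<and> (\<forall>p. \<bar>G p - H p\<bar> \<le> e))"

lemma unif_div_continuous:
  assumes "unif_div Q G"
  shows "continuous_on UNIV Q"
proof -
  obtain a b where ab: "\<And>\<epsilon>. \<epsilon> > 0 \<Longrightarrow> \<exists>\<delta>>0. \<forall>p h. norm h \<le> \<delta> \<longrightarrow>
        norm (Q (p + h) - Q p - (Re h *\<^sub>R a p + Im h *\<^sub>R b p)) \<le> \<epsilon> * norm h"
    using assms unfolding unif_div_def by blast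
  have "(Q has_derivative (\<lambda>h. Re h *\<^sub>R a p + Im h *\<^sub>R b p)) (at p)" for p
    using has_derivative_of_unif[of Q a b] ab by blast
  then show ?thesis
    using has_derivative_continuous continuous_at_imp_continuous_on by blast
qed

lemma poly_area_eq_0:
  assumes "periodic N x" and "N > 0" and "poly_length N x = 0"
  shows "poly_area N x = 0"
proof -
  have "x k = x 0" for k
    using periodic_dist_le_poly_length[OF assms(1,2), of k] assms(3) by simp
  then have "wedge (x k) (x (k + 1)) = 0" for k
    by (metis mult.commute diff_self wedge_def)
  then show ?thesis
    by (simp add: poly_area_def)
qed

lemma discrete_EL_perturb:
  assumes "N > 0" "periodic N x" "\<And>p. \<bar>G p - H p\<bar> \<le> e / 4" "e > 0" "\<mu> \<le> e" "\<epsilon> \<le> e / 2"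
    and EL: "\<And>k. norm (velocity N x k - velocity N x (k - 1)
            - (poly_length N x / real N * (G (x k) + lm)) *\<^sub>R (\<i> * (velocity N x k + velocity N x (k - 1)) / 2))
          \<le> poly_length N x / real N * (\<mu> + \<epsilon> / 2 * (norm (velocity N x k) + norm (velocity N x (k - 1))))"
  shows "discrete_EL e H lm N x"
  unfolding discrete_EL_def
proof (intro conjI allI assms(1,2))
  fix k
  define v w l where "v = velocity N x k" and "w = velocity N x (k - 1)" and "l = poly_length N x / real N"
  have l: "l \<ge> 0"
    by (simp add: l_def poly_length_nonneg)
  have "v - w - (l * (H (x k) + lm)) *\<^sub>R (\<i> * (v + w) / 2)
      = (v - w - (l * (G (x k) + lm)) *\<^sub>R (\<i> * (v + w) / 2)) + (l * (G (x k) - H (x k))) *\<^sub>R (\<i> * (v + w) / 2)"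
    by (simp add: algebra_simps)
  also have "norm \<dots> \<le> l * (\<mu> + \<epsilon> / 2 * (norm v + norm w)) + l * (e / 4 * ((norm v + norm w) / 2))"
  proof (rule order_trans[OF norm_triangle_ineq add_mono])
    have "norm ((l * (G (x k) - H (x k))) *\<^sub>R (\<i> * (v + w) / 2)) = l * (\<bar>G (x k) - H (x k)\<bar> * (norm (v + w) / 2))"
      using l by (simp add: norm_mult abs_mult)
    also have "\<dots> \<le> l * (e / 4 * ((norm v + norm w) / 2))"
      using assms(3)[of "x k"] assms(4) l norm_triangle_ineq[of v w]
      by (intro mult_left_mono mult_mono) auto
    finally show "norm ((l * (G (x k) - H (x k))) *\<^sub>R (\<i> * (v + w) / 2)) \<le> l * (e / 4 * ((norm v + norm w) / 2))" .
  qed (use EL[of k] in \<open>simp add: v_def w_def l_def\<close>)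
  also have "\<dots> = l * (\<mu> + (\<epsilon> / 2 + e / 8) * (norm v + norm w))"
    by (simp add: algebra_simps)
  also have "\<dots> \<le> l * (e + e * (norm v + norm w))"
    using assms(4-6) l by (intro mult_left_mono add_mono mult_right_mono) auto
  finally show "norm (velocity N x k - velocity N x (k - 1)
            - (poly_length N x / real N * (H (x k) + lm)) *\<^sub>R (\<i> * (velocity N x k + velocity N x (k - 1)) / 2))
        \<le> poly_length N x / real N * (e * (1 + norm (velocity N x k) + norm (velocity N x (k - 1))))"
    by (simp add: v_def w_def l_def algebra_simps)
qed

lemma mean_norm_nonneg: "mean_norm N x \<ge> 0"
  by (simp add: mean_norm_def sum_nonneg)

lemma mean_norm_regular_polygon:
  assumes "r \<ge> 0" and "N > 0"
  shows "mean_norm N (regular_polygon N c r) \<le> norm c + r"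
proof -
  have "norm (regular_polygon N c r k) \<le> norm c + r" for k
    unfolding regular_polygon_def using assms(1) by (intro norm_triangle_le) (simp add: norm_mult)
  then have "(\<Sum>k\<in>{0..<int N}. norm (regular_polygon N c r k)) \<le> real N * (norm c + r)"
    using sum_bounded_above[of "{0..<int N}" "\<lambda>k. norm (regular_polygon N c r k)" "norm c + r"] by simp
  then show ?thesis
    using assms(2) by (simp add: mean_norm_def field_simps)
qed

text \<open>\<open>c\<close>, \<open>r\<close> and \<open>g0\<close> describe a disc on which
  \<open>H \<ge> g0\<close>; the value \<open>g0 = 0\<close> switches it off. The last conclusion
  compares the minimiser with a polygon inscribed in this disc. It carries an arbitrary bound
  \<open>\<eta>\<close> for \<open>\<bar>H\<bar>\<close> around the minimiser, because it is applied
  where \<open>H\<close> is small.\<close>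

lemma exists_near_minimiser:
  fixes r0 q e r g0 :: real
  assumes H: "approximable H q" and q: "q < 1" and r0: "r0 > 0" and e: "e > 0"
    and disc: "r \<ge> 0" "g0 \<ge> 0" "\<And>p. g0 > 0 \<Longrightarrow> p \<in> cball c r \<Longrightarrow> g0 \<le> H p"
  defines "a0 \<equiv> pi * r0\<^sup>2" and "S \<equiv> 4 * pi * r0" and "K \<equiv> 16 / (pi * r0 ^ 3)"
  obtains N x where "real N \<ge> 1 / e"
    and "discrete_EL e H (- 2 * K * (poly_area N x - a0)) N x"
    and "(1 - q) * poly_length N x + K * (poly_area N x - a0)\<^sup>2 \<le> S"
    and "\<bar>poly_area N x - a0\<bar> \<le> a0 / 2"
    and "\<And>\<eta>. g0 > 0 \<Longrightarrow> (\<And>p. p \<in> cball (x 0) (poly_length N x) \<Longrightarrow> \<bar>H p\<bar> \<le> \<eta>) \<Longrightarrow>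
        poly_length N x + K * (poly_area N x - a0)\<^sup>2
        \<le> 2 * pi * r + K * (pi * r\<^sup>2 - a0)\<^sup>2 - g0 * pi * r\<^sup>2 / 2 + (\<eta> + e) * (poly_length N x)\<^sup>2 + e"
proof -
  have K: "K > 0" and a0: "a0 > 0" and S: "S > 0"
    using r0 by (simp_all add: K_def a0_def S_def)
  \<comment> \<open>The calibration behind \<open>K\<close>: an area penalty of at most
    \<open>S\<close> keeps the area within \<open>a0 / 2\<close> of \<open>a0\<close>.\<close>
  have SK: "S = K * (a0 / 2)\<^sup>2"
    using r0 by (simp add: S_def K_def a0_def power2_eq_square power3_eq_cube field_simps)
  \<comment> \<open>Of the gain \<open>g0 * pi * r^2\<close> of the test polygon at most a quarter
    is lost to the approximation of \<open>H\<close> and an eighth to the discretised flux, so that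
    the half in the conclusion is left.\<close>
  define e1 where "e1 = (if g0 > 0 then min (e / 4) (g0 / 4) else e / 4)"
  define \<epsilon> where "\<epsilon> = (if g0 > 0 then min (e / 2) (g0 / 16) else e / 2)"
  \<comment> \<open>The three entries control the penalty in the Euler-Lagrange equation, at the
    test polygon around \<open>c\<close>, and at the comparison polygon around 0.\<close>
  define \<mu> where "\<mu> = min e (min (e / (2 * (norm c + r + 1))) ((1 - q) * pi))"
  have nc: "norm c + r + 1 > 0"
    using disc(1) by (simp add: add_nonneg_pos)
  have e1: "e1 > 0" "e1 \<le> e / 4" and \<epsilon>: "\<epsilon> > 0" "\<epsilon> \<le> e / 2"
    using e by (auto simp: e1_def \<epsilon>_def)
  have \<mu>: "\<mu> > 0" "\<mu> \<le> e" "\<mu> * (norm c + r) \<le> e / 2" "\<mu> * r0 \<le> (1 - q) * pi * r0"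
  proof -
    show "\<mu> > 0" "\<mu> \<le> e"
      using e q nc by (auto simp: \<mu>_def)
    have "\<mu> * (norm c + r) \<le> e / (2 * (norm c + r + 1)) * (norm c + r)"
      using disc(1) by (intro mult_right_mono) (auto simp: \<mu>_def)
    also have "\<dots> \<le> e / 2"
      using e nc by (simp add: field_simps)
    finally show "\<mu> * (norm c + r) \<le> e / 2" .
    show "\<mu> * r0 \<le> (1 - q) * pi * r0"
      using r0 by (intro mult_right_mono) (auto simp: \<mu>_def)
  qed
  obtain Q G where Q: "\<And>p. norm (Q p) \<le> q" and div: "unif_div Q G" and GH: "\<And>p. \<bar>G p - H p\<bar> \<le> e1"
    using H e1(1) unfolding approximable_def by blast
  have q0: "q \<ge> 0"
    using Q[of 0] norm_ge_zero order_trans by blast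
  obtain \<delta>1 where \<delta>1: "\<delta>1 > 0"
    and EL: "\<And>N x K a0 \<mu> k. N > 0 \<Longrightarrow> periodic N x \<Longrightarrow> \<mu> \<ge> 0 \<Longrightarrow> poly_length N x > 0
      \<Longrightarrow> (\<And>k. norm (x (k + 1) - x k) \<le> \<delta>1)
      \<Longrightarrow> (\<And>y. periodic N y \<Longrightarrow> poly_energy Q K a0 N x + \<mu> * mean_norm N x
              \<le> poly_energy Q K a0 N y + \<mu> * mean_norm N y)
      \<Longrightarrow> norm (velocity N x k - velocity N x (k - 1)
            - (poly_length N x / real N * (G (x k) - 2 * K * (poly_area N x - a0)))
                *\<^sub>R (\<i> * (velocity N x k + velocity N x (k - 1)) / 2))
          \<le> poly_length N x / real N *
              (\<mu> + \<epsilon> / 2 * (norm (velocity N x k) + norm (velocity N x (k - 1))))"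
    by (rule euler_lagrange[OF div \<epsilon>(1)]) blast
  obtain \<delta>2 where \<delta>2: "\<delta>2 > 0"
    and flux: "\<And>N x c R \<eta>. periodic N x \<Longrightarrow> (\<And>k. norm (x (k + 1) - x k) \<le> \<delta>2)
       \<Longrightarrow> (\<And>k. norm (x k - c) \<le> R) \<Longrightarrow> (\<And>p. p \<in> cball c R \<Longrightarrow> \<bar>G p\<bar> \<le> \<eta>)
       \<Longrightarrow> \<bar>poly_flux Q N x\<bar> \<le> (\<eta> + \<epsilon>) * R * poly_length N x"
    and flux_ge: "\<And>N x c R g. periodic N x \<Longrightarrow> (\<And>k. norm (x (k + 1) - x k) \<le> \<delta>2)
       \<Longrightarrow> (\<And>k. norm (x k - c) \<le> R) \<Longrightarrow> (\<And>p. p \<in> cball c R \<Longrightarrow> g \<le> G p)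
       \<Longrightarrow> (\<And>k. wedge (x k - c) (x (k + 1) - x (k - 1)) \<ge> 0)
       \<Longrightarrow> poly_flux Q N x \<ge> g * poly_area N x - \<epsilon> * R * poly_length N x"
    by (rule poly_flux_bounds[OF div \<epsilon>(1)]) blast
  define T where "T N = S / (1 - q) / sqrt (real N)" for N
  have Tlim: "T \<longlonglongrightarrow> 0"
    unfolding T_def
    by (intro tendsto_divide_0[OF tendsto_const] filterlim_at_top_imp_at_infinity
        filterlim_compose[OF sqrt_at_top filterlim_real_sequentially])
  have ev1: "eventually (\<lambda>N. real N \<ge> 1 / e \<and> N \<ge> 2) sequentially"
    by (intro eventually_conj eventually_ge_at_top)
      (use filterlim_real_sequentially in \<open>simp add: filterlim_at_top\<close>)
  have ev2: "eventually (\<lambda>N. T N < min \<delta>1 \<delta>2) sequentially"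
    using order_tendstoD(2)[OF Tlim, of "min \<delta>1 \<delta>2"] \<delta>1 \<delta>2 by simp
  have ev3: "eventually (\<lambda>N. 2 * pi * r / real N < \<delta>2) sequentially"
    using order_tendstoD(2)[OF lim_const_over_n \<delta>2] .
  have "(\<lambda>N. K * (poly_area N (regular_polygon N 0 r0) - a0)\<^sup>2) \<longlonglongrightarrow> K * (pi * r0\<^sup>2 - a0)\<^sup>2"
    using r0 by (intro tendsto_intros poly_area_regular_polygon_tendsto) auto
  then have "(\<lambda>N. K * (poly_area N (regular_polygon N 0 r0) - a0)\<^sup>2) \<longlonglongrightarrow> 0"
    by (simp add: a0_def)
  then have ev4: "eventually (\<lambda>N. K * (poly_area N (regular_polygon N 0 r0) - a0)\<^sup>2 < (1 - q) * pi * r0) sequentially"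
    using q r0 by (intro order_tendstoD) auto
  have "(\<lambda>N. K * (poly_area N (regular_polygon N c r) - a0)\<^sup>2 - 3 * g0 / 4 * poly_area N (regular_polygon N c r))
      \<longlonglongrightarrow> K * (pi * r\<^sup>2 - a0)\<^sup>2 - 3 * g0 / 4 * (pi * r\<^sup>2)"
    using disc(1) by (intro tendsto_intros poly_area_regular_polygon_tendsto) auto
  then have ev5: "eventually (\<lambda>N. K * (poly_area N (regular_polygon N c r) - a0)\<^sup>2
        - 3 * g0 / 4 * poly_area N (regular_polygon N c r)
        < K * (pi * r\<^sup>2 - a0)\<^sup>2 - 3 * g0 / 4 * (pi * r\<^sup>2) + e / 2) sequentially"
    using e by (intro order_tendstoD) auto
  have "\<exists>N. (real N \<ge> 1 / e \<and> N \<ge> 2) \<and> T N < min \<delta>1 \<delta>2 \<and> 2 * pi * r / real N < \<delta>2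
      \<and> K * (poly_area N (regular_polygon N 0 r0) - a0)\<^sup>2 < (1 - q) * pi * r0
      \<and> K * (poly_area N (regular_polygon N c r) - a0)\<^sup>2 - 3 * g0 / 4 * poly_area N (regular_polygon N c r)
        < K * (pi * r\<^sup>2 - a0)\<^sup>2 - 3 * g0 / 4 * (pi * r\<^sup>2) + e / 2"
    using eventually_conj[OF ev1 eventually_conj[OF ev2 eventually_conj[OF ev3 eventually_conj[OF ev4 ev5]]]]
    by (rule eventually_happens'[OF sequentially_bot])
  then obtain N where N1: "real N \<ge> 1 / e" "N \<ge> 2" and N2: "T N < min \<delta>1 \<delta>2" and N3: "2 * pi * r / real N < \<delta>2"
    and N4: "K * (poly_area N (regular_polygon N 0 r0) - a0)\<^sup>2 < (1 - q) * pi * r0"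
    and N5: "K * (poly_area N (regular_polygon N c r) - a0)\<^sup>2 - 3 * g0 / 4 * poly_area N (regular_polygon N c r)
        < K * (pi * r\<^sup>2 - a0)\<^sup>2 - 3 * g0 / 4 * (pi * r\<^sup>2) + e / 2"
    by blast
  have N0: "N > 0"
    using N1 by simp
  obtain x where per: "periodic N x"
    and min: "\<And>y. periodic N y \<Longrightarrow> poly_energy Q K a0 N x + \<mu> * mean_norm N x
              \<le> poly_energy Q K a0 N y + \<mu> * mean_norm N y"
    using minimiser_exists[OF unif_div_continuous[OF div] Q q _ \<mu>(1) N0, of K a0] K by auto
  define l A where "l = poly_length N x" and "A = poly_area N x"
  have pen: "\<mu> * mean_norm N x \<ge> 0"
    using \<mu>(1) mean_norm_nonneg by simp
  have flux_le: "\<bar>poly_flux Q N x\<bar> \<le> q * l"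
    unfolding l_def by (rule abs_poly_flux_le[OF Q])
  \<comment> \<open>Length and flux of the comparison polygon cost at most
    \<open>(1 + q) * (2 * pi * r0)\<close>; its area defect and its penalty take at most
    \<open>(1 - q) * pi * r0\<close> each. The sum is \<open>S\<close>.\<close>
  have bound: "(1 - q) * l + K * (A - a0)\<^sup>2 \<le> S"
  proof -
    let ?y = "regular_polygon N 0 r0"
    have ly: "poly_length N ?y \<le> 2 * pi * r0"
      using r0 N0 by (intro poly_length_regular_polygon) auto
    have "poly_energy Q K a0 N x + \<mu> * mean_norm N x \<le> poly_energy Q K a0 N ?y + \<mu> * mean_norm N ?y"
      by (rule min[OF regular_polygon_periodic[OF N0]])
    moreover have "\<bar>poly_flux Q N ?y\<bar> \<le> q * poly_length N ?y"
      by (rule abs_poly_flux_le[OF Q])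
    moreover have "q * poly_length N ?y \<le> q * (2 * pi * r0)"
      using ly q0 by (rule mult_left_mono)
    moreover have "\<mu> * mean_norm N ?y \<le> (1 - q) * pi * r0"
    proof -
      have "\<mu> * mean_norm N ?y \<le> \<mu> * (norm (0::complex) + r0)"
        using \<mu>(1) r0 N0 by (intro mult_left_mono mean_norm_regular_polygon) auto
      then show ?thesis
        using \<mu>(4) by simp
    qed
    moreover have "(1 + q) * (2 * pi * r0) + 2 * ((1 - q) * pi * r0) = S"
      by (simp add: S_def algebra_simps)
    ultimately have "l - poly_flux Q N x + K * (A - a0)\<^sup>2 \<le> S"
      using N4 ly pen unfolding poly_energy_def l_def A_def by (simp add: algebra_simps)
    then show ?thesis
      using flux_le by (simp add: algebra_simps)
  qed
  have l0: "l \<ge> 0"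
    by (simp add: l_def poly_length_nonneg)
  have "K * (A - a0)\<^sup>2 \<le> K * (a0 / 2)\<^sup>2"
    using bound l0 q unfolding SK by (smt (verit) mult_nonneg_nonneg)
  then have "(A - a0)\<^sup>2 \<le> (a0 / 2)\<^sup>2"
    using K by simp
  then have Aa0: "\<bar>A - a0\<bar> \<le> a0 / 2"
    using a0 by (metis abs_le_square_iff abs_of_pos half_gt_zero)
  \<comment> \<open>Zero length would mean zero area, which differs from \<open>a0\<close> by more
    than \<open>a0 / 2\<close>. The length can be differentiated only where it is positive.\<close>
  have lpos: "l > 0"
  proof (rule ccontr)
    assume "\<not> l > 0"
    then have "A = 0"
      using poly_area_eq_0[OF per N0] l0 unfolding l_def A_def by simp
    then show False
      using Aa0 a0 by simp
  qed
  have lS: "l \<le> S / (1 - q)"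
  proof -
    have "(1 - q) * l \<le> S"
      using bound K by (smt (verit) mult_nonneg_nonneg zero_le_power2)
    then show ?thesis
      using q by (simp add: field_simps)
  qed
  have edge: "norm (x (k + 1) - x k) \<le> T N" for k
  proof -
    have "norm (x (k + 1) - x k) \<le> l / sqrt (real N)"
      unfolding l_def by (rule edge_le_poly_length[OF per N0])
    also have "\<dots> \<le> T N"
      unfolding T_def using lS by (intro divide_right_mono) auto
    finally show ?thesis .
  qed
  have small: "norm (x (k + 1) - x k) \<le> \<delta>1" "norm (x (k + 1) - x k) \<le> \<delta>2" for k
    using edge[of k] N2 by auto
  have dEL: "discrete_EL e H (- 2 * K * (A - a0)) N x"
  proof (rule discrete_EL_perturb[OF N0 per _ e \<mu>(2) \<epsilon>(2), of G])
    show "\<bar>G p - H p\<bar> \<le> e / 4" for p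
      using GH[of p] e1(2) by linarith
    show "norm (velocity N x k - velocity N x (k - 1)
            - (poly_length N x / real N * (G (x k) + - 2 * K * (A - a0))) *\<^sub>R (\<i> * (velocity N x k + velocity N x (k - 1)) / 2))
          \<le> poly_length N x / real N * (\<mu> + \<epsilon> / 2 * (norm (velocity N x k) + norm (velocity N x (k - 1))))" for k
      using EL[OF N0 per less_imp_le[OF \<mu>(1)] lpos[unfolded l_def] small(1) min, of k] by (simp add: A_def)
  qed
  have test: "l + K * (A - a0)\<^sup>2 \<le> 2 * pi * r + K * (pi * r\<^sup>2 - a0)\<^sup>2 - g0 * pi * r\<^sup>2 / 2 + (\<eta> + e) * l\<^sup>2 + e"
    if g0: "g0 > 0" and \<eta>: "\<And>p. p \<in> cball (x 0) l \<Longrightarrow> \<bar>H p\<bar> \<le> \<eta>" for \<eta>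
  proof -
    let ?y = "regular_polygon N c r"
    have "\<bar>poly_flux Q N x\<bar> \<le> (\<eta> + e1 + \<epsilon>) * l * poly_length N x"
    proof (rule flux[OF per small(2)])
      show "norm (x k - x 0) \<le> l" for k
        unfolding l_def by (rule periodic_dist_le_poly_length[OF per N0])
      show "\<bar>G p\<bar> \<le> \<eta> + e1" if "p \<in> cball (x 0) l" for p
        using \<eta>[OF that] GH[of p] by linarith
    qed
    also have "\<dots> = (\<eta> + e1 + \<epsilon>) * l\<^sup>2"
      by (simp add: l_def power2_eq_square)
    also have "\<dots> \<le> (\<eta> + e) * l\<^sup>2"
      using e1 \<epsilon> by (intro mult_right_mono) auto
    finally have fx: "poly_flux Q N x \<le> (\<eta> + e) * l\<^sup>2"
      by simp
    have ly: "poly_length N ?y \<le> 2 * pi * r"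
      using disc(1) N0 by (intro poly_length_regular_polygon) auto
    have "poly_flux Q N ?y \<ge> (3 * g0 / 4) * poly_area N ?y - \<epsilon> * r * poly_length N ?y"
    proof (rule flux_ge[OF regular_polygon_periodic[OF N0]])
      show "norm (?y (k + 1) - ?y k) \<le> \<delta>2" for k
        using regular_polygon_edge[OF disc(1), of N c k] N3 by linarith
      show "norm (?y k - c) \<le> r" for k
        by (simp add: norm_regular_polygon_centred[OF disc(1)])
      show "wedge (?y k - c) (?y (k + 1) - ?y (k - 1)) \<ge> 0" for k
        by (rule regular_polygon_convex[OF disc(1) N1(2)])
      show "3 * g0 / 4 \<le> G p" if "p \<in> cball c r" for p
      proof -
        have "e1 \<le> g0 / 4"
          using g0 by (simp add: e1_def)
        then show ?thesis
          using disc(3)[OF g0 that] GH[of p] by linarith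
      qed
    qed
    moreover have "\<epsilon> * r * poly_length N ?y \<le> g0 * pi * r\<^sup>2 / 8"
    proof -
      have "\<epsilon> * r * poly_length N ?y \<le> (g0 / 16) * r * (2 * pi * r)"
        using g0 disc(1) ly poly_length_nonneg \<epsilon>(1) by (intro mult_mono) (auto simp: \<epsilon>_def)
      then show ?thesis
        by (simp add: power2_eq_square algebra_simps)
    qed
    moreover have "\<mu> * mean_norm N ?y \<le> e / 2"
    proof -
      have "\<mu> * mean_norm N ?y \<le> \<mu> * (norm c + r)"
        using \<mu>(1) disc(1) N0 by (intro mult_left_mono mean_norm_regular_polygon) auto
      then show ?thesis
        using \<mu>(3) by simp
    qed
    moreover have "poly_energy Q K a0 N x + \<mu> * mean_norm N x \<le> poly_energy Q K a0 N ?y + \<mu> * mean_norm N ?y"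
      by (rule min[OF regular_polygon_periodic[OF N0]])
    moreover have "g0 * pi * r\<^sup>2 \<ge> 0"
      using g0 by simp
    ultimately show ?thesis
      using fx ly pen N5 unfolding poly_energy_def l_def[symmetric] A_def[symmetric] by (simp add: algebra_simps)
  qed
  show ?thesis
    by (rule that[of N x]) (use N1 dEL bound Aa0 test in \<open>simp_all add: l_def A_def\<close>)
qed


section \<open>Existence of loops\<close>

text \<open>The period is normalised to 1, so the speed \<open>ell\<close> is the length of the
  whole run, which may cover its image several times. \<open>A\<close> is positive for
  counterclockwise circles, opposite in sign to \<open>loop_area\<close>.\<close>

definition ode_loop :: "(complex \<Rightarrow> real) \<Rightarrow> real \<Rightarrow> real \<Rightarrow> real \<Rightarrow> (real \<Rightarrow> complex) \<Rightarrow> (real \<Rightarrow> complex) \<Rightarrow> bool" where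
  "ode_loop H ell lm A U V \<longleftrightarrow>
     (\<forall>t. (U has_vector_derivative V t) (at t)) \<and>
     (\<forall>t. (V has_vector_derivative (ell * (H (U t) + lm)) *\<^sub>R (\<i> * V t)) (at t)) \<and>
     (\<forall>t. norm (V t) = ell) \<and> (\<forall>t. U (t + 1) = U t) \<and>
     ((\<lambda>t. 1/2 * wedge (U t) (V t)) has_integral A) {0..1}"

definition has_loops :: "(complex \<Rightarrow> real) \<Rightarrow> real \<Rightarrow> bool" where
  "has_loops H q \<longleftrightarrow> (\<forall>r>0. \<exists>ell lm A U V. ode_loop H ell lm A U V \<and>
      \<bar>A - pi * r\<^sup>2\<bar> \<le> pi * r\<^sup>2 / 2 \<and> (1 - q) * ell \<le> 4 * pi * r \<and> \<bar>lm\<bar> \<le> 16 / r)"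

lemma discrete_EL_translate:
  assumes "discrete_EL e H lm N x"
  shows "discrete_EL e (\<lambda>p. H (p + c)) lm N (\<lambda>k. x k - c)"
proof -
  have "velocity N (\<lambda>k. x k - c) = velocity N x"
    by (simp add: fun_eq_iff velocity_def)
  moreover have "poly_length N (\<lambda>k. x k - c) = poly_length N x"
    by (simp add: poly_length_def)
  ultimately show ?thesis
    using assms unfolding discrete_EL_def periodic_def by simp
qed

lemma poly_length_translate: "poly_length N (\<lambda>k. x k - c) = poly_length N x"
  by (simp add: poly_length_def)

lemma near_multiplier_bound:
  assumes "r > 0" and "\<bar>A - pi * r\<^sup>2\<bar> \<le> pi * r\<^sup>2 / 2"
  shows "\<bar>- 2 * (16 / (pi * r ^ 3)) * (A - pi * r\<^sup>2)\<bar> \<le> 16 / r"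
proof -
  have "\<bar>- 2 * (16 / (pi * r ^ 3)) * (A - pi * r\<^sup>2)\<bar> = 2 * (16 / (pi * r ^ 3)) * \<bar>A - pi * r\<^sup>2\<bar>"
    using assms(1) by (subst abs_mult) simp
  also have "\<dots> \<le> 2 * (16 / (pi * r ^ 3)) * (pi * r\<^sup>2 / 2)"
    using assms by (intro mult_left_mono) auto
  also have "\<dots> = 16 / r"
    using assms(1) by (simp add: power2_eq_square power3_eq_cube)
  finally show ?thesis .
qed

lemma polygon_sequence_limit:
  fixes r q :: real and N :: "nat \<Rightarrow> nat" and x :: "nat \<Rightarrow> int \<Rightarrow> complex" and h :: "nat \<Rightarrow> complex \<Rightarrow> real"
  defines "K \<equiv> 16 / (pi * r ^ 3)" and "a0 \<equiv> pi * r\<^sup>2"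
  assumes r: "r > 0" and q: "q < 1"
    and e: "e \<longlonglongrightarrow> 0" "\<And>n. 0 < e n" "\<And>n. e n \<le> 1"
    and N: "\<And>n. real (N n) \<ge> 1 / e n"
    and EL: "\<And>n. discrete_EL (e n) (h n) (- 2 * K * (poly_area (N n) (x n) - a0)) (N n) (x n)"
    and en: "\<And>n. (1 - q) * poly_length (N n) (x n) + K * (poly_area (N n) (x n) - a0)\<^sup>2 \<le> 4 * pi * r"
    and ar: "\<And>n. \<bar>poly_area (N n) (x n) - a0\<bar> \<le> a0 / 2"
    and x0: "\<And>n. norm (x n 0) \<le> R" and M: "\<And>n p. \<bar>h n p\<bar> \<le> M"
    and equi: "\<And>\<epsilon>. \<epsilon> > 0 \<Longrightarrow> \<exists>\<delta>>0. \<forall>n p q. dist p q < \<delta> \<longrightarrow> \<bar>h n p - h n q\<bar> \<le> \<epsilon>"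
    and hg: "\<And>p. (\<lambda>n. h n p) \<longlonglongrightarrow> g p"
  obtains F ell lm A U V where "F \<noteq> bot" "F \<le> sequentially" "ode_loop g ell lm A U V"
    "((\<lambda>n. poly_length (N n) (x n)) \<longlongrightarrow> ell) F" "((\<lambda>n. poly_area (N n) (x n)) \<longlongrightarrow> A) F"
    "\<bar>A - a0\<bar> \<le> a0 / 2" "(1 - q) * ell \<le> 4 * pi * r" "\<bar>lm\<bar> \<le> 16 / r"
proof -
  have K: "K > 0"
    using r by (simp add: K_def)
  have len: "(1 - q) * poly_length (N n) (x n) \<le> 4 * pi * r" for n
    using en[of n] K by (smt (verit) mult_nonneg_nonneg zero_le_power2)
  have Nlim: "filterlim N at_top sequentially"
  proof -
    have "filterlim (\<lambda>n. inverse (e n)) at_top sequentially"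
      by (rule filterlim_inverse_at_top[OF e(1)]) (simp add: e(2))
    then have "filterlim (\<lambda>n. real (N n)) at_top sequentially"
      by (rule filterlim_at_top_mono) (use N in \<open>simp add: inverse_eq_divide\<close>)
    then show ?thesis
      by (simp add: filterlim_sequentially_iff_filterlim_real)
  qed
  have lm: "\<bar>- 2 * K * (poly_area (N n) (x n) - a0)\<bar> \<le> 16 / r" for n
    using near_multiplier_bound[OF r] ar[of n] unfolding K_def a0_def by blast
  have L: "poly_length (N n) (x n) \<le> 4 * pi * r / (1 - q)" for n
    using len[of n] q by (simp add: field_simps)
  obtain F U V ell lm0 A where F: "F \<noteq> bot" "F \<le> sequentially"
    and U: "\<And>t. (U has_vector_derivative V t) (at t)"
    and V: "\<And>t. (V has_vector_derivative (ell * (g (U t) + lm0)) *\<^sub>R (\<i> * V t)) (at t)"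
    and nV: "\<And>t. norm (V t) = ell" and per: "\<And>t. U (t + 1) = U t"
    and l: "((\<lambda>n. poly_length (N n) (x n)) \<longlongrightarrow> ell) F"
    and lm0: "((\<lambda>n. - 2 * K * (poly_area (N n) (x n) - a0)) \<longlongrightarrow> lm0) F"
    and A: "((\<lambda>n. poly_area (N n) (x n)) \<longlongrightarrow> A) F"
    and I: "((\<lambda>t. 1/2 * wedge (U t) (V t)) has_integral A) {0..1}"
    using polygon_limit[OF Nlim EL e(1) less_imp_le[OF e(2)] e(3) x0 L lm M equi hg] by blast
  have "\<bar>A - a0\<bar> \<le> a0 / 2"
    by (rule tendsto_upperbound[OF tendsto_rabs[OF tendsto_diff[OF A tendsto_const]] _ F(1)]) (intro always_eventually allI ar)
  moreover have "(1 - q) * ell \<le> 4 * pi * r"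
    by (rule tendsto_upperbound[OF tendsto_mult[OF tendsto_const l] _ F(1)]) (intro always_eventually allI len)
  moreover have "\<bar>lm0\<bar> \<le> 16 / r"
    by (rule tendsto_upperbound[OF tendsto_rabs[OF lm0] _ F(1)]) (intro always_eventually allI lm)
  moreover have "ode_loop g ell lm0 A U V"
    unfolding ode_loop_def using U V nV per I by blast
  ultimately show ?thesis
    using that F l A by blast
qed

lemma inverse_Suc_tendsto: "(\<lambda>n. 1 / (real n + 1)) \<longlonglongrightarrow> 0"
  using LIMSEQ_inverse_real_of_nat by (simp add: inverse_eq_divide add.commute)

section \<open>Case (A): compactness by lattice translations\<close>

theorem has_loops_periodic:
  assumes H: "approximable H q" "q < 1" and M: "\<And>p. \<bar>H p\<bar> \<le> M" and uc: "uniformly_continuous_on UNIV H"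
    and per: "\<And>p m n. H (p + of_int m + \<i> * of_int n) = H p"
  shows "has_loops H q"
  unfolding has_loops_def
proof (intro allI impI)
  fix r :: real
  assume r: "r > 0"
  define e where "e n = 1 / (real n + 1)" for n
  have e: "e n > 0" "e n \<le> 1" for n
    by (auto simp: e_def)
  define P where "P n N x \<longleftrightarrow> real N \<ge> 1 / e n \<and>
      discrete_EL (e n) H (- 2 * (16 / (pi * r ^ 3)) * (poly_area N x - pi * r\<^sup>2)) N x \<and>
      (1 - q) * poly_length N x + (16 / (pi * r ^ 3)) * (poly_area N x - pi * r\<^sup>2)\<^sup>2 \<le> 4 * pi * r \<and>
      \<bar>poly_area N x - pi * r\<^sup>2\<bar> \<le> pi * r\<^sup>2 / 2" for n N x
  have "\<exists>N x. P n N x \<and> norm (x 0) \<le> 2" for n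
  proof -
    \<comment> \<open>Radius and gain 0 switch off the test disc; compactness comes from
      periodicity.\<close>
    obtain N x where P: "P n N x"
      by (rule exists_near_minimiser[OF H r e(1)[of n], of 0 0 0]) (simp_all add: P_def)
    define c :: complex where "c = of_int \<lfloor>Re (x 0)\<rfloor> + \<i> * of_int \<lfloor>Im (x 0)\<rfloor>"
    have Hc: "(\<lambda>p. H (p + c)) = H"
      using per by (simp add: c_def add.assoc[symmetric])
    have pN: "periodic N x"
      using P by (simp add: P_def discrete_EL_def)
    have "P n N (\<lambda>k. x k - c)"
      using P discrete_EL_translate[of "e n" H _ N x c] unfolding P_def Hc
      by (simp add: poly_area_translate[OF pN] poly_length_translate)
    moreover have "norm (x 0 - c) \<le> 2"
    proof -
      have "Re (x 0 - c) = Re (x 0) - of_int \<lfloor>Re (x 0)\<rfloor>" "Im (x 0 - c) = Im (x 0) - of_int \<lfloor>Im (x 0)\<rfloor>"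
        by (simp_all add: c_def)
      then have "\<bar>Re (x 0 - c)\<bar> \<le> 1" "\<bar>Im (x 0 - c)\<bar> \<le> 1"
        by linarith+
      then show ?thesis
        using cmod_le[of "x 0 - c"] by linarith
    qed
    ultimately show ?thesis
      by blast
  qed
  then obtain N x where P: "\<And>n. P n (N n) (x n)" and x0: "\<And>n. norm (x n 0) \<le> 2"
    by metis
  have equi: "\<exists>\<delta>>0. \<forall>n p q. dist p q < \<delta> \<longrightarrow> \<bar>H p - H q\<bar> \<le> \<epsilon>" if "\<epsilon> > 0" for \<epsilon>
    using uc that unfolding uniformly_continuous_on_def by (metis UNIV_I dist_commute dist_real_def less_imp_le)
  obtain F ell lm A U V where "ode_loop H ell lm A U V" "\<bar>A - pi * r\<^sup>2\<bar> \<le> pi * r\<^sup>2 / 2"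
      "(1 - q) * ell \<le> 4 * pi * r" "\<bar>lm\<bar> \<le> 16 / r"
  proof (rule polygon_sequence_limit[OF r H(2), of e N "\<lambda>_. H" x 2 M H])
    show "e \<longlonglongrightarrow> 0"
      unfolding e_def by (rule inverse_Suc_tendsto)
  qed (use e P x0 M equi in \<open>auto simp: P_def\<close>)
  then show "\<exists>ell lm A U V. ode_loop H ell lm A U V \<and>
      \<bar>A - pi * r\<^sup>2\<bar> \<le> pi * r\<^sup>2 / 2 \<and> (1 - q) * ell \<le> 4 * pi * r \<and> \<bar>lm\<bar> \<le> 16 / r"
    by blast
qed

section \<open>Case (B): circles at infinity and the test polygon\<close>

lemma ode_loop_velocity_periodic:
  assumes "ode_loop H ell lm A U V"
  shows "V (t + 1) = V t"
proof -
  have "((\<lambda>s. U (s + 1)) has_vector_derivative V (t + 1)) (at t)"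
  proof -
    have "((\<lambda>s. s + 1) has_vector_derivative 1) (at t)"
      by (auto intro!: derivative_eq_intros)
    then show ?thesis
      using vector_diff_chain_at[of "\<lambda>s. s + 1" 1 t U "V (t + 1)"] assms
      unfolding ode_loop_def o_def by simp
  qed
  moreover have "(\<lambda>s. U (s + 1)) = U"
    using assms by (simp add: ode_loop_def)
  ultimately show ?thesis
    using assms vector_derivative_unique_at unfolding ode_loop_def by metis
qed

lemma zero_derivative_imp_constant:
  fixes f :: "real \<Rightarrow> 'b::real_normed_vector"
  assumes "\<And>t. (f has_vector_derivative 0) (at t)"
  shows "f s = f t"
proof -
  obtain c where "\<And>x. x \<in> UNIV \<Longrightarrow> f x = c"
    using has_vector_derivative_zero_constant[of UNIV f] assms by auto
  then show ?thesis
    by simp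
qed

text \<open>For vanishing \<open>H\<close> the equation is linear with angular velocity
  \<open>\<omega> = ell * lm\<close>. Closing up after time 1 makes \<open>\<omega>\<close> a
  nonzero multiple of \<open>2 * pi\<close>, and integration around the centre gives
  \<open>\<omega> * A = ell^2 / 2\<close>. Multiple coverings of a circle only strengthen the
  inequality.\<close>

lemma free_loop_isoperimetric:
  assumes loop: "ode_loop (\<lambda>_. 0) ell lm A U V" and A: "A > 0"
  shows "4 * pi * A \<le> ell\<^sup>2"
proof -
  define \<omega> where "\<omega> = ell * lm"
  have dU: "(U has_vector_derivative V t) (at t)"
    and dV: "(V has_vector_derivative \<omega> *\<^sub>R (\<i> * V t)) (at t)"
    and nV: "norm (V t) = ell" and per: "U (t + 1) = U t" for t
    using loop by (simp_all add: ode_loop_def \<omega>_def)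
  have I: "((\<lambda>t. 1/2 * wedge (U t) (V t)) has_integral A) {0..1}"
    using loop by (simp add: ode_loop_def)
  have "ell \<noteq> 0"
  proof
    assume "ell = 0"
    then have "V t = 0" for t
      using nV[of t] by simp
    then have "((\<lambda>t. 0) has_integral A) {0..1::real}"
      using I by (simp add: wedge.zero_right)
    then show False
      using A has_integral_unique[OF has_integral_0] by blast
  qed
  have "((\<lambda>t. V t * cis (- \<omega> * t)) has_vector_derivative 0) (at t)" for t
  proof -
    have "((\<lambda>t. cis (- \<omega> * t)) has_vector_derivative (- \<omega>) *\<^sub>R (\<i> * cis (- \<omega> * t))) (at t)"
    proof -
      have "((\<lambda>z. exp (- (\<i> * of_real \<omega>) * z)) has_field_derivative
          exp (- (\<i> * of_real \<omega>) * of_real t) * - (\<i> * of_real \<omega>)) (at (of_real t))"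
        by (auto intro!: derivative_eq_intros)
      from has_vector_derivative_real_field[OF this] show ?thesis
        by (simp add: cis_conv_exp scaleR_conv_of_real mult_ac)
    qed
    from has_vector_derivative_mult[OF dV this] show ?thesis
      by (simp add: scaleR_conv_of_real algebra_simps)
  qed
  then have rot: "V t * cis (- \<omega> * t) = V 0 * cis (- \<omega> * 0)" for t
    by (rule zero_derivative_imp_constant)
  from this[of 1] have "V 1 * cis (- \<omega>) = V 0"
    by simp
  moreover have "V 1 = V 0"
    using ode_loop_velocity_periodic[OF loop, of 0] by simp
  moreover have "V 0 \<noteq> 0"
    using nV[of 0] \<open>ell \<noteq> 0\<close> by auto
  ultimately have "cis (- \<omega>) = 1"
    by simp
  then have "cos \<omega> = 1"
    by (simp add: complex_eq_iff)
  then obtain m :: int where m: "\<omega> = of_int m * 2 * pi"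
    using cos_one_2pi_int by auto
  have V_int: "(V has_integral 0) {0..1}"
    using fundamental_theorem_of_calculus[of 0 1 U V] dU per[of 0]
    by (simp add: has_vector_derivative_at_within)
  \<comment> \<open>With \<open>\<omega> = 0\<close> the velocity would be constant and nonzero, and
    \<open>U\<close> could not return to its starting point.\<close>
  have "\<omega> \<noteq> 0"
  proof
    assume "\<omega> = 0"
    then have "V t = V 0" for t
      using rot[of t] by simp
    then have "((\<lambda>t. V 0) has_integral 0) {0..1::real}"
      using V_int by (metis ext)
    moreover have "((\<lambda>t. V 0) has_integral V 0) {0..1::real}"
      using has_integral_const_real[of "V 0" 0 1] by simp
    ultimately show False
      using \<open>V 0 \<noteq> 0\<close> has_integral_unique by blast
  qed
  then have "\<bar>\<omega>\<bar> \<ge> 2 * pi"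
    unfolding m by (auto simp: abs_mult)
  \<comment> \<open>The conserved quantity is \<open>\<omega>\<close> times the centre of the
    circle.\<close>
  have "((\<lambda>t. \<omega> *\<^sub>R U t + \<i> * V t) has_vector_derivative 0) (at t)" for t
  proof -
    have "((\<lambda>t. \<omega> *\<^sub>R U t + \<i> * V t) has_vector_derivative (\<omega> *\<^sub>R V t + \<i> * (\<omega> *\<^sub>R (\<i> * V t)))) (at t)"
      by (intro has_vector_derivative_add has_vector_derivative_mult_right dV
          bounded_linear.has_vector_derivative[OF bounded_linear_scaleR_right] dU)
    moreover have "\<omega> *\<^sub>R V t + \<i> * (\<omega> *\<^sub>R (\<i> * V t)) = 0"
      by (simp add: complex_eq_iff)
    ultimately show ?thesis
      by (simp only:)
  qed
  then have c: "\<omega> *\<^sub>R U t + \<i> * V t = \<omega> *\<^sub>R U 0 + \<i> * V 0" for t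
    by (rule zero_derivative_imp_constant)
  define c where "c = \<omega> *\<^sub>R U 0 + \<i> * V 0"
  have "wedge (\<omega> *\<^sub>R U t) (V t) = wedge c (V t) + ell\<^sup>2" for t
  proof -
    have "\<omega> *\<^sub>R U t = c - \<i> * V t"
      using c[of t] by (simp add: c_def algebra_simps)
    moreover have "wedge (\<i> * V t) (V t) = - (norm (V t))\<^sup>2"
      unfolding cmod_power2 wedge_def by (simp add: power2_eq_square)
    ultimately show ?thesis
      by (simp add: wedge.diff_left nV)
  qed
  then have *: "\<omega> * (1/2 * wedge (U t) (V t)) = 1/2 * wedge c (V t) + 1/2 * ell\<^sup>2" for t
    by (simp add: wedge.scaleR_left algebra_simps)
  have I1: "((\<lambda>t. \<omega> * (1/2 * wedge (U t) (V t))) has_integral \<omega> * A) {0..1}"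
    by (rule has_integral_mult_right[OF I])
  have I2: "((\<lambda>t. \<omega> * (1/2 * wedge (U t) (V t))) has_integral 1/2 * wedge c 0 + 1/2 * ell\<^sup>2) {0..1}"
    unfolding *
  proof (intro has_integral_add has_integral_mult_right)
    show "((\<lambda>t. wedge c (V t)) has_integral wedge c 0) {0..1}"
      using has_integral_linear[OF V_int wedge.bounded_linear_right[of c]] by (simp add: o_def)
    show "((\<lambda>t. ell\<^sup>2) has_integral ell\<^sup>2) {0..1::real}"
      using has_integral_const_real[of "ell\<^sup>2" 0 1] by simp
  qed
  have \<omega>A: "\<omega> * A = 1/2 * ell\<^sup>2"
    using has_integral_unique[OF I1 I2] by (simp add: wedge.zero_right)
  have "\<bar>\<omega>\<bar> * A = \<bar>\<omega> * A\<bar>"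
    using A by (simp add: abs_mult)
  then have "\<bar>\<omega>\<bar> * A = 1/2 * ell\<^sup>2"
    unfolding \<omega>A by simp
  moreover have "2 * pi * A \<le> \<bar>\<omega>\<bar> * A"
    using \<open>\<bar>\<omega>\<bar> \<ge> 2 * pi\<close> A by (intro mult_right_mono) auto
  ultimately show ?thesis
    by simp
qed


text \<open>The radius \<open>r\<close> has energy \<open>2 * pi * r\<close> and larger radii have
  more, so a minimum over the compact interval \<open>{0..r}\<close> is a global one; radius 0 costs
  \<open>16 * pi * r\<close> and is excluded.\<close>

lemma circle_energy_minimum:
  fixes r K :: real
  assumes r: "r > 0" and K: "K = 16 / (pi * r ^ 3)"
  obtains s where "s > 0" "\<And>t. t \<ge> 0 \<Longrightarrow> 2 * pi * s + K * (pi * s\<^sup>2 - pi * r\<^sup>2)\<^sup>2 \<le> 2 * pi * t + K * (pi * t\<^sup>2 - pi * r\<^sup>2)\<^sup>2"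
proof -
  define \<psi> where "\<psi> t = 2 * pi * t + K * (pi * t\<^sup>2 - pi * r\<^sup>2)\<^sup>2" for t
  have K0: "K > 0"
    using r K by simp
  have "continuous_on {0..r} \<psi>"
    unfolding \<psi>_def by (intro continuous_intros)
  then obtain s where s: "s \<in> {0..r}" "\<And>t. t \<in> {0..r} \<Longrightarrow> \<psi> s \<le> \<psi> t"
    using continuous_attains_inf[of "{0..r}" \<psi>] r by auto
  have "\<psi> s \<le> \<psi> t" if "t \<ge> 0" for t
  proof (cases "t \<le> r")
    case False
    have "\<psi> s \<le> \<psi> r"
      using s(2) r by simp
    also have "\<psi> r = 2 * pi * r"
      by (simp add: \<psi>_def)
    also have "\<dots> \<le> 2 * pi * t"
      using False by simp
    also have "\<dots> \<le> \<psi> t"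
      using K0 by (simp add: \<psi>_def)
    finally show ?thesis .
  qed (use s that in auto)
  moreover have "s > 0"
  proof (rule ccontr)
    assume "\<not> s > 0"
    then have "\<psi> s = K * (pi * r\<^sup>2)\<^sup>2"
      using s(1) by (simp add: \<psi>_def)
    also have "\<dots> = 16 * pi * r"
      using r by (simp add: K power2_eq_square power3_eq_cube)
    finally have "\<psi> r < \<psi> s"
      using r by (simp add: \<psi>_def)
    then show False
      using s(2)[of r] r by simp
  qed
  ultimately show ?thesis
    using that unfolding \<psi>_def by blast
qed

theorem has_loops_decaying:
  assumes H: "approximable H q" "q < 1" and M: "\<And>p. \<bar>H p\<bar> \<le> M" and uc: "uniformly_continuous_on UNIV H"
    and decay: "(H \<longlongrightarrow> 0) at_infinity"
    and discs: "\<And>r. r > 0 \<Longrightarrow> \<exists>c g0. g0 > 0 \<and> (\<forall>p\<in>cball c r. g0 \<le> H p)"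
  shows "has_loops H q"
  unfolding has_loops_def
proof (intro allI impI)
  fix r :: real
  assume r: "r > 0"
  define K where "K = 16 / (pi * r ^ 3)"
  define a0 where "a0 = pi * r\<^sup>2"
  have K: "K > 0" and a0: "a0 > 0"
    using r by (simp_all add: K_def a0_def)
  obtain s where s: "s > 0" "\<And>t. t \<ge> 0 \<Longrightarrow> 2 * pi * s + K * (pi * s\<^sup>2 - a0)\<^sup>2 \<le> 2 * pi * t + K * (pi * t\<^sup>2 - a0)\<^sup>2"
    using circle_energy_minimum[OF r K_def] unfolding a0_def by blast
  \<comment> \<open>The disc has the radius of the best circle, so that the flux gained there is a
    strict gain over all circles at infinity.\<close>
  obtain c g0 where g0: "g0 > 0" "\<And>p. p \<in> cball c s \<Longrightarrow> g0 \<le> H p"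
    using discs[OF s(1)] by blast
  define e where "e n = 1 / (real n + 1)" for n
  have e: "e n > 0" "e n \<le> 1" for n
    by (auto simp: e_def)
  have elim0: "e \<longlonglongrightarrow> 0"
    unfolding e_def by (rule inverse_Suc_tendsto)
  define P where "P n N x \<longleftrightarrow> real N \<ge> 1 / e n \<and>
      discrete_EL (e n) H (- 2 * K * (poly_area N x - a0)) N x \<and>
      (1 - q) * poly_length N x + K * (poly_area N x - a0)\<^sup>2 \<le> 4 * pi * r \<and>
      \<bar>poly_area N x - a0\<bar> \<le> a0 / 2 \<and>
      (\<forall>\<eta>. (\<forall>p\<in>cball (x 0) (poly_length N x). \<bar>H p\<bar> \<le> \<eta>) \<longrightarrow>
         poly_length N x + K * (poly_area N x - a0)\<^sup>2
        \<le> 2 * pi * s + K * (pi * s\<^sup>2 - a0)\<^sup>2 - g0 * pi * s\<^sup>2 / 2 + (\<eta> + e n) * (poly_length N x)\<^sup>2 + e n)" for n N x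
  have "\<exists>N x. P n N x" for n
  proof -
    obtain N x where "real N \<ge> 1 / e n"
      "discrete_EL (e n) H (- 2 * K * (poly_area N x - a0)) N x"
      "(1 - q) * poly_length N x + K * (poly_area N x - a0)\<^sup>2 \<le> 4 * pi * r"
      "\<bar>poly_area N x - a0\<bar> \<le> a0 / 2"
      "\<And>\<eta>. g0 > 0 \<Longrightarrow> (\<And>p. p \<in> cball (x 0) (poly_length N x) \<Longrightarrow> \<bar>H p\<bar> \<le> \<eta>) \<Longrightarrow>
        poly_length N x + K * (poly_area N x - a0)\<^sup>2
        \<le> 2 * pi * s + K * (pi * s\<^sup>2 - a0)\<^sup>2 - g0 * pi * s\<^sup>2 / 2 + (\<eta> + e n) * (poly_length N x)\<^sup>2 + e n"
      using exists_near_minimiser[OF H r e(1)[of n] less_imp_le[OF s(1)] less_imp_le[OF g0(1)] g0(2)]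
      unfolding K_def a0_def by blast
    then show ?thesis
      using g0(1) unfolding P_def by blast
  qed
  then obtain N x where P: "\<And>n. P n (N n) (x n)"
    by metis
  have N: "real (N n) \<ge> 1 / e n"
    and EL: "discrete_EL (e n) H (- 2 * K * (poly_area (N n) (x n) - a0)) (N n) (x n)"
    and en: "(1 - q) * poly_length (N n) (x n) + K * (poly_area (N n) (x n) - a0)\<^sup>2 \<le> 4 * pi * r"
    and ar: "\<bar>poly_area (N n) (x n) - a0\<bar> \<le> a0 / 2" for n
    using P[of n] unfolding P_def by blast+
  have test: "poly_length (N n) (x n) + K * (poly_area (N n) (x n) - a0)\<^sup>2
        \<le> 2 * pi * s + K * (pi * s\<^sup>2 - a0)\<^sup>2 - g0 * pi * s\<^sup>2 / 2 + (\<eta> + e n) * (poly_length (N n) (x n))\<^sup>2 + e n"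
    if "\<And>p. p \<in> cball (x n 0) (poly_length (N n) (x n)) \<Longrightarrow> \<bar>H p\<bar> \<le> \<eta>" for n \<eta>
    using P[of n] that unfolding P_def by blast
  have equi: "\<exists>\<delta>>0. \<forall>p q. dist p q < \<delta> \<longrightarrow> \<bar>H p - H q\<bar> \<le> \<epsilon>" if "\<epsilon> > 0" for \<epsilon>
    using uc that unfolding uniformly_continuous_on_def by (metis UNIV_I dist_commute dist_real_def less_imp_le)
  note lim = polygon_sequence_limit[OF r H(2), folded K_def a0_def]
  \<comment> \<open>Either the first vertices tend to infinity, which is refuted, or infinitely many
    of them lie in one ball and a subsequence can be used.\<close>
  have "\<exists>R. \<not> eventually (\<lambda>n. norm (x n 0) > R) sequentially"
  proof (rule ccontr)
    assume "\<nexists>R. \<not> eventually (\<lambda>n. norm (x n 0) > R) sequentially"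
    then have far: "eventually (\<lambda>n. norm (x n 0) > R) sequentially" for R
      by blast
    have xinf: "filterlim (\<lambda>n. x n 0) at_infinity sequentially"
      unfolding filterlim_at_infinity[OF order_refl]
      using far by (auto intro: eventually_mono less_imp_le)
    \<comment> \<open>The polygons are recentred at their first vertices and \<open>H\<close> is
      translated along; by decay the translated functions tend to 0.\<close>
    obtain F ell lm A U V where F: "F \<noteq> bot" "F \<le> sequentially" and loop: "ode_loop (\<lambda>_. 0) ell lm A U V"
      and l: "((\<lambda>n. poly_length (N n) (\<lambda>k. x n k - x n 0)) \<longlongrightarrow> ell) F"
      and A: "((\<lambda>n. poly_area (N n) (\<lambda>k. x n k - x n 0)) \<longlongrightarrow> A) F"
      and Aa0: "\<bar>A - a0\<bar> \<le> a0 / 2"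
    proof (rule lim[of e N "\<lambda>n p. H (p + x n 0)" "\<lambda>n k. x n k - x n 0" 0 M "\<lambda>_. 0"])
      show "discrete_EL (e n) (\<lambda>p. H (p + x n 0)) (- 2 * K * (poly_area (N n) (\<lambda>k. x n k - x n 0) - a0)) (N n) (\<lambda>k. x n k - x n 0)" for n
      proof -
        have "periodic (N n) (x n)"
          using EL[of n] by (simp add: discrete_EL_def)
        then show ?thesis
          using discrete_EL_translate[OF EL[of n]] by (simp add: poly_area_translate)
      qed
      show "\<bar>poly_area (N n) (\<lambda>k. x n k - x n 0) - a0\<bar> \<le> a0 / 2"
        "(1 - q) * poly_length (N n) (\<lambda>k. x n k - x n 0) + K * (poly_area (N n) (\<lambda>k. x n k - x n 0) - a0)\<^sup>2 \<le> 4 * pi * r" for n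
      proof -
        have "periodic (N n) (x n)"
          using EL[of n] by (simp add: discrete_EL_def)
        then show "\<bar>poly_area (N n) (\<lambda>k. x n k - x n 0) - a0\<bar> \<le> a0 / 2"
          "(1 - q) * poly_length (N n) (\<lambda>k. x n k - x n 0) + K * (poly_area (N n) (\<lambda>k. x n k - x n 0) - a0)\<^sup>2 \<le> 4 * pi * r"
          using ar[of n] en[of n] by (simp_all add: poly_area_translate poly_length_translate)
      qed
      show "\<exists>\<delta>>0. \<forall>n p q. dist p q < \<delta> \<longrightarrow> \<bar>H (p + x n 0) - H (q + x n 0)\<bar> \<le> \<epsilon>" if "\<epsilon> > 0" for \<epsilon>
        using equi[OF that] by (metis dist_add_cancel2)
      show "(\<lambda>n. H (p + x n 0)) \<longlonglongrightarrow> 0" for p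
        by (rule filterlim_compose[OF decay tendsto_add_filterlim_at_infinity[OF tendsto_const xinf]])
    qed (use e elim0 N M in auto)
    have pN: "periodic (N n) (x n)" for n
      using EL[of n] by (simp add: discrete_EL_def)
    have l: "((\<lambda>n. poly_length (N n) (x n)) \<longlongrightarrow> ell) F" and A: "((\<lambda>n. poly_area (N n) (x n)) \<longlongrightarrow> A) F"
      using l A by (simp_all add: poly_length_translate poly_area_translate[OF pN])
    have len: "poly_length (N n) (x n) \<le> 4 * pi * r / (1 - q)" for n
    proof -
      have "(1 - q) * poly_length (N n) (x n) \<le> 4 * pi * r"
        using en[of n] K by (smt (verit) mult_nonneg_nonneg zero_le_power2)
      then show ?thesis
        using H(2) by (simp add: field_simps)
    qed
    \<comment> \<open>The comparison with the test polygon survives in the limit: far out,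
      \<open>\<bar>H\<bar>\<close> is below any given \<open>\<eta>\<close> on the ball that
      contains the polygon.\<close>
    have "ell + K * (A - a0)\<^sup>2 \<le> 2 * pi * s + K * (pi * s\<^sup>2 - a0)\<^sup>2 - g0 * pi * s\<^sup>2 / 2 + (\<eta> + 0) * ell\<^sup>2 + 0"
      if \<eta>: "\<eta> > 0" for \<eta>
    proof (rule tendsto_le[OF F(1)])
      show "((\<lambda>n. poly_length (N n) (x n) + K * (poly_area (N n) (x n) - a0)\<^sup>2) \<longlongrightarrow> ell + K * (A - a0)\<^sup>2) F"
        by (intro tendsto_intros l A)
      have "(e \<longlongrightarrow> 0) F"
        using elim0 F(2) by (rule filterlim_mono[OF _ order_refl])
      then show "((\<lambda>n. 2 * pi * s + K * (pi * s\<^sup>2 - a0)\<^sup>2 - g0 * pi * s\<^sup>2 / 2 + (\<eta> + e n) * (poly_length (N n) (x n))\<^sup>2 + e n)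
          \<longlongrightarrow> 2 * pi * s + K * (pi * s\<^sup>2 - a0)\<^sup>2 - g0 * pi * s\<^sup>2 / 2 + (\<eta> + 0) * ell\<^sup>2 + 0) F"
        by (intro tendsto_intros l)
      obtain B where B: "\<And>p. norm p \<ge> B \<Longrightarrow> \<bar>H p\<bar> < \<eta>"
        using tendstoD[OF decay \<eta>] unfolding eventually_at_infinity by auto
      have "eventually (\<lambda>n. norm (x n 0) > B + 4 * pi * r / (1 - q)) F"
        using far F(2) by (auto simp: le_filter_def)
      then show "eventually (\<lambda>n. poly_length (N n) (x n) + K * (poly_area (N n) (x n) - a0)\<^sup>2
          \<le> 2 * pi * s + K * (pi * s\<^sup>2 - a0)\<^sup>2 - g0 * pi * s\<^sup>2 / 2 + (\<eta> + e n) * (poly_length (N n) (x n))\<^sup>2 + e n) F"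
      proof eventually_elim
        case (elim n)
        show ?case
        proof (rule test)
          fix p
          assume "p \<in> cball (x n 0) (poly_length (N n) (x n))"
          then have "norm (x n 0 - p) \<le> 4 * pi * r / (1 - q)"
            using len[of n] by (simp add: dist_norm)
          then have "norm p \<ge> B"
            using elim norm_triangle_sub[of "x n 0" p] by linarith
          then show "\<bar>H p\<bar> \<le> \<eta>"
            using B less_imp_le by blast
        qed
      qed
    qed
    note bnd0 = this
    have "ell + K * (A - a0)\<^sup>2 - (2 * pi * s + K * (pi * s\<^sup>2 - a0)\<^sup>2 - g0 * pi * s\<^sup>2 / 2) \<le> \<eta> * ell\<^sup>2"
      if "\<eta> > 0" for \<eta>
      using bnd0[OF that] by (simp add: algebra_simps)
    note bnd = this
    have Apos: "A > 0"
      using Aa0 a0 by linarith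
    then have "4 * pi * A \<le> ell\<^sup>2"
      using free_loop_isoperimetric[OF loop] by blast
    \<comment> \<open>\<open>t\<close> is the radius of the circle of area \<open>A\<close>. By the
      isoperimetric inequality \<open>ell\<close> is at least its length, so the limit loop has no
      less energy than the best circle.\<close>
    moreover define t where "t = sqrt (A / pi)"
    moreover have "t \<ge> 0" "pi * t\<^sup>2 = A"
      using Apos by (simp_all add: t_def)
    moreover have "ell \<ge> 0"
      using loop unfolding ode_loop_def by (metis norm_ge_zero)
    moreover have "(2 * pi * t)\<^sup>2 = 4 * pi * A"
      using \<open>pi * t\<^sup>2 = A\<close> by (simp add: power_mult_distrib) (simp add: power2_eq_square mult_ac)
    ultimately have "2 * pi * t \<le> ell"
      by (metis power2_le_imp_le)
    then have "2 * pi * s + K * (pi * s\<^sup>2 - a0)\<^sup>2 \<le> ell + K * (A - a0)\<^sup>2"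
      using s(2)[OF \<open>t \<ge> 0\<close>] \<open>pi * t\<^sup>2 = A\<close> by simp
    then have gap: "g0 * pi * s\<^sup>2 / 2 \<le> \<eta> * ell\<^sup>2" if "\<eta> > 0" for \<eta>
      using bnd[OF that] by linarith
    define d where "d = g0 * pi * s\<^sup>2 / 2"
    have d: "d > 0"
      using g0(1) s(1) by (simp add: d_def)
    \<comment> \<open>This choice of \<open>\<eta>\<close> makes the right side smaller than the
      gain \<open>d\<close>.\<close>
    have "d \<le> d / (2 * (ell\<^sup>2 + 1)) * ell\<^sup>2"
      using gap[of "d / (2 * (ell\<^sup>2 + 1))"] d unfolding d_def[symmetric] by (simp add: add_nonneg_pos)
    also have "\<dots> < d"
      using d by (simp add: field_simps add_pos_nonneg)
    finally show False
      by simp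
  qed
  then obtain R where "\<not> eventually (\<lambda>n. norm (x n 0) > R) sequentially"
    by blast
  then have "infinite {n. norm (x n 0) \<le> R}"
    unfolding not_eventually not_less frequently_sequentially infinite_nat_iff_unbounded_le by blast
  then obtain \<sigma> :: "nat \<Rightarrow> nat" where \<sigma>: "strict_mono \<sigma>" "\<And>n. norm (x (\<sigma> n) 0) \<le> R"
    using infinite_enumerate by force
  obtain F ell lm A U V where "ode_loop H ell lm A U V" "\<bar>A - a0\<bar> \<le> a0 / 2"
      "(1 - q) * ell \<le> 4 * pi * r" "\<bar>lm\<bar> \<le> 16 / r"
  proof (rule lim[of "\<lambda>n. e (\<sigma> n)" "\<lambda>n. N (\<sigma> n)" "\<lambda>_. H" "\<lambda>n. x (\<sigma> n)" R M H])
    show "(\<lambda>n. e (\<sigma> n)) \<longlonglongrightarrow> 0"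
      using LIMSEQ_subseq_LIMSEQ[OF elim0 \<sigma>(1)] by (simp add: o_def)
    show "\<exists>\<delta>>0. \<forall>(n::nat) p q. dist p q < \<delta> \<longrightarrow> \<bar>H p - H q\<bar> \<le> \<epsilon>" if "\<epsilon> > 0" for \<epsilon>
      using equi[OF that] by blast
  qed (use e N EL en ar \<sigma>(2) M in auto)
  then show "\<exists>ell lm A U V. ode_loop H ell lm A U V \<and>
      \<bar>A - pi * r\<^sup>2\<bar> \<le> pi * r\<^sup>2 / 2 \<and> (1 - q) * ell \<le> 4 * pi * r \<and> \<bar>lm\<bar> \<le> 16 / r"
    unfolding a0_def by blast
qed


section \<open>From solutions of the differential equation to loops with minimal period\<close>

locale closed_solution =
  fixes H :: "complex \<Rightarrow> real" and ell lm A M :: real and U V :: "real \<Rightarrow> complex"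
  assumes loop: "ode_loop H ell lm A U V" and A: "A \<noteq> 0"
    and bounded: "\<And>p. \<bar>H p\<bar> \<le> M" and continuous: "continuous_on UNIV H"
begin

definition acc :: "real \<Rightarrow> complex" where
  "acc t = (ell * (H (U t) + lm)) *\<^sub>R (\<i> * V t)"

lemma dU: "(U has_vector_derivative V t) (at t)"
  and dV: "(V has_vector_derivative acc t) (at t)"
  and norm_V: "norm (V t) = ell" and U_period: "U (t + 1) = U t"
  and area: "((\<lambda>t. 1/2 * wedge (U t) (V t)) has_integral A) {0..1}"
  using loop unfolding ode_loop_def acc_def by blast+

lemma ell_pos: "ell > 0"
proof -
  have "ell \<noteq> 0"
  proof
    assume "ell = 0"
    then have "V t = 0" for t
      using norm_V[of t] by simp
    then have "((\<lambda>t. 0) has_integral A) {0..1::real}"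
      using area by (simp add: wedge.zero_right)
    then show False
      using A has_integral_unique[OF has_integral_0] by blast
  qed
  then show ?thesis
    using norm_V[of 0] norm_ge_zero[of "V 0"] by linarith
qed

lemma continuous_U: "continuous_on S U" and continuous_V: "continuous_on S V"
  using dU dV by (auto intro!: continuous_at_imp_continuous_on has_vector_derivative_continuous)

lemma continuous_acc: "continuous_on S acc"
  unfolding acc_def
  by (intro continuous_intros continuous_V continuous_on_compose2[OF continuous continuous_U]) auto

lemma norm_acc_le: "norm (acc t) \<le> ell * (ell * (M + \<bar>lm\<bar>))"
proof -
  have "norm (acc t) = ell * (ell * \<bar>H (U t) + lm\<bar>)"
    using ell_pos by (simp add: acc_def norm_mult norm_V abs_mult)
  moreover have "\<bar>H (U t) + lm\<bar> \<le> M + \<bar>lm\<bar>"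
    using bounded[of "U t"] by linarith
  ultimately show ?thesis
    using ell_pos by simp
qed

definition is_period :: "real \<Rightarrow> bool" where
  "is_period T \<longleftrightarrow> (\<forall>t. U (t + T) = U t)"

lemma period_V:
  assumes "is_period T"
  shows "V (t + T) = V t"
proof -
  have "((\<lambda>s. s + T) has_vector_derivative 1) (at t)"
    by (auto intro!: derivative_eq_intros)
  then have "((\<lambda>s. U (s + T)) has_vector_derivative V (t + T)) (at t)"
    using vector_diff_chain_at[of "\<lambda>s. s + T" 1 t U "V (t + T)"] dU unfolding o_def by simp
  moreover have "(\<lambda>s. U (s + T)) = U"
    using assms by (simp add: is_period_def)
  ultimately show ?thesis
    using dU vector_derivative_unique_at by metis
qed

text \<open>The component of the velocity along its initial value must vanish within one period, which takes time.\<close>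

lemma period_lower_bound:
  assumes T: "is_period T" "T > 0"
  shows "1 \<le> T * (ell * (M + \<bar>lm\<bar>))"
proof -
  have dUV: "((\<lambda>s. U s \<bullet> V 0) has_real_derivative V s \<bullet> V 0) (at s)" for s
    unfolding has_real_derivative_iff_has_vector_derivative
    by (rule bounded_linear.has_vector_derivative[OF bounded_linear_inner_left dU])
  have dVV: "((\<lambda>s. V s \<bullet> V 0) has_real_derivative acc s \<bullet> V 0) (at s)" for s
    unfolding has_real_derivative_iff_has_vector_derivative
    by (rule bounded_linear.has_vector_derivative[OF bounded_linear_inner_left dV])
  obtain \<xi> where \<xi>: "0 < \<xi>" "\<xi> < T" "U T \<bullet> V 0 - U 0 \<bullet> V 0 = (T - 0) * (V \<xi> \<bullet> V 0)"
    using MVT2[OF T(2) dUV] by blast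
  have "U T = U 0"
    using T(1) unfolding is_period_def by (metis add_0)
  then have V\<xi>: "V \<xi> \<bullet> V 0 = 0"
    using \<xi>(3) T(2) by simp
  obtain \<eta> where \<eta>: "V \<xi> \<bullet> V 0 - V 0 \<bullet> V 0 = (\<xi> - 0) * (acc \<eta> \<bullet> V 0)"
    using MVT2[OF \<xi>(1) dVV] by blast
  have "ell * ell = \<xi> * - (acc \<eta> \<bullet> V 0)"
    using \<eta> V\<xi> norm_V[of 0] by (simp add: power2_norm_eq_inner[symmetric] power2_eq_square)
  also have "- (acc \<eta> \<bullet> V 0) \<le> norm (acc \<eta>) * norm (V 0)"
    using Cauchy_Schwarz_ineq2[of "acc \<eta>" "V 0"] by linarith
  then have "\<xi> * - (acc \<eta> \<bullet> V 0) \<le> \<xi> * (norm (acc \<eta>) * ell)"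
    using \<xi>(1) unfolding norm_V by (intro mult_left_mono) auto
  also have "\<dots> \<le> T * (ell * (ell * (M + \<bar>lm\<bar>)) * ell)"
    using \<xi> norm_acc_le[of \<eta>] ell_pos order_trans[OF norm_ge_zero norm_acc_le[of \<eta>]]
    by (intro mult_mono) auto
  finally have "(ell * ell) * 1 \<le> (ell * ell) * (T * (ell * (M + \<bar>lm\<bar>)))"
    by (simp add: mult_ac)
  then show ?thesis
    using ell_pos by simp
qed

lemma is_period_1: "is_period 1"
  by (simp add: is_period_def U_period)

text \<open>Since \<open>M\<close> is fixed, this forces \<open>\<bar>lm\<bar>\<close> to be large
  when the loop is short, which yields the divergence of the multipliers as \<open>r\<close> tends
  to 0.\<close>

lemma curvature_bound: "1 \<le> ell * (M + \<bar>lm\<bar>)"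
  using period_lower_bound[OF is_period_1] by simp

lemma is_period_multiple:
  assumes "is_period T"
  shows "is_period (of_nat n * T)"
  using assms unfolding is_period_def
proof (induction n)
  case (Suc n)
  have "U (t + of_nat (Suc n) * T) = U ((t + of_nat n * T) + T)" for t
    by (simp add: algebra_simps)
  then show ?case
    using Suc by simp
qed simp

text \<open>Positive periods are bounded away from 0 and periods form a closed set, so the infimum
  is attained. It divides 1, since a remainder would be a smaller period.\<close>

lemma minimal_period_exists:
  obtains m T where "m > 0" "T > 0" "real m * T = 1" "minimal_period U T"
proof -
  define P where "P = {T. T > 0 \<and> is_period T}"
  define d where "d = 1 / (ell * (M + \<bar>lm\<bar>))"
  have d: "d > 0"
    using curvature_bound by (simp add: d_def)
  have lower: "d \<le> T" if "T \<in> P" for T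
    using period_lower_bound[of T] that curvature_bound by (simp add: P_def d_def field_simps)
  have ne: "P \<noteq> {}"
    using is_period_1 zero_less_one unfolding P_def by blast
  have bb: "bdd_below P"
    using lower by (rule bdd_belowI)
  define T where "T = Inf P"
  have "T \<in> closure P"
    unfolding T_def by (rule closure_contains_Inf[OF ne bb])
  moreover have "closed {T. is_period T}"
    unfolding is_period_def
    by (intro closed_Collect_all closed_Collect_eq continuous_on_compose2[OF continuous_U[of UNIV]] continuous_intros) auto
  then have "closure P \<subseteq> {T. is_period T}"
    by (rule closure_minimal[rotated]) (auto simp: P_def)
  ultimately have T: "is_period T"
    by blast
  have Tpos: "T > 0"
    using cInf_greatest[OF ne lower] d by (simp add: T_def)
  have T_le: "T \<le> S" if "is_period S" "S > 0" for S
    unfolding T_def using that bb by (intro cInf_lower) (auto simp: P_def)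
  have min: "minimal_period U T"
    unfolding minimal_period_def using Tpos T T_le by (force simp: is_period_def)
  define m where "m = nat \<lfloor>1 / T\<rfloor>"
  have m: "real m * T \<le> 1" "1 < (real m + 1) * T"
  proof -
    have "real m \<le> 1 / T" "1 / T < real m + 1"
      using Tpos unfolding m_def by (simp_all add: of_nat_nat)
    then show "real m * T \<le> 1" "1 < (real m + 1) * T"
      using Tpos by (simp_all add: field_simps)
  qed
  have "real m * T = 1"
  proof (rule ccontr)
    assume "real m * T \<noteq> 1"
    define S where "S = 1 - real m * T"
    have "is_period S"
      unfolding is_period_def
    proof
      fix t
      have "U (t + S) = U ((t + S) + real m * T)"
        using is_period_multiple[OF T, of m] by (simp add: is_period_def)
      also have "\<dots> = U t"
        by (simp add: S_def U_period)
      finally show "U (t + S) = U t" .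
    qed
    moreover have "S > 0" "S < T"
      using m \<open>real m * T \<noteq> 1\<close> by (simp_all add: S_def algebra_simps)
    ultimately show False
      using T_le by force
  qed
  moreover from this have "m > 0"
    using gr_zeroI by fastforce
  ultimately show ?thesis
    using that Tpos min by blast
qed

lemma area_of_periods:
  assumes T: "is_period T" "T > 0" and I: "((\<lambda>t. 1/2 * wedge (U t) (V t)) has_integral B) {0..T}"
  shows "((\<lambda>t. 1/2 * wedge (U t) (V t)) has_integral real n * B) {0..real n * T}"
proof (induction n)
  case (Suc n)
  let ?W = "\<lambda>t. 1/2 * wedge (U t) (V t)"
  have "?W (t + real n * T) = ?W t" for t
    using is_period_multiple[OF T(1), of n] period_V[of "real n * T" t] by (simp add: is_period_def)
  then have "((\<lambda>t. ?W (t + real n * T)) has_integral B) {0..T}"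
    using I by simp
  then have "(?W has_integral B) {real n * T..real (Suc n) * T}"
    using has_integral_shift_Icc_real[of ?W "real n * T" B 0 T] by (simp add: o_def algebra_simps)
  then have "(?W has_integral (real n * B + B)) {0..real (Suc n) * T}"
    using Suc T(2) by (intro has_integral_combine[of 0 "real n * T"]) (auto simp: algebra_simps)
  then show ?case
    by (simp add: algebra_simps)
qed (simp add: has_integral_refl)

text \<open>A crude isoperimetric inequality. The starting point may be subtracted because the
  velocity has integral zero over a period, and then \<open>norm (U t - U 0) \<le> ell * T\<close>
  while the speed is \<open>ell\<close>.\<close>

lemma area_of_period_le:
  assumes T: "is_period T" "T > 0" and I: "((\<lambda>t. 1/2 * wedge (U t) (V t)) has_integral B) {0..T}"
  shows "\<bar>B\<bar> \<le> ell\<^sup>2 * T\<^sup>2 / 2"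
proof -
  have VI: "(V has_integral (U t - U 0)) {0..t}" if "t \<ge> 0" for t
    by (rule fundamental_theorem_of_calculus[OF that]) (rule has_vector_derivative_at_within[OF dU])
  have V0: "(V has_integral 0) {0..T}"
    using VI[of T] T unfolding is_period_def by (metis add_0 diff_self less_imp_le)
  have "((\<lambda>t. wedge (U 0) (V t)) has_integral 0) {0..T}"
    using has_integral_linear[OF V0 wedge.bounded_linear_right[of "U 0"]] by (simp add: o_def wedge.zero_right)
  from has_integral_diff[OF I has_integral_mult_right[OF this, of "1/2"]]
  have I': "((\<lambda>t. 1/2 * wedge (U t - U 0) (V t)) has_integral B) {0..T}"
    by (simp add: wedge.diff_left right_diff_distrib)
  have "norm B \<le> (ell\<^sup>2 * T / 2) * measure lborel (cbox 0 T)"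
  proof (rule has_integral_bound)
    show "((\<lambda>t. 1/2 * wedge (U t - U 0) (V t)) has_integral B) (cbox 0 T)"
      using I' by simp
    show "0 \<le> ell\<^sup>2 * T / 2"
      using T by simp
    fix t :: real
    assume "t \<in> cbox 0 T"
    then have t: "0 \<le> t" "t \<le> T"
      by auto
    have "norm (U t - U 0) \<le> ell * measure lborel (cbox 0 t)"
      by (rule has_integral_bound[of ell V]) (use VI[OF t(1)] ell_pos norm_V in auto)
    then have "norm (U t - U 0) \<le> ell * T"
      using t ell_pos mult_left_mono[of t T ell] by (auto intro: order_trans)
    then have "\<bar>wedge (U t - U 0) (V t)\<bar> \<le> (ell * T) * ell"
      using ell_pos by (intro order_trans[OF abs_wedge_le mult_mono]) (auto simp: norm_V intro: order_trans[OF norm_ge_zero])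
    then show "norm (1/2 * wedge (U t - U 0) (V t)) \<le> ell\<^sup>2 * T / 2"
      by (simp add: power2_eq_square mult_ac)
  qed
  then show ?thesis
    using T by (simp add: power2_eq_square mult_ac)
qed

lemma is_G_loop:
  assumes "is_period T" and "T > 0"
  shows "G_loop_with_period (\<lambda>p. lm + H p) U T"
  unfolding G_loop_with_period_def
proof (intro exI conjI allI)
  fix t
  show "(U has_vector_derivative V t) (at t)" "(V has_vector_derivative acc t) (at t)"
    by (fact dU, fact dV)
  show "V t \<noteq> 0"
    using norm_V[of t] ell_pos by auto
  show "U (t + T) = U t"
    using assms(1) by (simp add: is_period_def)
  have "(\<i> * V t) \<bullet> acc t = (ell * (H (U t) + lm)) * (norm (V t))\<^sup>2"
    unfolding acc_def inner_scaleR_right power2_norm_eq_inner[symmetric] by (simp add: norm_mult)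
  then show "(\<i> * V t) \<bullet> acc t / (norm (V t)) ^ 3 = lm + H (U t)"
    using ell_pos by (simp add: norm_V power2_eq_square power3_eq_cube)
qed (use assms continuous_acc in auto)

text \<open>\<open>loop_area\<close> integrates the inner product of \<open>U\<close> with
  \<open>\<i> * U'\<close>, which is minus \<open>wedge U U'\<close>: counterclockwise circles have
  negative area in this convention.\<close>

lemma loop_area_eq:
  assumes "((\<lambda>t. 1/2 * wedge (U t) (V t)) has_integral B) {0..T}"
  shows "loop_area U T = - B"
proof -
  have *: "U t \<bullet> (\<i> * vector_derivative U (at t)) = (- 2) * (1/2 * wedge (U t) (V t))" for t
    using vector_derivative_at[OF dU[of t]] by (simp add: wedge_eq_inner inner_complex_def)
  show ?thesis
    unfolding loop_area_def * using integral_unique[OF has_integral_mult_right[OF assms, of "- 2"]] by simp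
qed

text \<open>If the solution runs \<open>m\<close> times through a minimal loop whose wedge integral
  is \<open>B\<close>, then \<open>A = m * B\<close>, and the crude isoperimetric inequality with
  \<open>T = 1 / m\<close> bounds \<open>m^2 * \<bar>B\<bar>\<close>. Multiplication by
  \<open>\<bar>B\<bar>\<close> makes the left side \<open>A^2\<close>, a lower bound for
  \<open>\<bar>B\<bar>\<close> that is free of \<open>m\<close>.\<close>

theorem has_loop_of_area_exists:
  obtains \<tau> where "has_loop_of_area (\<lambda>p. lm + H p) \<tau>" "\<tau> \<noteq> 0" "\<bar>\<tau>\<bar> \<le> \<bar>A\<bar>" "2 * A\<^sup>2 \<le> \<bar>\<tau>\<bar> * ell\<^sup>2"
proof -
  obtain m T where m: "m > 0" and T: "T > 0" and mT: "real m * T = 1" and min: "minimal_period U T"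
    by (rule minimal_period_exists)
  have per: "is_period T"
    using min by (simp add: minimal_period_def is_period_def)
  have "(\<lambda>t. 1/2 * wedge (U t) (V t)) integrable_on {0..T}"
    by (intro integrable_continuous_interval continuous_intros wedge.continuous_on continuous_U continuous_V)
  then obtain B where B: "((\<lambda>t. 1/2 * wedge (U t) (V t)) has_integral B) {0..T}"
    by blast
  have AB: "A = real m * B"
    using has_integral_unique[OF area] area_of_periods[OF per T B, of m] unfolding mT by blast
  have "B \<noteq> 0"
    using A AB by auto
  have mA: "\<bar>A\<bar> = real m * \<bar>B\<bar>"
    by (simp add: AB abs_mult)
  have "\<bar>B\<bar> \<le> ell\<^sup>2 * T\<^sup>2 / 2"
    by (rule area_of_period_le[OF per T B])
  then have "(real m)\<^sup>2 * \<bar>B\<bar> \<le> (real m)\<^sup>2 * (ell\<^sup>2 * T\<^sup>2 / 2)"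
    by (rule mult_left_mono) simp
  also have "\<dots> = (real m * T)\<^sup>2 * ell\<^sup>2 / 2"
    by (simp add: power_mult_distrib mult_ac)
  finally have "(real m)\<^sup>2 * \<bar>B\<bar> \<le> ell\<^sup>2 / 2"
    by (simp add: mT)
  then have "\<bar>B\<bar> * ((real m)\<^sup>2 * \<bar>B\<bar>) \<le> \<bar>B\<bar> * (ell\<^sup>2 / 2)"
    by (rule mult_left_mono) simp
  moreover have "A\<^sup>2 = \<bar>B\<bar> * ((real m)\<^sup>2 * \<bar>B\<bar>)"
    using mA power2_abs[of A] by (simp add: power2_eq_square mult_ac)
  ultimately have "2 * A\<^sup>2 \<le> \<bar>B\<bar> * ell\<^sup>2"
    by simp
  moreover have "\<bar>B\<bar> \<le> \<bar>A\<bar>"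
  proof -
    have "1 * \<bar>B\<bar> \<le> real m * \<bar>B\<bar>"
      using m by (intro mult_right_mono) auto
    then show ?thesis
      by (simp add: mA)
  qed
  moreover have "has_loop_of_area (\<lambda>p. lm + H p) (- B)"
    unfolding has_loop_of_area_def using is_G_loop[OF per T] min loop_area_eq[OF B] by blast
  ultimately show ?thesis
    using that[of "- B"] \<open>B \<noteq> 0\<close> by simp
qed

end

text \<open>Inserting \<open>A \<ge> pi * r^2 / 2\<close> and
  \<open>(1 - q) * ell \<le> 4 * pi * r\<close> into
  \<open>2 * A^2 \<le> \<bar>\<tau>\<bar> * ell^2\<close> gives the constant
  \<open>(1 - q)^2 / 32\<close>; the bound on \<open>ell\<close> inserted into
  \<open>curvature_bound\<close> gives the lower bound on \<open>\<bar>lm\<bar>\<close>.\<close>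

lemma has_loops_quantitative:
  assumes H: "has_loops H q" and q: "q < 1" and M: "\<And>p. \<bar>H p\<bar> \<le> M" and cont: "continuous_on UNIV H" and r: "r > 0"
  shows "\<exists>lm \<tau>. has_loop_of_area (\<lambda>p. lm + H p) \<tau> \<and> \<tau> \<noteq> 0 \<and> \<bar>\<tau>\<bar> \<le> 3 * pi / 2 * r\<^sup>2 \<and>
     (1 - q)\<^sup>2 / 32 * r\<^sup>2 \<le> \<bar>\<tau>\<bar> \<and> \<bar>lm\<bar> \<le> 16 / r \<and> (1 - q) / (4 * pi * r) - M \<le> \<bar>lm\<bar>"
proof -
  obtain ell lm A U V where loop: "ode_loop H ell lm A U V" and Ar: "\<bar>A - pi * r\<^sup>2\<bar> \<le> pi * r\<^sup>2 / 2"
    and ell: "(1 - q) * ell \<le> 4 * pi * r" and lm: "\<bar>lm\<bar> \<le> 16 / r"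
    using H r unfolding has_loops_def by blast
  have r2: "pi * r\<^sup>2 > 0"
    using r by simp
  then have A1: "pi * r\<^sup>2 / 2 \<le> A" and A2: "A \<le> 3 * pi / 2 * r\<^sup>2"
    using Ar unfolding abs_le_iff by linarith+
  have A0: "A > 0"
    using A1 r2 by linarith
  interpret closed_solution H ell lm A M U V
    using loop A0 M cont by unfold_locales auto
  obtain \<tau> where \<tau>: "has_loop_of_area (\<lambda>p. lm + H p) \<tau>" "\<tau> \<noteq> 0" "\<bar>\<tau>\<bar> \<le> \<bar>A\<bar>" "2 * A\<^sup>2 \<le> \<bar>\<tau>\<bar> * ell\<^sup>2"
    by (rule has_loop_of_area_exists)
  have "(1 - q)\<^sup>2 / 32 * r\<^sup>2 \<le> \<bar>\<tau>\<bar>"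
  proof -
    have "(pi * r\<^sup>2 / 2)\<^sup>2 \<le> A\<^sup>2"
      using A1 r2 by (intro power_mono) auto
    then have "2 * (pi * r\<^sup>2 / 2)\<^sup>2 * (1 - q)\<^sup>2 \<le> (\<bar>\<tau>\<bar> * ell\<^sup>2) * (1 - q)\<^sup>2"
      using \<tau>(4) by (intro mult_right_mono) auto
    also have "\<dots> = \<bar>\<tau>\<bar> * ((1 - q) * ell)\<^sup>2"
      by (simp add: power_mult_distrib mult_ac)
    also have "\<dots> \<le> \<bar>\<tau>\<bar> * (4 * pi * r)\<^sup>2"
      using ell ell_pos q by (intro mult_left_mono power_mono) auto
    finally have "(16 * (pi * r)\<^sup>2) * ((1 - q)\<^sup>2 / 32 * r\<^sup>2) \<le> (16 * (pi * r)\<^sup>2) * \<bar>\<tau>\<bar>"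
      by (simp add: power2_eq_square algebra_simps)
    then show ?thesis
      using r by (subst (asm) mult_le_cancel_left_pos) auto
  qed
  moreover have "(1 - q) / (4 * pi * r) - M \<le> \<bar>lm\<bar>"
  proof -
    have "(1 - q) * 1 \<le> (1 - q) * (ell * (M + \<bar>lm\<bar>))"
      using curvature_bound q by (intro mult_left_mono) auto
    also have "\<dots> = ((1 - q) * ell) * (M + \<bar>lm\<bar>)"
      by simp
    also have "\<dots> \<le> (4 * pi * r) * (M + \<bar>lm\<bar>)"
      using ell M[of 0] by (intro mult_right_mono) auto
    finally have "(1 - q) / (4 * pi * r) \<le> M + \<bar>lm\<bar>"
      using r by (simp add: divide_le_eq mult_ac)
    then show ?thesis
      by simp
  qed
  moreover have "\<bar>\<tau>\<bar> \<le> 3 * pi / 2 * r\<^sup>2"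
    using \<tau>(3) A0 A2 by linarith
  ultimately show ?thesis
    using \<tau>(1,2) lm by blast
qed

theorem loops_of_has_loops:
  assumes H: "has_loops H q" and q: "q < 1" and M: "\<And>p. \<bar>H p\<bar> \<le> M" and cont: "continuous_on UNIV H"
  shows "(\<exists>Hs \<tau> :: nat \<Rightarrow> real.
            filterlim (\<lambda>j. \<bar>Hs j\<bar>) at_top sequentially \<and> (\<forall>j. \<tau> j \<noteq> 0) \<and> \<tau> \<longlonglongrightarrow> 0
            \<and> (\<forall>j. has_loop_of_area (\<lambda>p. Hs j + H p) (\<tau> j)))
       \<and> (\<exists>Hs' \<tau>' :: nat \<Rightarrow> real.
            (\<lambda>k. \<bar>Hs' k\<bar>) \<longlonglongrightarrow> 0 \<and> (\<forall>k. \<tau>' k \<noteq> 0)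
            \<and> filterlim (\<lambda>k. \<bar>\<tau>' k\<bar>) at_top sequentially
            \<and> (\<forall>k. has_loop_of_area (\<lambda>p. Hs' k + H p) (\<tau>' k)))"
proof -
  have "\<forall>r. \<exists>lm \<tau>. r > 0 \<longrightarrow> has_loop_of_area (\<lambda>p. lm + H p) \<tau> \<and> \<tau> \<noteq> 0 \<and> \<bar>\<tau>\<bar> \<le> 3 * pi / 2 * r\<^sup>2 \<and>
     (1 - q)\<^sup>2 / 32 * r\<^sup>2 \<le> \<bar>\<tau>\<bar> \<and> \<bar>lm\<bar> \<le> 16 / r \<and> (1 - q) / (4 * pi * r) - M \<le> \<bar>lm\<bar>"
    using has_loops_quantitative[OF H q M cont] by blast
  from choice[OF this] obtain L where "\<forall>r. \<exists>\<tau>. r > 0 \<longrightarrow> has_loop_of_area (\<lambda>p. L r + H p) \<tau> \<and> \<tau> \<noteq> 0 \<and> \<bar>\<tau>\<bar> \<le> 3 * pi / 2 * r\<^sup>2 \<and>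
     (1 - q)\<^sup>2 / 32 * r\<^sup>2 \<le> \<bar>\<tau>\<bar> \<and> \<bar>L r\<bar> \<le> 16 / r \<and> (1 - q) / (4 * pi * r) - M \<le> \<bar>L r\<bar>"
    by blast
  from choice[OF this] obtain \<tau> where LT: "\<forall>r. r > 0 \<longrightarrow> has_loop_of_area (\<lambda>p. L r + H p) (\<tau> r) \<and> \<tau> r \<noteq> 0 \<and> \<bar>\<tau> r\<bar> \<le> 3 * pi / 2 * r\<^sup>2 \<and>
     (1 - q)\<^sup>2 / 32 * r\<^sup>2 \<le> \<bar>\<tau> r\<bar> \<and> \<bar>L r\<bar> \<le> 16 / r \<and> (1 - q) / (4 * pi * r) - M \<le> \<bar>L r\<bar>"
    by blast
  \<comment> \<open>\<open>1 / n1 j\<close> are the radii for the first pair of sequences,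
    \<open>n1 k\<close> those for the second.\<close>
  define n1 where "n1 j = real j + 1" for j
  have n1: "n1 j > 0" "n1 j \<ge> 1" for j
    by (simp_all add: n1_def)
  have n1_top: "filterlim n1 at_top sequentially"
    unfolding n1_def by (rule filterlim_at_top_mono[OF filterlim_real_sequentially]) simp
  have inv0: "(\<lambda>j. 1 / n1 j) \<longlonglongrightarrow> 0"
    unfolding n1_def by (rule inverse_Suc_tendsto)
  have small: "filterlim (\<lambda>j. \<bar>L (1 / n1 j)\<bar>) at_top sequentially" "(\<lambda>j. \<tau> (1 / n1 j)) \<longlonglongrightarrow> 0"
  proof -
    have "filterlim (\<lambda>j. - M + (1 - q) / (4 * pi) * n1 j) at_top sequentially"
      using q by (intro filterlim_tendsto_add_at_top[OF tendsto_const]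
          filterlim_tendsto_pos_mult_at_top[OF tendsto_const _ n1_top]) auto
    then show "filterlim (\<lambda>j. \<bar>L (1 / n1 j)\<bar>) at_top sequentially"
    proof (rule filterlim_at_top_mono, intro always_eventually allI)
      fix j
      show "- M + (1 - q) / (4 * pi) * n1 j \<le> \<bar>L (1 / n1 j)\<bar>"
        using LT[rule_format, of "1 / n1 j"] n1(1)[of j] by simp
    qed
    have "(\<lambda>j. 3 * pi / 2 * (1 / n1 j)\<^sup>2) \<longlonglongrightarrow> 3 * pi / 2 * 0\<^sup>2"
      by (intro tendsto_intros inv0)
    then have "(\<lambda>j. 3 * pi / 2 * (1 / n1 j)\<^sup>2) \<longlonglongrightarrow> 0"
      by simp
    then show "(\<lambda>j. \<tau> (1 / n1 j)) \<longlonglongrightarrow> 0"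
      by (rule Lim_null_comparison[rotated]) (use LT n1 in auto)
  qed
  have large: "(\<lambda>k. \<bar>L (n1 k)\<bar>) \<longlonglongrightarrow> 0" "filterlim (\<lambda>k. \<bar>\<tau> (n1 k)\<bar>) at_top sequentially"
  proof -
    have "(\<lambda>k. 16 * (1 / n1 k)) \<longlonglongrightarrow> 16 * 0"
      by (intro tendsto_intros inv0)
    then have "(\<lambda>k. 16 * (1 / n1 k)) \<longlonglongrightarrow> 0"
      by simp
    then show "(\<lambda>k. \<bar>L (n1 k)\<bar>) \<longlonglongrightarrow> 0"
      by (rule Lim_null_comparison[rotated]) (use LT n1 in auto)
    have "filterlim (\<lambda>k. (1 - q)\<^sup>2 / 32 * n1 k) at_top sequentially"
      using q by (intro filterlim_tendsto_pos_mult_at_top[OF tendsto_const _ n1_top]) auto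
    then show "filterlim (\<lambda>k. \<bar>\<tau> (n1 k)\<bar>) at_top sequentially"
    proof (rule filterlim_at_top_mono, intro always_eventually allI)
      fix k
      have "(1 - q)\<^sup>2 / 32 * n1 k \<le> (1 - q)\<^sup>2 / 32 * (n1 k)\<^sup>2"
        using n1(2)[of k] by (intro mult_left_mono) (auto simp: power2_eq_square)
      also have "\<dots> \<le> \<bar>\<tau> (n1 k)\<bar>"
        using LT n1(1)[of k] by blast
      finally show "(1 - q)\<^sup>2 / 32 * n1 k \<le> \<bar>\<tau> (n1 k)\<bar>" .
    qed
  qed
  show ?thesis
  proof (intro conjI)
    show "\<exists>Hs \<tau> :: nat \<Rightarrow> real.
            filterlim (\<lambda>j. \<bar>Hs j\<bar>) at_top sequentially \<and> (\<forall>j. \<tau> j \<noteq> 0) \<and> \<tau> \<longlonglongrightarrow> 0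
            \<and> (\<forall>j. has_loop_of_area (\<lambda>p. Hs j + H p) (\<tau> j))"
      by (rule exI[of _ "\<lambda>j. L (1 / n1 j)"], rule exI[of _ "\<lambda>j. \<tau> (1 / n1 j)"]) (use small LT n1(1) in auto)
    show "\<exists>Hs' \<tau>' :: nat \<Rightarrow> real.
            (\<lambda>k. \<bar>Hs' k\<bar>) \<longlonglongrightarrow> 0 \<and> (\<forall>k. \<tau>' k \<noteq> 0)
            \<and> filterlim (\<lambda>k. \<bar>\<tau>' k\<bar>) at_top sequentially
            \<and> (\<forall>k. has_loop_of_area (\<lambda>p. Hs' k + H p) (\<tau>' k))"
      by (rule exI[of _ "\<lambda>k. L (n1 k)"], rule exI[of _ "\<lambda>k. \<tau> (n1 k)"]) (use large LT n1(1) in auto)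
  qed
qed

section \<open>Approximate vector potentials in the periodic case\<close>

lemma uniformly_continuous_UNIV_dist:
  assumes "uniformly_continuous_on UNIV f" "e > 0"
  shows "\<exists>d>0. \<forall>x x'. dist x' x < d \<longrightarrow> dist (f x') (f x) < e"
  using assms unfolding uniformly_continuous_on_def by (metis UNIV_I)

text \<open>\<open>p + h\<close> is reached by one step along the real and one along the imaginary
  axis. Uniform continuity of the partial derivatives makes \<open>\<delta>\<close> independent of
  \<open>p\<close>, as \<open>unif_div\<close> demands.\<close>

lemma uniform_remainder_of_partials:
  assumes dx: "\<And>p. ((\<lambda>t. Q (p + of_real t)) has_vector_derivative a p) (at 0)"
    and dy: "\<And>p. ((\<lambda>t. Q (p + of_real t * \<i>)) has_vector_derivative b p) (at 0)"
    and a: "uniformly_continuous_on UNIV a" and b: "uniformly_continuous_on UNIV b"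
    and \<epsilon>: "\<epsilon> > 0"
  shows "\<exists>\<delta>>0. \<forall>p h. norm h \<le> \<delta> \<longrightarrow> norm (Q (p + h) - Q p - (Re h *\<^sub>R a p + Im h *\<^sub>R b p)) \<le> \<epsilon> * norm h"
proof -
  have along: "norm (Q (p + of_real t * v) - Q p - t *\<^sub>R c p) \<le> \<bar>t\<bar> * e"
    if d: "\<And>p. ((\<lambda>t. Q (p + of_real t * v)) has_vector_derivative c p) (at 0)"
      and v: "norm v = 1" and \<delta>: "\<And>p p'. dist p' p < \<delta> \<Longrightarrow> dist (c p') (c p) < e" and t: "\<bar>t\<bar> < \<delta>"
    for v c p \<delta> e t
  proof -
    have d': "((\<lambda>t. Q (p + of_real t * v)) has_vector_derivative c (p + of_real s * v)) (at s)" for s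
    proof -
      have "((\<lambda>t. t - s) has_vector_derivative 1) (at s)"
        by (auto intro!: derivative_eq_intros)
      moreover have "((\<lambda>t. Q ((p + of_real s * v) + of_real t * v)) has_vector_derivative c (p + of_real s * v)) (at (s - s))"
        using d[of "p + of_real s * v"] by simp
      ultimately have "((\<lambda>t. Q ((p + of_real s * v) + of_real (t - s) * v)) has_vector_derivative 1 *\<^sub>R c (p + of_real s * v)) (at s)"
        using vector_diff_chain_at[of "\<lambda>t. t - s" 1 s] unfolding o_def by blast
      then show ?thesis
        by (simp add: algebra_simps)
    qed
    have "norm (Q (p + of_real t * v) - Q (p + of_real 0 * v) - (t - 0) *\<^sub>R c (p + of_real 0 * v)) \<le> norm (t - 0) * e"
    proof (rule vector_differentiable_bound_linearization[where S = "closed_segment 0 t" and f' = "\<lambda>s. c (p + of_real s * v)"])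
      fix s assume s: "s \<in> closed_segment 0 t"
      show "((\<lambda>t. Q (p + of_real t * v)) has_vector_derivative c (p + of_real s * v)) (at s within closed_segment 0 t)"
        by (rule has_vector_derivative_at_within[OF d'])
      have "\<bar>s\<bar> \<le> \<bar>t\<bar>"
        using s by (auto simp: closed_segment_eq_real_ivl split: if_splits)
      then have "dist (p + of_real s * v) p < \<delta>"
        using t by (simp add: dist_norm norm_mult v)
      from \<delta>[OF this] show "norm (c (p + of_real s * v) - c (p + of_real 0 * v)) \<le> e"
        by (simp add: dist_norm)
    qed auto
    then show ?thesis
      by simp
  qed
  have e: "\<epsilon> / 3 > 0"
    using \<epsilon> by simp
  obtain \<delta>1 where \<delta>1: "\<delta>1 > 0" "\<And>p p'. dist p' p < \<delta>1 \<Longrightarrow> dist (a p') (a p) < \<epsilon> / 3"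
    using uniformly_continuous_UNIV_dist[OF a e] by blast
  obtain \<delta>2 where \<delta>2: "\<delta>2 > 0" "\<And>p p'. dist p' p < \<delta>2 \<Longrightarrow> dist (b p') (b p) < \<epsilon> / 3"
    using uniformly_continuous_UNIV_dist[OF b e] by blast
  show ?thesis
  proof (intro exI[of _ "min \<delta>1 \<delta>2 / 2"] conjI allI impI)
    show "0 < min \<delta>1 \<delta>2 / 2"
      using \<delta>1(1) \<delta>2(1) by simp
    fix p h :: complex
    assume "norm h \<le> min \<delta>1 \<delta>2 / 2"
    then have h: "norm h < \<delta>1" "norm h < \<delta>2"
      using \<delta>1(1) \<delta>2(1) by auto
    have Re: "\<bar>Re h\<bar> \<le> norm h" and Im: "\<bar>Im h\<bar> \<le> norm h"
      by (rule abs_Re_le_cmod, rule abs_Im_le_cmod)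
    let ?p = "p + of_real (Re h)"
    have 1: "norm (Q ?p - Q p - Re h *\<^sub>R a p) \<le> \<bar>Re h\<bar> * (\<epsilon> / 3)"
      using along[of 1 a \<delta>1 "\<epsilon> / 3" "Re h" p] dx \<delta>1(2) h(1) Re by simp
    have 2: "norm (Q (?p + of_real (Im h) * \<i>) - Q ?p - Im h *\<^sub>R b ?p) \<le> \<bar>Im h\<bar> * (\<epsilon> / 3)"
      using along[of \<i> b \<delta>2 "\<epsilon> / 3" "Im h" ?p] dy \<delta>2(2) h(2) Im by simp
    have "dist ?p p < \<delta>2"
      using h(2) Re by (simp add: dist_norm)
    from \<delta>2(2)[OF this] have 3: "norm (Im h *\<^sub>R (b ?p - b p)) \<le> \<bar>Im h\<bar> * (\<epsilon> / 3)"
      unfolding norm_scaleR by (intro mult_left_mono) (auto simp: dist_norm)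
    have ph: "?p + of_real (Im h) * \<i> = p + h"
      by (simp add: complex_eq_iff)
    have "norm (Q (p + h) - Q p - (Re h *\<^sub>R a p + Im h *\<^sub>R b p)) =
        norm ((Q (?p + of_real (Im h) * \<i>) - Q ?p - Im h *\<^sub>R b ?p) + (Q ?p - Q p - Re h *\<^sub>R a p) + Im h *\<^sub>R (b ?p - b p))"
      unfolding ph by (simp add: algebra_simps)
    also have "\<dots> \<le> \<bar>Im h\<bar> * (\<epsilon> / 3) + \<bar>Re h\<bar> * (\<epsilon> / 3) + \<bar>Im h\<bar> * (\<epsilon> / 3)"
      by (intro order_trans[OF norm_triangle_ineq add_mono] 1 2 3)
    also have "\<dots> \<le> norm h * (\<epsilon> / 3) + norm h * (\<epsilon> / 3) + norm h * (\<epsilon> / 3)"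
      using Re Im e by (intro add_mono mult_right_mono) auto
    finally show "norm (Q (p + h) - Q p - (Re h *\<^sub>R a p + Im h *\<^sub>R b p)) \<le> \<epsilon> * norm h"
      by (simp add: mult.commute)
  qed
qed

lemma unif_div_of_partials:
  assumes "\<And>p. ((\<lambda>t. Q (p + of_real t)) has_vector_derivative a p) (at 0)"
    and "\<And>p. ((\<lambda>t. Q (p + of_real t * \<i>)) has_vector_derivative b p) (at 0)"
    and "uniformly_continuous_on UNIV a" and "uniformly_continuous_on UNIV b"
    and "\<And>p. G p = Re (a p) + Im (b p)"
  shows "unif_div Q G"
  unfolding unif_div_def using uniform_remainder_of_partials[OF assms(1-4)] assms(5) by blast

lemma has_vector_derivative_Complex:
  assumes "(f has_real_derivative f') (at t)" "(g has_real_derivative g') (at t)"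
  shows "((\<lambda>t. Complex (f t) (g t)) has_vector_derivative Complex f' g') (at t)"
  unfolding Complex_eq
  by (intro has_vector_derivative_add has_vector_derivative_mult_right has_vector_derivative_of_real assms)

section \<open>Averages and sawtooth integrals along segments\<close>

definition moving_integral :: "(real \<Rightarrow> real) \<Rightarrow> complex \<Rightarrow> (complex \<Rightarrow> real) \<Rightarrow> complex \<Rightarrow> real" where
  "moving_integral w v f p = integral {0..1} (\<lambda>s. w s * f (p + of_real s * v))"

lemma moving_integrable:
  fixes f :: "complex \<Rightarrow> real"
  assumes "continuous_on UNIV w" "continuous_on UNIV f"
  shows "(\<lambda>s. w s * f (p + of_real s * v)) integrable_on {0..1}"
  by (intro integrable_continuous_interval continuous_intros continuous_on_compose2[OF assms(2)] continuous_on_subset[OF assms(1)]) auto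

lemma moving_integral_uniformly_continuous:
  assumes w: "continuous_on UNIV w" "\<And>s. s \<in> {0..1} \<Longrightarrow> \<bar>w s\<bar> \<le> 1" and f: "uniformly_continuous_on UNIV f"
  shows "uniformly_continuous_on UNIV (moving_integral w v f)"
  unfolding uniformly_continuous_on_def
proof (intro allI impI)
  fix e :: real
  assume e: "e > 0"
  then have "e / 2 > 0"
    by simp
  then obtain d where d: "d > 0" "\<And>x x'. dist x' x < d \<Longrightarrow> dist (f x') (f x) < e / 2"
    using uniformly_continuous_UNIV_dist[OF f] by blast
  note I = moving_integrable[OF w(1) uniformly_continuous_imp_continuous[OF f]]
  show "\<exists>d>0. \<forall>x\<in>UNIV. \<forall>x'\<in>UNIV. dist x' x < d \<longrightarrow> dist (moving_integral w v f x') (moving_integral w v f x) < e"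
  proof (intro exI[of _ d] conjI ballI impI)
    fix p p' :: complex
    assume "dist p' p < d"
    then have pp: "dist (f (p' + of_real s * v)) (f (p + of_real s * v)) < e / 2" for s
      by (intro d(2)) simp
    have "norm (integral {0..1} (\<lambda>s. w s * f (p' + of_real s * v) - w s * f (p + of_real s * v))) \<le> e / 2 * (1 - 0)"
    proof (rule integral_bound)
      show "continuous_on {0..1} (\<lambda>s. w s * f (p' + of_real s * v) - w s * f (p + of_real s * v))"
        by (intro continuous_intros continuous_on_compose2[OF uniformly_continuous_imp_continuous[OF f]] continuous_on_subset[OF w(1)]) auto
      fix s :: real assume "s \<in> {0..1}"
      then have "\<bar>w s\<bar> * \<bar>f (p' + of_real s * v) - f (p + of_real s * v)\<bar> \<le> 1 * (e / 2)"
        using w(2) pp[of s] by (intro mult_mono) (auto simp: dist_real_def)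
      then show "norm (w s * f (p' + of_real s * v) - w s * f (p + of_real s * v)) \<le> e / 2"
        by (simp add: abs_mult right_diff_distrib[symmetric])
    qed simp
    then show "dist (moving_integral w v f p') (moving_integral w v f p) < e"
      using e unfolding moving_integral_def dist_real_def by (simp add: integral_diff[OF I I])
  qed (fact d(1))
qed

lemma directional_derivative_shift:
  fixes f :: "complex \<Rightarrow> real"
  assumes "\<And>p. ((\<lambda>t. f (p + of_real t * v)) has_real_derivative g p) (at 0)"
  shows "((\<lambda>t. f (p + of_real t * v)) has_real_derivative g (p + of_real s * v)) (at s)"
proof -
  have "((\<lambda>t. f ((p + of_real s * v) + of_real t * v)) has_real_derivative g (p + of_real s * v)) (at (s - s))"
    using assms[of "p + of_real s * v"] by simp
  moreover have "((\<lambda>t. t - s) has_real_derivative 1) (at s)"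
    by (auto intro!: derivative_eq_intros)
  ultimately have "((\<lambda>t. f ((p + of_real s * v) + of_real (t - s) * v)) has_real_derivative g (p + of_real s * v) * 1) (at s)"
    by (rule DERIV_chain2[of "\<lambda>t. f ((p + of_real s * v) + of_real t * v)"])
  then show ?thesis
    by (simp add: algebra_simps)
qed

lemma moving_integral_derivative:
  assumes w: "continuous_on UNIV w" and f: "continuous_on UNIV f" and g: "continuous_on UNIV g"
    and d: "\<And>p. ((\<lambda>t. f (p + of_real t * e)) has_real_derivative g p) (at 0)"
  shows "((\<lambda>t. moving_integral w v f (p + of_real t * e)) has_real_derivative moving_integral w v g p) (at 0)"
proof -
  have "((\<lambda>t. integral (cbox 0 1) (\<lambda>s. w s * f ((p + of_real s * v) + of_real t * e))) has_vector_derivative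
      integral (cbox 0 1) (\<lambda>s. w s * g ((p + of_real s * v) + of_real 0 * e))) (at 0 within UNIV)"
  proof (rule leibniz_rule_vector_derivative)
    show "((\<lambda>t. w s * f (p + of_real s * v + of_real t * e)) has_vector_derivative w s * g (p + of_real s * v + of_real t * e)) (at t)" for t s
      unfolding has_real_derivative_iff_has_vector_derivative[symmetric]
      by (rule DERIV_cmult[OF directional_derivative_shift[OF d]])
    show "(\<lambda>s. w s * f (p + of_real s * v + of_real t * e)) integrable_on cbox 0 1" for t
      using moving_integrable[OF w f, of "p + of_real t * e" v] by (simp add: add_ac)
    show "continuous_on (UNIV \<times> cbox 0 1) (\<lambda>(t, s). w s * g (p + of_real s * v + of_real t * e))"
      unfolding split_beta
      by (intro continuous_intros continuous_on_compose2[OF g] continuous_on_compose2[OF w]) auto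
  qed auto
  then show ?thesis
    by (simp add: moving_integral_def has_real_derivative_iff_has_vector_derivative add_ac)
qed

text \<open>The interval is wide enough to contain \<open>t + s\<close> for \<open>t\<close> between
  -1 and 1 and \<open>s\<close> between 0 and 1, the arguments that occur in unit segments moved
  near their starting point.\<close>

lemma local_antiderivative:
  fixes \<phi> :: "real \<Rightarrow> real"
  assumes "continuous_on UNIV \<phi>"
  obtains F where "\<And>t. t \<in> {-3<..<3} \<Longrightarrow> (F has_real_derivative \<phi> t) (at t)"
proof
  fix t :: real
  assume t: "t \<in> {-3<..<3}"
  have "((\<lambda>x. integral {-3..x} \<phi>) has_real_derivative \<phi> t) (at t within {-3..3})"
    using t by (intro integral_has_real_derivative continuous_on_subset[OF assms]) auto
  then show "((\<lambda>x. integral {-3..x} \<phi>) has_real_derivative \<phi> t) (at t)"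
    using t at_within_Icc_at[of "-3" t 3] by simp
qed

lemma has_real_derivative_shift: "(F has_real_derivative c) (at (t + s)) \<Longrightarrow> ((\<lambda>t. F (t + s)) has_real_derivative c) (at t)"
  by (simp add: DERIV_shift)

text \<open>The sawtooth is the kernel that integrates periodic functions after removal of their
  mean. As \<open>f\<close> is merely continuous, integration by parts first expresses the integral
  through an antiderivative \<open>F\<close>, as \<open>(F (t + 1) + F t) / 2\<close> minus the
  integral of \<open>F\<close>; differentiation and periodicity then give \<open>f\<close> minus its
  mean.\<close>

lemma sawtooth_moving_derivative:
  assumes f: "continuous_on UNIV f" and per: "\<And>p. f (p + v) = f p"
  shows "((\<lambda>t. moving_integral (\<lambda>s. s - 1/2) v f (p + of_real t * v)) has_real_derivative f p - moving_integral (\<lambda>s. 1) v f p) (at 0)"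
proof -
  define \<phi> where "\<phi> t = f (p + of_real t * v)" for t
  have \<phi>: "continuous_on S \<phi>" for S
    unfolding \<phi>_def by (intro continuous_on_compose2[OF f] continuous_intros) auto
  obtain F where F: "\<And>t. t \<in> {-3<..<3} \<Longrightarrow> (F has_real_derivative \<phi> t) (at t)"
    using local_antiderivative[OF \<phi>] by blast
  have contF: "continuous_on {-3<..<3} F"
    using F DERIV_isCont by (intro continuous_at_imp_continuous_on) blast
  have parts: "moving_integral (\<lambda>s. s - 1/2) v f (p + of_real t * v) = (F (t + 1) + F t) / 2 - integral {0..1} (\<lambda>s. F (t + s))"
    if t: "t \<in> {-1<..<1}" for t
  proof -
    have "((\<lambda>s. F (t + s) + (s - 1/2) * \<phi> (t + s)) has_integral ((1 - 1/2) * F (t + 1) - (0 - 1/2) * F (t + 0))) {0..1}"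
    proof (rule fundamental_theorem_of_calculus)
      fix s :: real assume s: "s \<in> {0..1}"
      have "((\<lambda>s. F (t + s)) has_real_derivative \<phi> (t + s)) (at s)"
        using has_real_derivative_shift[of F "\<phi> (t + s)" s t] F[of "t + s"] s t by (simp add: add_ac)
      then have "((\<lambda>s. (s - 1/2) * F (t + s)) has_real_derivative F (t + s) + (s - 1/2) * \<phi> (t + s)) (at s)"
        by (auto intro!: derivative_eq_intros)
      then show "((\<lambda>s. (s - 1/2) * F (t + s)) has_vector_derivative F (t + s) + (s - 1/2) * \<phi> (t + s)) (at s within {0..1})"
        unfolding has_real_derivative_iff_has_vector_derivative by (rule has_vector_derivative_at_within)
    qed simp
    moreover have "((\<lambda>s. F (t + s)) has_integral integral {0..1} (\<lambda>s. F (t + s))) {0..1}"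
      using t by (intro integrable_integral integrable_continuous_interval continuous_on_compose2[OF contF] continuous_intros) auto
    ultimately have "((\<lambda>s. (F (t + s) + (s - 1/2) * \<phi> (t + s)) - F (t + s)) has_integral
        ((1 - 1/2) * F (t + 1) - (0 - 1/2) * F (t + 0)) - integral {0..1} (\<lambda>s. F (t + s))) {0..1}"
      by (rule has_integral_diff)
    then have "integral {0..1} (\<lambda>s. (s - 1/2) * \<phi> (t + s)) = (F (t + 1) + F t) / 2 - integral {0..1} (\<lambda>s. F (t + s))"
      by (simp add: integral_unique add_divide_distrib)
    then show ?thesis
      by (simp add: moving_integral_def \<phi>_def algebra_simps)
  qed
  have leibniz: "((\<lambda>t. integral (cbox 0 1) (\<lambda>s. F (t + s))) has_vector_derivative integral (cbox 0 1) (\<lambda>s. \<phi> (0 + s))) (at 0 within {-1<..<1})"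
  proof (rule leibniz_rule_vector_derivative)
    fix t s :: real assume "t \<in> {-1<..<1}" "s \<in> cbox 0 1"
    then show "((\<lambda>t. F (t + s)) has_vector_derivative \<phi> (t + s)) (at t within {-1<..<1})"
      unfolding has_real_derivative_iff_has_vector_derivative[symmetric]
      by (intro has_field_derivative_at_within[OF has_real_derivative_shift] F) auto
  next
    fix t :: real assume "t \<in> {-1<..<1}"
    then show "(\<lambda>s. F (t + s)) integrable_on cbox 0 1"
      unfolding cbox_interval
      by (intro integrable_continuous_interval continuous_on_compose2[OF contF] continuous_intros) auto
  next
    show "continuous_on ({-1<..<1} \<times> cbox 0 1) (\<lambda>(t, s). \<phi> (t + s))"
      unfolding split_beta by (intro continuous_on_compose2[OF \<phi>[of UNIV]] continuous_intros) auto
  qed auto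
  have "((\<lambda>t. (F (t + 1) + F t) / 2 - integral {0..1} (\<lambda>s. F (t + s))) has_real_derivative (\<phi> 1 + \<phi> 0) / 2 - integral {0..1} \<phi>) (at 0)"
  proof -
    have "((\<lambda>t. F (t + 1)) has_real_derivative \<phi> 1) (at 0)"
      by (rule has_real_derivative_shift) (use F[of 1] in simp)
    moreover have "((\<lambda>t. integral {0..1} (\<lambda>s. F (t + s))) has_real_derivative integral {0..1} \<phi>) (at 0)"
      using leibniz at_within_open[of "0::real" "{-1<..<1}"] by (simp add: has_real_derivative_iff_has_vector_derivative)
    ultimately show ?thesis
      using F[of 0] by (auto intro!: derivative_eq_intros)
  qed
  then have "((\<lambda>t. moving_integral (\<lambda>s. s - 1/2) v f (p + of_real t * v)) has_real_derivative (\<phi> 1 + \<phi> 0) / 2 - integral {0..1} \<phi>) (at 0)"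
    by (rule has_field_derivative_transform_within_open[where S = "{-1<..<1}"]) (use parts in auto)
  moreover have "\<phi> 1 = f p" "\<phi> 0 = f p" "integral {0..1} \<phi> = moving_integral (\<lambda>s. 1) v f p"
    using per[of p] by (simp_all add: \<phi>_def[abs_def] moving_integral_def)
  ultimately show ?thesis
    by simp
qed

text \<open>A moving average over a unit segment equals \<open>F (t + 1) - F t\<close> for an
  antiderivative \<open>F\<close>, so averaging gains differentiability in the direction of the
  segment.\<close>

lemma average_moving_derivative:
  assumes f: "continuous_on UNIV f"
  shows "((\<lambda>t. moving_integral (\<lambda>s. 1) v f (p + of_real t * v)) has_real_derivative f (p + v) - f p) (at 0)"
proof -
  define \<phi> where "\<phi> t = f (p + of_real t * v)" for t
  have \<phi>: "continuous_on S \<phi>" for S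
    unfolding \<phi>_def by (intro continuous_on_compose2[OF f] continuous_intros) auto
  obtain F where F: "\<And>t. t \<in> {-3<..<3} \<Longrightarrow> (F has_real_derivative \<phi> t) (at t)"
    using local_antiderivative[OF \<phi>] by blast
  have eq: "F (t + 1) - F t = moving_integral (\<lambda>s. 1) v f (p + of_real t * v)" if t: "t \<in> {-1<..<1}" for t
  proof -
    have "((\<lambda>s. \<phi> (t + s)) has_integral (F (t + 1) - F (t + 0))) {0..1}"
    proof (rule fundamental_theorem_of_calculus)
      fix s :: real assume s: "s \<in> {0..1}"
      have "((\<lambda>s. F (t + s)) has_real_derivative \<phi> (t + s)) (at s)"
        using has_real_derivative_shift[of F "\<phi> (t + s)" s t] F[of "t + s"] s t by (simp add: add_ac)
      then show "((\<lambda>s. F (t + s)) has_vector_derivative \<phi> (t + s)) (at s within {0..1})"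
        unfolding has_real_derivative_iff_has_vector_derivative by (rule has_vector_derivative_at_within)
    qed simp
    then show ?thesis
      by (simp add: moving_integral_def \<phi>_def integral_unique algebra_simps)
  qed
  have "((\<lambda>t. F (t + 1)) has_real_derivative \<phi> 1) (at 0)"
    by (rule has_real_derivative_shift) (use F[of 1] in simp)
  then have "((\<lambda>t. F (t + 1) - F t) has_real_derivative \<phi> 1 - \<phi> 0) (at 0)"
    using F[of 0] by (auto intro!: derivative_eq_intros)
  then have "((\<lambda>t. moving_integral (\<lambda>s. 1) v f (p + of_real t * v)) has_real_derivative \<phi> 1 - \<phi> 0) (at 0)"
    by (rule has_field_derivative_transform_within_open[where S = "{-1<..<1}"]) (use eq in auto)
  then show ?thesis
    by (simp add: \<phi>_def)
qed

lemma sawtooth_integral: "((\<lambda>s::real. \<bar>s - 1/2\<bar>) has_integral 1/4) {0..1}"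
proof -
  have "((\<lambda>s::real. - (s - 1/2)) has_integral (- ((1/2 - 1/2)\<^sup>2 / 2)) - (- ((0 - 1/2)\<^sup>2 / 2))) {0..1/2}"
    by (rule fundamental_theorem_of_calculus)
      (auto simp: has_real_derivative_iff_has_vector_derivative[symmetric] intro!: derivative_eq_intros simp: field_simps)
  then have 1: "((\<lambda>s::real. \<bar>s - 1/2\<bar>) has_integral 1/8) {0..1/2}"
    by (rule has_integral_spike[OF negligible_empty, rotated -1, THEN has_integral_eq_rhs]) (auto simp: power2_eq_square field_simps)
  have "((\<lambda>s::real. s - 1/2) has_integral (1 - 1/2)\<^sup>2 / 2 - (1/2 - 1/2)\<^sup>2 / 2) {1/2..1}"
    by (rule fundamental_theorem_of_calculus)
      (auto simp: has_real_derivative_iff_has_vector_derivative[symmetric] intro!: derivative_eq_intros simp: field_simps)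
  then have 2: "((\<lambda>s::real. \<bar>s - 1/2\<bar>) has_integral 1/8) {1/2..1}"
    by (rule has_integral_spike[OF negligible_empty, rotated -1, THEN has_integral_eq_rhs]) (auto simp: power2_eq_square field_simps)
  show ?thesis
    using has_integral_combine[OF _ _ 1 2] by simp
qed

text \<open>The sawtooth has integral norm 1/4 on the unit interval.\<close>

lemma sawtooth_moving_bound:
  assumes f: "continuous_on UNIV f" and M: "\<And>p. \<bar>f p\<bar> \<le> M"
  shows "\<bar>moving_integral (\<lambda>s. s - 1/2) v f p\<bar> \<le> M / 4"
proof -
  have "norm (integral {0..1} (\<lambda>s. (s - 1/2) * f (p + of_real s * v))) \<le> integral {0..1} (\<lambda>s. M * \<bar>s - 1/2\<bar>)"
  proof (rule integral_norm_bound_integral)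
    show "(\<lambda>s. (s - 1/2) * f (p + of_real s * v)) integrable_on {0..1}"
      by (intro moving_integrable f continuous_intros)
    show "(\<lambda>s. M * \<bar>s - 1/2\<bar>) integrable_on {0..1}"
      by (intro integrable_continuous_interval continuous_intros)
    show "norm ((s - 1/2) * f (p + of_real s * v)) \<le> M * \<bar>s - 1/2\<bar>" for s
      using mult_left_mono[OF M[of "p + of_real s * v"], of "\<bar>s - 1/2\<bar>"] by (simp add: abs_mult mult_ac)
  qed
  then show ?thesis
    using integral_unique[OF sawtooth_integral] by (simp add: moving_integral_def)
qed

lemma average_moving_bound:
  assumes f: "continuous_on UNIV f" and e: "\<And>s. s \<in> {0..1} \<Longrightarrow> \<bar>f (p + of_real s * v) - c\<bar> \<le> e"
  shows "\<bar>moving_integral (\<lambda>s. 1) v f p - c\<bar> \<le> e"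
proof -
  have cont: "continuous_on {0..1} (\<lambda>s. f (p + of_real s * v))"
    by (intro continuous_on_compose2[OF f] continuous_intros) auto
  have "norm (integral {0..1} (\<lambda>s. f (p + of_real s * v) - c)) \<le> e * (1 - 0)"
    using e by (intro integral_bound continuous_intros cont) auto
  then show ?thesis
    by (simp add: moving_integral_def integral_diff[OF integrable_continuous_interval[OF cont] integrable_const_ivl])
qed

lemma image_Complex_cbox: "(\<lambda>p. Complex (fst p) (snd p)) ` cbox u v = cbox (Complex (fst u) (snd u)) (Complex (fst v) (snd v))"
proof -
  have "z \<in> (\<lambda>p. Complex (fst p) (snd p)) ` cbox u v" if "z \<in> cbox (Complex (fst u) (snd u)) (Complex (fst v) (snd v))" for z
    by (rule image_eqI[of _ _ "(Re z, Im z)"]) (use that in \<open>auto simp: mem_box Basis_complex_def Basis_prod_def inner_complex_def inner_prod_def\<close>)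
  then show ?thesis
    by (auto simp: mem_box Basis_complex_def Basis_prod_def inner_complex_def inner_prod_def)
qed

text \<open>Fubini is transported from pairs of reals to complex numbers by the coordinate map,
  which preserves boxes and their areas.\<close>

lemma integral_cbox_complex:
  fixes f :: "complex \<Rightarrow> real"
  assumes f: "continuous_on UNIV f"
  shows "integral (cbox 0 (1 + \<i>)) f = integral {0..1} (\<lambda>x. integral {0..1} (\<lambda>y. f (Complex x y)))"
proof -
  define g where "g = (\<lambda>p::real \<times> real. Complex (fst p) (snd p))"
  define h where "h z = (Re z, Im z)" for z
  have hg: "h (g p) = p" "g (h z) = z" for p z
    by (simp_all add: g_def h_def)
  have img: "g ` cbox u v = cbox (g u) (g v)" for u v
    unfolding g_def by (rule image_Complex_cbox)
  have imh: "h ` cbox u v = cbox (h u) (h v)" for u v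
    using img[of "h u" "h v"] hg by (metis (no_types, lifting) image_cong image_ident image_image)
  have content: "measure lborel (g ` cbox u v) = 1 * measure lborel (cbox u v)" for u v
  proof (cases "fst u \<le> fst v \<and> snd u \<le> snd v")
    case True
    then have "measure lborel (cbox (g u) (g v)) = (fst v - fst u) * (snd v - snd u)"
      by (subst content_cbox) (auto simp: g_def Basis_complex_def inner_complex_def)
    moreover have "measure lborel (cbox u v) = (fst v - fst u) * (snd v - snd u)"
      using True content_Pair[of "fst u" "snd u" "fst v" "snd v"] by simp
    ultimately show ?thesis
      by (simp add: img)
  next
    case False
    then have "cbox u v = {}"
      by (auto simp: cbox_Pair_eq[of "fst u" "snd u" "fst v" "snd v", simplified])
    then show ?thesis
      by simp
  qed
  have contg: "continuous_on UNIV g"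
    unfolding g_def Complex_eq by (intro continuous_intros)
  have "(f has_integral integral (cbox 0 (1 + \<i>)) f) (cbox 0 (1 + \<i>))"
    by (intro integrable_integral integrable_continuous continuous_on_subset[OF f]) auto
  then have "((\<lambda>p. f (g p)) has_integral (1 / 1) *\<^sub>R integral (cbox 0 (1 + \<i>)) f) (h ` cbox 0 (1 + \<i>))"
  proof (rule has_integral_twiddle[where g = g and h = h, rotated -1])
    show "isCont g p" for p
      using contg continuous_on_eq_continuous_at[of UNIV g] by blast
    show "\<exists>w z. g ` cbox u v = cbox w z" "\<exists>w z. h ` cbox u' v' = cbox w z" for u v u' v'
      using img imh by blast+
  qed (use hg content in auto)
  then have "integral (cbox (0, 0) (1, 1)) (\<lambda>p. f (g p)) = integral (cbox 0 (1 + \<i>)) f"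
    unfolding imh by (simp add: h_def integral_unique)
  moreover have "integral (cbox (0, 0) (1, 1)) (\<lambda>p. f (g p)) = integral (cbox 0 1) (\<lambda>x. integral (cbox 0 1) (\<lambda>y. f (g (x, y))))"
    by (intro integral_prod_continuous continuous_on_compose2[OF f] continuous_on_subset[OF contg]) auto
  ultimately show ?thesis
    by (simp add: g_def)
qed

text \<open>\<open>h\<close>, the mean of \<open>H\<close> along vertical unit segments, depends on
  \<open>Re p\<close> alone and has horizontal mean zero because \<open>H\<close> has mean zero. It
  is integrated horizontally; the remainder has vertical mean zero by construction and is integrated
  vertically. Two components of size \<open>M / 4\<close> have norm at most
  \<open>sqrt 2 * M / 4\<close>, whence the threshold \<open>2 * sqrt 2\<close>.\<close>

theorem approximable_periodic:
  assumes uc: "uniformly_continuous_on UNIV H" and M: "\<And>p. \<bar>H p\<bar> \<le> M"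
    and per: "\<And>p m n. H (p + of_int m + \<i> * of_int n) = H p"
    and mean: "integral (cbox 0 (1 + \<i>)) H = 0"
  shows "approximable H (M / (2 * sqrt 2))"
  unfolding approximable_def
proof (intro allI impI)
  fix e :: real
  assume e: "e > 0"
  then have "e / 2 > 0"
    by simp
  then obtain \<delta> where \<delta>: "\<delta> > 0" "\<And>x x'. dist x' x < \<delta> \<Longrightarrow> dist (H x') (H x) < e / 2"
    using uniformly_continuous_UNIV_dist[OF uc] by blast
  define d where "d = \<delta> / 2"
  have d: "d > 0" "d < \<delta>"
    using \<delta>(1) by (simp_all add: d_def)
  have per1: "H (p + 1) = H p" and peri: "H (p + \<i>) = H p" for p
    using per[of p 1 0] per[of p 0 1] by simp_all
  define saw where "saw = (\<lambda>s::real. s - 1/2)"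
  have saw: "continuous_on UNIV saw" "\<And>s. s \<in> {0..1} \<Longrightarrow> \<bar>saw s\<bar> \<le> 1"
    by (auto simp: saw_def intro!: continuous_intros)
  have one: "continuous_on UNIV (\<lambda>s::real. 1::real)" "\<And>s::real. s \<in> {0..1} \<Longrightarrow> \<bar>1::real\<bar> \<le> 1"
    by auto
  note ucI = moving_integral_uniformly_continuous
  note cI = uniformly_continuous_imp_continuous[OF ucI]
  define h where "h = moving_integral (\<lambda>s. 1) \<i> H"
  define Hd where "Hd = moving_integral (\<lambda>s. 1) (of_real d) H"
  define hd where "hd = moving_integral (\<lambda>s. 1) \<i> Hd"
  define Q1 where "Q1 = moving_integral saw 1 h"
  define Q2 where "Q2 = moving_integral saw \<i> Hd"
  \<comment> \<open>\<open>H\<close> is replaced by its average \<open>Hd\<close> in the direction 1, so that \<open>Q2\<close>, which integrates \<open>Hd - hd\<close> in the direction \<open>\<i>\<close>, is also differentiable in the direction 1.\<close>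
  define dH where "dH p = (H (p + of_real d) - H p) / d" for p
  note H = uc uniformly_continuous_imp_continuous[OF uc]
  have uc_h: "uniformly_continuous_on UNIV h" and uc_Hd: "uniformly_continuous_on UNIV Hd"
    unfolding h_def Hd_def using ucI[OF one uc] by auto
  have uc_hd: "uniformly_continuous_on UNIV hd"
    unfolding hd_def by (rule ucI[OF one uc_Hd])
  note h = uc_h uniformly_continuous_imp_continuous[OF uc_h]
  note Hd = uc_Hd uniformly_continuous_imp_continuous[OF uc_Hd]
  have uc_shift: "uniformly_continuous_on UNIV (\<lambda>p. H (p + of_real d))"
    unfolding uniformly_continuous_on_def
  proof (intro allI impI)
    fix e :: real assume "e > 0"
    then obtain \<delta> where "\<delta> > 0" "\<And>x x'. dist x' x < \<delta> \<Longrightarrow> dist (H x') (H x) < e"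
      using uniformly_continuous_UNIV_dist[OF uc] by blast
    then show "\<exists>\<delta>>0. \<forall>x\<in>UNIV. \<forall>x'\<in>UNIV. dist x' x < \<delta> \<longrightarrow> dist (H (x' + of_real d)) (H (x + of_real d)) < e"
      by (intro exI[of _ \<delta>]) simp
  qed
  have uc_dH: "uniformly_continuous_on UNIV dH"
    unfolding dH_def divide_inverse
    by (intro uniformly_continuous_on_cmul_right uniformly_continuous_on_diff uc uc_shift)
  have h_per: "h (p + 1) = h p" for p
  proof -
    have "H (p + 1 + z) = H (p + z)" for z
      using per1[of "p + z"] by (simp add: add_ac)
    then show ?thesis
      by (simp add: h_def moving_integral_def)
  qed
  \<comment> \<open>The vertical derivative of the vertical average is
    \<open>H (p + \<i>) - H p\<close>, which vanishes.\<close>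
  have h_const: "h (p + of_real t * \<i>) = h p" for p t
  proof -
    have "((\<lambda>t. h (p + of_real t * \<i>)) has_real_derivative 0) (at 0)" for p
      using average_moving_derivative[OF H(2), of \<i> p] peri[of p] by (simp add: h_def)
    then have "\<forall>t. ((\<lambda>t. h (p + of_real t * \<i>)) has_real_derivative 0) (at t)"
      using directional_derivative_shift[of h \<i> "\<lambda>_. 0"] by simp
    from DERIV_isconst_all[OF this, of t 0] show ?thesis
      by simp
  qed
  have Hd_per: "Hd (p + \<i>) = Hd p" for p
  proof -
    have "H (p + \<i> + z) = H (p + z)" for z
      using peri[of "p + z"] by (simp add: add_ac)
    then show ?thesis
      by (simp add: Hd_def moving_integral_def)
  qed
  \<comment> \<open>The horizontal mean of \<open>h\<close> is constant in both directions; at 0 it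
    is the iterated integral over the unit square.\<close>
  have h_mean: "moving_integral (\<lambda>s. 1) 1 h p = 0" for p
  proof -
    let ?m = "moving_integral (\<lambda>s. 1) 1 h"
    have "((\<lambda>t. ?m (p + of_real t * 1)) has_real_derivative 0) (at 0)" for p
      using average_moving_derivative[OF h(2), of 1 p] h_per[of p] by simp
    then have "\<forall>t. ((\<lambda>t. ?m (of_real (Im p) * \<i> + of_real t * 1)) has_real_derivative 0) (at t)"
      using directional_derivative_shift[of ?m 1 "\<lambda>_. 0"] by simp
    from DERIV_isconst_all[OF this, of "Re p" 0] have "?m p = ?m (of_real (Im p) * \<i>)"
      by (simp add: complex_eq[of p, symmetric] add.commute mult.commute)
    also have "\<dots> = ?m 0"
    proof -
      have "h (of_real (Im p) * \<i> + of_real s) = h (of_real s)" for s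
        using h_const[of "of_real s" "Im p"] by (simp add: add.commute)
      then show ?thesis
        by (simp add: moving_integral_def)
    qed
    also have "\<dots> = integral (cbox 0 (1 + \<i>)) H"
      unfolding integral_cbox_complex[OF H(2)] by (simp add: moving_integral_def h_def Complex_eq mult.commute)
    finally show ?thesis
      by (simp add: mean)
  qed
  have Q1x: "((\<lambda>t. Q1 (p + of_real t)) has_real_derivative h p) (at 0)" for p
    using sawtooth_moving_derivative[of h 1 p, OF h(2) h_per] h_mean[of p] by (simp add: Q1_def saw_def)
  have Q1y: "Q1 (p + of_real t * \<i>) = Q1 p" for p t
  proof -
    have "h (p + of_real t * \<i> + z) = h (p + z)" for z
      using h_const[of "p + z" t] by (simp add: add_ac)
    then show ?thesis
      by (simp add: Q1_def moving_integral_def)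
  qed
  have Q2y: "((\<lambda>t. Q2 (p + of_real t * \<i>)) has_real_derivative Hd p - hd p) (at 0)" for p
    using sawtooth_moving_derivative[of Hd \<i> p, OF Hd(2) Hd_per] by (simp add: Q2_def hd_def saw_def)
  have dHd: "((\<lambda>t. Hd (p + of_real t * 1)) has_real_derivative dH p) (at 0)" for p
  proof -
    have "((\<lambda>t. Hd (p + of_real t * of_real d)) has_real_derivative H (p + of_real d) - H p) (at (0 / d))"
      using average_moving_derivative[OF H(2)] by (simp add: Hd_def)
    moreover have "((\<lambda>t. t / d) has_real_derivative 1 / d) (at 0)"
      using d(1) by (auto intro!: derivative_eq_intros)
    ultimately have "((\<lambda>t. Hd (p + of_real (t / d) * of_real d)) has_real_derivative (H (p + of_real d) - H p) * (1 / d)) (at 0)"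
      by (rule DERIV_chain2[of "\<lambda>t. Hd (p + of_real t * of_real d)"])
    then show ?thesis
      using d(1) by (simp add: dH_def)
  qed
  have Q2x: "((\<lambda>t. Q2 (p + of_real t)) has_real_derivative moving_integral saw \<i> dH p) (at 0)" for p
    using moving_integral_derivative[OF saw(1) Hd(2) uniformly_continuous_imp_continuous[OF uc_dH] dHd] by (simp add: Q2_def)
  define Q where "Q p = Complex (Q1 p) (Q2 p)" for p
  have uc_Complex: "uniformly_continuous_on UNIV (\<lambda>p. Complex (f p) (g p))"
    if "uniformly_continuous_on UNIV f" "uniformly_continuous_on UNIV g" for f g :: "complex \<Rightarrow> real"
    unfolding Complex_eq
    by (intro uniformly_continuous_on_add uniformly_continuous_on_cmul_left that
        bounded_linear.uniformly_continuous_on[OF bounded_linear_of_real])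
  show "\<exists>Q G. (\<forall>p. norm (Q p) \<le> M / (2 * sqrt 2)) \<and> unif_div Q G \<and> (\<forall>p. \<bar>G p - H p\<bar> \<le> e)"
  proof (rule exI[of _ Q], rule exI[of _ "\<lambda>p. h p + (Hd p - hd p)"], intro conjI allI)
    fix p
    have "(norm (Q p))\<^sup>2 = (Q1 p)\<^sup>2 + (Q2 p)\<^sup>2"
      by (simp add: Q_def cmod_power2)
    also have "\<dots> \<le> (M / 4)\<^sup>2 + (M / 4)\<^sup>2"
    proof -
      have "\<bar>h p\<bar> \<le> M" "\<bar>Hd p\<bar> \<le> M" for p
        using average_moving_bound[OF H(2), where c = 0 and e = M] M by (simp_all add: h_def Hd_def)
      then have "\<bar>Q1 p\<bar> \<le> M / 4" "\<bar>Q2 p\<bar> \<le> M / 4"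
        using sawtooth_moving_bound[OF h(2)] sawtooth_moving_bound[OF Hd(2)] by (simp_all add: Q1_def Q2_def saw_def)
      then show ?thesis
        by (intro add_mono abs_le_square_iff[THEN iffD1]) auto
    qed
    also have "\<dots> = (M / (2 * sqrt 2))\<^sup>2"
      by (simp add: power_divide power_mult_distrib)
    finally show "norm (Q p) \<le> M / (2 * sqrt 2)"
      by (rule power2_le_imp_le) (use M[of 0] in auto)
    have "\<bar>Hd p - H p\<bar> \<le> e / 2" for p
      unfolding Hd_def
    proof (rule average_moving_bound[OF H(2)])
      fix s :: real
      assume s: "s \<in> {0..1}"
      have "s * d \<le> 1 * d"
        using s d by (intro mult_right_mono) auto
      then have "s * d < \<delta>"
        using d by linarith
      then have "dist (p + of_real s * of_real d) p < \<delta>"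
        using s d by (auto simp: dist_norm norm_mult)
      from \<delta>(2)[OF this] show "\<bar>H (p + of_real s * of_real d) - H p\<bar> \<le> e / 2"
        by (simp add: dist_real_def)
    qed
    note Hd_close = this
    have "\<bar>moving_integral (\<lambda>s. 1) \<i> (\<lambda>p. Hd p - H p) p - 0\<bar> \<le> e / 2"
      by (rule average_moving_bound) (use Hd_close in \<open>auto intro!: continuous_intros Hd(2) H(2)\<close>)
    moreover have "moving_integral (\<lambda>s. 1) \<i> (\<lambda>p. Hd p - H p) p = hd p - h p"
      using integral_diff[OF moving_integrable[OF one(1) Hd(2)] moving_integrable[OF one(1) H(2)], of p \<i> p \<i>]
      by (simp add: moving_integral_def hd_def h_def)
    ultimately show "\<bar>h p + (Hd p - hd p) - H p\<bar> \<le> e"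
      using Hd_close[of p] by linarith
  next
    show "unif_div Q (\<lambda>p. h p + (Hd p - hd p))"
    proof (rule unif_div_of_partials)
      show "((\<lambda>t. Q (p + of_real t)) has_vector_derivative Complex (h p) (moving_integral saw \<i> dH p)) (at 0)" for p
        unfolding Q_def by (rule has_vector_derivative_Complex[OF Q1x Q2x])
      show "((\<lambda>t. Q (p + of_real t * \<i>)) has_vector_derivative Complex 0 (Hd p - hd p)) (at 0)" for p
        unfolding Q_def Q1y by (rule has_vector_derivative_Complex[OF DERIV_const Q2y])
      show "uniformly_continuous_on UNIV (\<lambda>p. Complex (h p) (moving_integral saw \<i> dH p))"
        by (intro uc_Complex uc_h ucI[OF saw uc_dH])
      show "uniformly_continuous_on UNIV (\<lambda>p. Complex 0 (Hd p - hd p))"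
        by (intro uc_Complex uniformly_continuous_on_const uniformly_continuous_on_diff uc_Hd uc_hd)
    qed simp
  qed
qed

section \<open>Riesz potentials and the Lorentz norm\<close>

text \<open>The area of a disc is linear in the squared radius, so the squared distance pushes the
  plane to \<open>pi\<close> times Lebesgue measure on the half-line. This replaces polar
  coordinates in the radial integrals below.\<close>

lemma distr_square_distance:
  "distr lborel borel (\<lambda>y::complex. (norm (p - y))\<^sup>2) = density lborel (\<lambda>v. ennreal pi * indicator {0..} v)"
proof (rule measure_eqI_generator_eq[where E = "range atMost" and \<Omega> = UNIV and A = "\<lambda>i. {..real i}"])
  have le: "emeasure (distr lborel borel (\<lambda>y::complex. (norm (p - y))\<^sup>2)) {..a} = ennreal (pi * max a 0)" for a :: real
  proof (cases "a \<ge> 0")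
    case True
    have "(\<lambda>y::complex. (norm (p - y))\<^sup>2) -` {..a} \<inter> space lborel = cball p (sqrt a)"
      using True by (auto simp: dist_norm real_le_rsqrt abs_le_square_iff[symmetric] intro: real_le_rsqrt) 
        (metis norm_ge_zero power_mono real_sqrt_pow2)
    then show ?thesis
      using True by (subst emeasure_distr) (auto simp: emeasure_cball unit_ball_vol_2)
  next
    case False
    then have "(\<lambda>y::complex. (norm (p - y))\<^sup>2) -` {..a} \<inter> space lborel = {}"
      by (auto dest: order_trans[OF zero_le_power2])
    then show ?thesis
      using False by (subst emeasure_distr) auto
  qed
  show "emeasure (distr lborel borel (\<lambda>y::complex. (norm (p - y))\<^sup>2)) {..real i} \<noteq> \<infinity>" for i
    unfolding le by simp
  fix X :: "real set"
  assume "X \<in> range atMost"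
  then obtain a where X: "X = {..a}"
    by auto
  have "emeasure (density lborel (\<lambda>v. ennreal pi * indicator {0..} v)) {..a} = (\<integral>\<^sup>+ v. ennreal pi * indicator {0..} v * indicator {..a} v \<partial>lborel)"
    by (rule emeasure_density) auto
  also have "\<dots> = (\<integral>\<^sup>+ v. ennreal pi * indicator {0..a} v \<partial>lborel)"
    by (intro nn_integral_cong) (auto simp: indicator_def)
  also have "\<dots> = ennreal (pi * max a 0)"
    by (subst nn_integral_cmult_indicator) (cases "a \<ge> 0"; auto simp: ennreal_mult' max_def)+
  finally show "emeasure (distr lborel borel (\<lambda>y::complex. (norm (p - y))\<^sup>2)) X = emeasure (density lborel (\<lambda>v. ennreal pi * indicator {0..} v)) X"
    by (simp add: X le)
next
  show "(\<Union>i. {..real i}) = UNIV"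
    using real_arch_simple by auto
qed (auto simp: Int_stable_def borel_eq_atMost)

lemma nn_integral_radial:
  assumes [measurable]: "g \<in> borel_measurable borel"
  shows "(\<integral>\<^sup>+ y. g ((norm (p - y :: complex))\<^sup>2) \<partial>lborel) = ennreal pi * (\<integral>\<^sup>+ v. g v * indicator {0..} v \<partial>lborel)"
proof -
  have "(\<integral>\<^sup>+ y. g ((norm (p - y :: complex))\<^sup>2) \<partial>lborel) = (\<integral>\<^sup>+ v. g v \<partial>distr lborel borel (\<lambda>y::complex. (norm (p - y))\<^sup>2))"
    by (subst nn_integral_distr) auto
  also have "\<dots> = (\<integral>\<^sup>+ v. ennreal pi * (g v * indicator {0..} v) \<partial>lborel)"
    unfolding distr_square_distance by (subst nn_integral_density) (auto simp: mult_ac intro!: nn_integral_cong)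
  finally show ?thesis
    by (simp add: nn_integral_cmult)
qed

lemma nn_integral_inverse_sqrt:
  assumes "c \<ge> 0"
  shows "(\<integral>\<^sup>+ v. ennreal (v powr (-1/2)) * indicator {0..c} v \<partial>lborel) = ennreal (2 * sqrt c)"
proof -
  have "((\<lambda>v. v powr (-1/2)) has_integral (c powr (-1/2 + 1) / (-1/2 + 1))) {0..c}"
    by (rule has_integral_powr_from_0) (use assms in auto)
  then have "((\<lambda>v. v powr (-1/2)) has_integral (2 * sqrt c)) {0..c}"
    using assms by (simp add: powr_half_sqrt mult.commute)
  from nn_integral_has_integral_lebesgue'[OF _ this] show ?thesis
    by simp
qed

text \<open>Split the integral at distance \<open>R\<close> from \<open>p\<close>; the optimal \<open>R\<close> is of order \<open>sqrt m\<close>.\<close>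

lemma riesz_potential_of_set_aux:
  fixes E :: "complex set"
  assumes [measurable]: "E \<in> sets borel" and R: "R > 0"
  shows "(\<integral>\<^sup>+ y. ennreal (1 / norm (p - y)) * indicator E y \<partial>lborel) \<le> ennreal (1 / R) * emeasure lborel E + ennreal (2 * pi * R)"
proof -
  have "(\<integral>\<^sup>+ y. ennreal (1 / norm (p - y)) * indicator E y \<partial>lborel) \<le>
     (\<integral>\<^sup>+ y. ennreal (1 / R) * indicator E y + ennreal ((norm (p - y))\<^sup>2 powr (-1/2)) * indicator {0..R\<^sup>2} ((norm (p - y))\<^sup>2) \<partial>lborel)"
  proof (rule nn_integral_mono)
    fix y
    have sq: "(norm (p - y))\<^sup>2 powr (-1/2) = 1 / norm (p - y)"
      by (simp add: powr_minus powr_half_sqrt inverse_eq_divide)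
    show "ennreal (1 / norm (p - y)) * indicator E y \<le> ennreal (1 / R) * indicator E y + ennreal ((norm (p - y))\<^sup>2 powr (-1/2)) * indicator {0..R\<^sup>2} ((norm (p - y))\<^sup>2)"
    proof (cases "norm (p - y) \<le> R")
      case True
      then have "(norm (p - y))\<^sup>2 \<le> R\<^sup>2"
        by (intro power_mono) auto
      then show ?thesis
        unfolding sq by (auto simp: indicator_def)
    next
      case False
      then have "1 / norm (p - y) \<le> 1 / R"
        using R by (intro divide_left_mono mult_pos_pos) auto
      then show ?thesis
        by (auto simp: indicator_def intro!: add_increasing2 ennreal_leI)
    qed
  qed
  also have "\<dots> = (\<integral>\<^sup>+ y. ennreal (1 / R) * indicator E y \<partial>lborel) + (\<integral>\<^sup>+ y. ennreal ((norm (p - y))\<^sup>2 powr (-1/2)) * indicator {0..R\<^sup>2} ((norm (p - y))\<^sup>2) \<partial>lborel)"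
    by (rule nn_integral_add) auto
  also have "(\<integral>\<^sup>+ y. ennreal (1 / R) * indicator E y \<partial>lborel) = ennreal (1 / R) * emeasure lborel E"
    by (rule nn_integral_cmult_indicator) auto
  also have "(\<integral>\<^sup>+ y. ennreal ((norm (p - y))\<^sup>2 powr (-1/2)) * indicator {0..R\<^sup>2} ((norm (p - y))\<^sup>2) \<partial>lborel) =
      ennreal pi * (\<integral>\<^sup>+ v. ennreal (v powr (-1/2)) * indicator {0..R\<^sup>2} v * indicator {0..} v \<partial>lborel)"
    by (rule nn_integral_radial) auto
  also have "(\<integral>\<^sup>+ v. ennreal (v powr (-1/2)) * indicator {0..R\<^sup>2} v * indicator {0..} v \<partial>lborel) = ennreal (2 * sqrt (R\<^sup>2))"
    by (subst nn_integral_inverse_sqrt[symmetric]) (auto intro!: nn_integral_cong simp: indicator_def)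
  finally show ?thesis
    using R by (simp add: ennreal_mult'[symmetric] mult_ac)
qed

lemma riesz_potential_of_set:
  fixes E :: "complex set"
  assumes [measurable]: "E \<in> sets borel" and E: "emeasure lborel E = ennreal m" "m \<ge> 0"
  shows "(\<integral>\<^sup>+ y. ennreal (1 / norm (p - y)) * indicator E y \<partial>lborel) \<le> ennreal (3 * sqrt pi * sqrt m)"
proof (cases "m = 0")
  case True
  then have "E \<in> null_sets lborel"
    using E by (auto simp: null_sets_def)
  then have "AE y in lborel. y \<notin> E"
    by (rule AE_not_in)
  then have "(\<integral>\<^sup>+ y. ennreal (1 / norm (p - y)) * indicator E y \<partial>lborel) = (\<integral>\<^sup>+ y. 0 \<partial>(lborel :: complex measure))"
    by (intro nn_integral_cong_AE) auto
  then show ?thesis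
    by simp
next
  case False
  \<comment> \<open>The radius of the disc of area \<open>m\<close>. The far part of the split then
    contributes \<open>sqrt (pi * m)\<close> and the near part twice as much.\<close>
  define R where "R = sqrt m / sqrt pi"
  have R: "R > 0"
    using False E by (simp add: R_def)
  have "1 / R * m = sqrt pi * sqrt m"
    using False E real_div_sqrt[of m] by (simp add: R_def times_divide_eq_right[symmetric] del: times_divide_eq_right)
  moreover have "2 * pi * R = 2 * sqrt pi * sqrt m"
    by (simp add: R_def field_simps)
  ultimately have "1 / R * m + 2 * pi * R = 3 * sqrt pi * sqrt m"
    by simp
  then show ?thesis
    using riesz_potential_of_set_aux[OF assms(1) R, of p] R E
    by (simp add: ennreal_mult'[symmetric] ennreal_plus[symmetric] del: ennreal_plus)
qed

lemma superlevel_finite_measure: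
  fixes H :: "complex \<Rightarrow> real"
  assumes H: "continuous_on UNIV H" and decay: "(H \<longlongrightarrow> 0) at_infinity" and s: "s > 0"
  shows "emeasure lborel {y. s < \<bar>H y\<bar>} < \<infinity>"
proof -
  obtain b where b: "\<And>y. norm y \<ge> b \<Longrightarrow> \<bar>H y\<bar> < s"
    using tendstoD[OF decay s] unfolding eventually_at_infinity by (auto simp: dist_real_def)
  have "{y. s < \<bar>H y\<bar>} \<subseteq> cball 0 b"
  proof
    fix y assume "y \<in> {y. s < \<bar>H y\<bar>}"
    then show "y \<in> cball 0 b"
      using b[of y] by (cases "b \<le> norm y") auto
  qed
  then have "emeasure lborel {y. s < \<bar>H y\<bar>} \<le> emeasure lborel (cball (0 :: complex) b)"
    by (intro emeasure_mono) auto
  also have "\<dots> < \<infinity>"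
    using emeasure_lborel_cball_finite[of "0 :: complex" b] by simp
  finally show ?thesis .
qed

lemma decr_rearr_ge:
  assumes M: "\<And>p. \<bar>H p\<bar> \<le> M" and s: "ennreal t < emeasure lborel {y. s < \<bar>H y\<bar>}" and H: "continuous_on UNIV H"
  shows "s \<le> decr_rearr H t"
  unfolding decr_rearr_def
proof (rule cInf_greatest)
  \<comment> \<open>The level \<open>M\<close> is admissible; without an admissible level the
    infimum would carry no information.\<close>
  have "{p. M < \<bar>H p\<bar>} = {}"
    using M by (auto simp: not_less)
  moreover have "0 \<le> M"
    using M[of 0] by linarith
  ultimately show "{s. 0 \<le> s \<and> emeasure lborel {p. s < \<bar>H p\<bar>} \<le> ennreal t} \<noteq> {}"
    by (auto intro!: exI[of _ M])
  fix s' assume s': "s' \<in> {s. 0 \<le> s \<and> emeasure lborel {p. s < \<bar>H p\<bar>} \<le> ennreal t}"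
  show "s \<le> s'"
  proof (rule ccontr)
    assume "\<not> s \<le> s'"
    moreover have [measurable]: "H \<in> borel_measurable borel"
      by (rule borel_measurable_continuous_onI[OF H])
    ultimately have "emeasure lborel {y. s < \<bar>H y\<bar>} \<le> emeasure lborel {y. s' < \<bar>H y\<bar>}"
      by (intro emeasure_mono) auto
    then show False
      using s s' by auto
  qed
qed

text \<open>Layer cake reduces \<open>\<bar>H\<bar>\<close> to its superlevel sets, whose potentials
  are at most \<open>3 * sqrt pi * sqrt (\<mu> s)\<close>. After the order of integration is
  exchanged, the levels \<open>s\<close> with \<open>t < \<mu> s\<close> fill at most the interval
  up to the decreasing rearrangement at \<open>t\<close>, which is the integrand of the Lorentz
  norm.\<close>

theorem riesz_potential_le_lorentz:
  assumes H: "continuous_on UNIV H" and decay: "(H \<longlongrightarrow> 0) at_infinity" and M: "\<And>p. \<bar>H p\<bar> \<le> M"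
  shows "(\<integral>\<^sup>+ y. ennreal (\<bar>H y\<bar> / norm (p - y)) \<partial>lborel) \<le> ennreal (3 / 2 * sqrt pi) * lorentz21 H"
proof -
  have [measurable]: "H \<in> borel_measurable borel"
    by (rule borel_measurable_continuous_onI[OF H])
  define \<mu> where "\<mu> s = (\<integral>\<^sup>+ y. indicator {y. s < \<bar>H y\<bar>} y \<partial>lborel)" for s
  have \<mu>: "\<mu> s = emeasure lborel {y. s < \<bar>H y\<bar>}" for s
    unfolding \<mu>_def by (subst nn_integral_indicator) auto
  have [measurable]: "\<mu> \<in> borel_measurable borel"
    unfolding \<mu>_def indicator_def by measurable
  have layer: "(\<integral>\<^sup>+ s. indicator {0<..<c} s \<partial>lborel) = ennreal c" if "c \<ge> 0" for c :: real
    using that by simp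
  have "(\<integral>\<^sup>+ y. ennreal (\<bar>H y\<bar> / norm (p - y)) \<partial>lborel) =
      (\<integral>\<^sup>+ y. (\<integral>\<^sup>+ s. ennreal (1 / norm (p - y)) * indicator {0<..<\<bar>H y\<bar>} s \<partial>lborel) \<partial>lborel)"
  proof (rule nn_integral_cong)
    fix y
    have "(\<integral>\<^sup>+ s. ennreal (1 / norm (p - y)) * indicator {0<..<\<bar>H y\<bar>} s \<partial>lborel) = ennreal (1 / norm (p - y)) * ennreal \<bar>H y\<bar>"
      by (subst nn_integral_cmult) (simp_all add: layer)
    then show "ennreal (\<bar>H y\<bar> / norm (p - y)) = (\<integral>\<^sup>+ s. ennreal (1 / norm (p - y)) * indicator {0<..<\<bar>H y\<bar>} s \<partial>lborel)"
      by (simp add: ennreal_mult'[symmetric])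
  qed
  also have "\<dots> = (\<integral>\<^sup>+ s. (\<integral>\<^sup>+ y. ennreal (1 / norm (p - y)) * indicator {0<..<\<bar>H y\<bar>} s \<partial>lborel) \<partial>lborel)"
    unfolding indicator_def greaterThanLessThan_iff by (rule lborel_pair.Fubini') measurable
  also have "\<dots> \<le> (\<integral>\<^sup>+ s. (\<integral>\<^sup>+ t. ennreal (3 / 2 * sqrt pi) * (ennreal (t powr (-1/2)) * (indicator {0<..} t * (indicator {0<..} s * of_bool (ennreal t < \<mu> s)))) \<partial>lborel) \<partial>lborel)"
  proof (rule nn_integral_mono)
    fix s :: real
    show "(\<integral>\<^sup>+ y. ennreal (1 / norm (p - y)) * indicator {0<..<\<bar>H y\<bar>} s \<partial>lborel) \<le>
        (\<integral>\<^sup>+ t. ennreal (3 / 2 * sqrt pi) * (ennreal (t powr (-1/2)) * (indicator {0<..} t * (indicator {0<..} s * of_bool (ennreal t < \<mu> s)))) \<partial>lborel)"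
    proof (cases "s > 0")
      case True
      obtain m where m: "\<mu> s = ennreal m" "m \<ge> 0"
        using superlevel_finite_measure[OF H decay True] unfolding \<mu>[symmetric] by (cases "\<mu> s") auto
      have "(\<integral>\<^sup>+ y. ennreal (1 / norm (p - y)) * indicator {0<..<\<bar>H y\<bar>} s \<partial>lborel) = (\<integral>\<^sup>+ y. ennreal (1 / norm (p - y)) * indicator {y. s < \<bar>H y\<bar>} y \<partial>lborel)"
        using True by (intro nn_integral_cong) (auto simp: indicator_def)
      also have "\<dots> \<le> ennreal (3 * sqrt pi * sqrt m)"
        by (rule riesz_potential_of_set) (use m \<mu> in auto)
      also have "\<dots> = ennreal (3 / 2 * sqrt pi) * ennreal (2 * sqrt m)"
        by (simp add: ennreal_mult'[symmetric] mult.assoc)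
      \<comment> \<open>Writing the square root as an integral in \<open>t\<close> introduces the
        weight of the Lorentz norm and prepares the exchange of \<open>s\<close> and
        \<open>t\<close>.\<close>
      also have "ennreal (2 * sqrt m) = (\<integral>\<^sup>+ t. ennreal (t powr (-1/2)) * indicator {0..m} t \<partial>lborel)"
        using nn_integral_inverse_sqrt[OF m(2)] by simp
      also have "\<dots> = (\<integral>\<^sup>+ t. ennreal (t powr (-1/2)) * (indicator {0<..} t * (indicator {0<..} s * of_bool (ennreal t < \<mu> s))) \<partial>lborel)"
      proof (rule nn_integral_cong_AE)
        have "AE t in lborel. t \<noteq> m"
          by (rule AE_lborel_singleton)
        then show "AE t in lborel. ennreal (t powr (-1/2)) * indicator {0..m} t =
            ennreal (t powr (-1/2)) * (indicator {0<..} t * (indicator {0<..} s * of_bool (ennreal t < \<mu> s)))"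
          by eventually_elim (use True m in \<open>auto simp: indicator_def ennreal_less_iff\<close>)
      qed
      finally show ?thesis
        by (subst nn_integral_cmult) auto
    qed (simp add: indicator_def)
  qed
  also have "\<dots> = (\<integral>\<^sup>+ t. (\<integral>\<^sup>+ s. ennreal (3 / 2 * sqrt pi) * (ennreal (t powr (-1/2)) * (indicator {0<..} t * (indicator {0<..} s * of_bool (ennreal t < \<mu> s)))) \<partial>lborel) \<partial>lborel)"
    by (rule lborel_pair.Fubini') measurable
  also have "\<dots> = (\<integral>\<^sup>+ t. ennreal (3 / 2 * sqrt pi) * (ennreal (t powr (-1/2)) * (indicator {0<..} t * (\<integral>\<^sup>+ s. indicator {0<..} s * of_bool (ennreal t < \<mu> s) \<partial>lborel))) \<partial>lborel)"
    by (intro nn_integral_cong) (simp add: nn_integral_cmult)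
  also have "\<dots> = ennreal (3 / 2 * sqrt pi) * (\<integral>\<^sup>+ t. ennreal (t powr (-1/2)) * (indicator {0<..} t * (\<integral>\<^sup>+ s. indicator {0<..} s * of_bool (ennreal t < \<mu> s) \<partial>lborel)) \<partial>lborel)"
    by (rule nn_integral_cmult) measurable
  also have "\<dots> \<le> ennreal (3 / 2 * sqrt pi) * lorentz21 H"
    unfolding lorentz21_def
  proof (rule mult_left_mono[OF nn_integral_mono])
    fix t :: real
    show "ennreal (t powr (-1/2)) * (indicator {0<..} t * (\<integral>\<^sup>+ s. indicator {0<..} s * of_bool (ennreal t < \<mu> s) \<partial>lborel)) \<le>
        ennreal (decr_rearr H t * t powr (-1/2)) * indicator {0<..} t"
    proof (cases "t > 0")
      case True
      have "(\<integral>\<^sup>+ s. indicator {0<..} s * of_bool (ennreal t < \<mu> s) \<partial>lborel) \<le> (\<integral>\<^sup>+ s. indicator {0<..decr_rearr H t} s \<partial>lborel)"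
        using decr_rearr_ge[OF M _ H] by (intro nn_integral_mono) (auto simp: indicator_def \<mu>)
      also have "\<dots> = ennreal (decr_rearr H t)"
        by (cases "decr_rearr H t \<ge> 0") (auto simp: ennreal_neg)
      finally have "ennreal (t powr (-1/2)) * (\<integral>\<^sup>+ s. indicator {0<..} s * of_bool (ennreal t < \<mu> s) \<partial>lborel) \<le> ennreal (t powr (-1/2)) * ennreal (decr_rearr H t)"
        by (rule mult_left_mono) simp
      then show ?thesis
        using True by (simp add: ennreal_mult'' mult.commute)
    qed simp
  qed simp
  finally show ?thesis .
qed

section \<open>Approximate vector potentials in the decaying case\<close>

lemma uniformly_continuous_of_decay:
  fixes f :: "complex \<Rightarrow> 'a::real_normed_vector"
  assumes f: "continuous_on UNIV f" and decay: "(f \<longlongrightarrow> 0) at_infinity"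
  shows "uniformly_continuous_on UNIV f"
  unfolding uniformly_continuous_on_def
proof (intro allI impI)
  fix e :: real
  assume e: "e > 0"
  then obtain R where R: "\<And>z. norm z \<ge> R \<Longrightarrow> norm (f z) < e / 2"
    using tendstoD[OF decay, of "e / 2"] unfolding eventually_at_infinity by (auto simp: dist_norm)
  have "uniformly_continuous_on (cball 0 (R + 1)) f"
    by (intro compact_uniformly_continuous continuous_on_subset[OF f]) auto
  then obtain d where d: "d > 0" "\<And>x x'. x \<in> cball 0 (R + 1) \<Longrightarrow> x' \<in> cball 0 (R + 1) \<Longrightarrow> dist x' x < d \<Longrightarrow> dist (f x') (f x) < e"
    using e unfolding uniformly_continuous_on_def by metis
  show "\<exists>d>0. \<forall>x\<in>UNIV. \<forall>x'\<in>UNIV. dist x' x < d \<longrightarrow> dist (f x') (f x) < e"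
  proof (intro exI[of _ "min d 1"] conjI ballI impI)
    fix x x' :: complex
    assume xx: "dist x' x < min d 1"
    then have diff: "\<bar>norm x' - norm x\<bar> < 1"
      using norm_triangle_ineq3[of x' x] by (simp add: dist_norm)
    show "dist (f x') (f x) < e"
    proof (cases "norm x \<le> R + 1 \<and> norm x' \<le> R + 1")
      case True
      then show ?thesis
        using d(2)[of x x'] xx by simp
    next
      case False
      then have "norm x \<ge> R" "norm x' \<ge> R"
        using diff by auto
      then show ?thesis
        using R[of x] R[of x'] norm_triangle_ineq4[of "f x'" "f x"] unfolding dist_norm by linarith
    qed
  qed (use d(1) in simp)
qed

lemma integrable_convolution:
  fixes f :: "complex \<Rightarrow> real" and k :: "complex \<Rightarrow> 'a::euclidean_space"
  assumes f: "continuous_on UNIV f" "\<forall>y. norm y > B \<longrightarrow> f y = 0" and k: "continuous_on UNIV k"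
  shows "integrable lborel (\<lambda>y. f y *\<^sub>R k (p - y))"
proof -
  have "integrable lborel (\<lambda>y. indicator (cball 0 B) y *\<^sub>R (f y *\<^sub>R k (p - y)))"
    by (intro borel_integrable_compact continuous_intros continuous_on_compose2[OF k] continuous_on_subset[OF f(1)]) auto
  moreover have "(\<lambda>y. indicator (cball 0 B) y *\<^sub>R (f y *\<^sub>R k (p - y))) = (\<lambda>y. f y *\<^sub>R k (p - y))"
    using f(2) by (auto simp: indicator_def fun_eq_iff) (meson linorder_not_le)
  ultimately show ?thesis
    by simp
qed

text \<open>All derivatives fall on the kernel, since \<open>f\<close> is merely continuous. Compact
  support makes \<open>f\<close> integrable, and the uniform remainder of the kernel is only
  multiplied by the integral of \<open>\<bar>f\<bar>\<close>.\<close>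

lemma unif_div_convolution:
  fixes f :: "complex \<Rightarrow> real" and K a b :: "complex \<Rightarrow> complex"
  assumes f: "continuous_on UNIV f" "\<forall>y. norm y > B \<longrightarrow> f y = 0"
    and cont: "continuous_on UNIV K" "continuous_on UNIV a" "continuous_on UNIV b"
    and rem: "\<forall>\<epsilon>>0. \<exists>\<delta>>0. \<forall>p h. norm h \<le> \<delta> \<longrightarrow> norm (K (p + h) - K p - (Re h *\<^sub>R a p + Im h *\<^sub>R b p)) \<le> \<epsilon> * norm h"
  shows "unif_div (\<lambda>p. LINT y|lborel. f y *\<^sub>R K (p - y)) (\<lambda>p. LINT y|lborel. f y * (Re (a (p - y)) + Im (b (p - y))))"
  unfolding unif_div_def
proof (rule exI[of _ "\<lambda>p. LINT y|lborel. f y *\<^sub>R a (p - y)"], rule exI[of _ "\<lambda>p. LINT y|lborel. f y *\<^sub>R b (p - y)"], rule conjI)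
  note int = integrable_convolution[OF f cont(1)] integrable_convolution[OF f cont(2)] integrable_convolution[OF f cont(3)]
  show "\<forall>p. (LINT y|lborel. f y * (Re (a (p - y)) + Im (b (p - y)))) = Re (LINT y|lborel. f y *\<^sub>R a (p - y)) + Im (LINT y|lborel. f y *\<^sub>R b (p - y))"
  proof
    fix p :: complex
    have "Re (LINT y|lborel. f y *\<^sub>R a (p - y)) = (LINT y|lborel. f y * Re (a (p - y)))"
      "Im (LINT y|lborel. f y *\<^sub>R b (p - y)) = (LINT y|lborel. f y * Im (b (p - y)))"
      using integral_bounded_linear[OF bounded_linear_Re int(2)[of p]] integral_bounded_linear[OF bounded_linear_Im int(3)[of p]] by simp_all
    moreover have "integrable lborel (\<lambda>y. f y * Re (a (p - y)))" "integrable lborel (\<lambda>y. f y * Im (b (p - y)))"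
      using integrable_bounded_linear[OF bounded_linear_Re int(2)[of p]] integrable_bounded_linear[OF bounded_linear_Im int(3)[of p]] by simp_all
    ultimately show "(LINT y|lborel. f y * (Re (a (p - y)) + Im (b (p - y)))) = Re (LINT y|lborel. f y *\<^sub>R a (p - y)) + Im (LINT y|lborel. f y *\<^sub>R b (p - y))"
      by (simp add: distrib_left)
  qed
  have absf: "integrable lborel (\<lambda>y. \<bar>f y\<bar>)"
    using integrable_norm[OF integrable_convolution[OF f, of "\<lambda>_. 1 :: real"]] by simp
  define L where "L = (LINT y|lborel. \<bar>f y\<bar>)"
  have L: "L \<ge> 0"
    unfolding L_def by (rule integral_nonneg_AE) simp
  show "\<forall>\<epsilon>>0. \<exists>\<delta>>0. \<forall>p h. norm h \<le> \<delta> \<longrightarrow>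
        norm ((LINT y|lborel. f y *\<^sub>R K (p + h - y)) - (LINT y|lborel. f y *\<^sub>R K (p - y)) -
          (Re h *\<^sub>R (LINT y|lborel. f y *\<^sub>R a (p - y)) + Im h *\<^sub>R (LINT y|lborel. f y *\<^sub>R b (p - y)))) \<le> \<epsilon> * norm h"
  proof (intro allI impI)
    fix \<epsilon> :: real
    assume \<epsilon>: "\<epsilon> > 0"
    \<comment> \<open>\<open>L + 1\<close> avoids a division by zero when \<open>f\<close> vanishes
      identically.\<close>
    define \<epsilon>' where "\<epsilon>' = \<epsilon> / (L + 1)"
    have \<epsilon>': "\<epsilon>' > 0"
      using \<epsilon> L by (simp add: \<epsilon>'_def)
    obtain \<delta> where \<delta>: "\<delta> > 0" "\<And>p h. norm h \<le> \<delta> \<Longrightarrow> norm (K (p + h) - K p - (Re h *\<^sub>R a p + Im h *\<^sub>R b p)) \<le> \<epsilon>' * norm h"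
      using rem \<epsilon>' by blast
    show "\<exists>\<delta>>0. \<forall>p h. norm h \<le> \<delta> \<longrightarrow>
        norm ((LINT y|lborel. f y *\<^sub>R K (p + h - y)) - (LINT y|lborel. f y *\<^sub>R K (p - y)) -
          (Re h *\<^sub>R (LINT y|lborel. f y *\<^sub>R a (p - y)) + Im h *\<^sub>R (LINT y|lborel. f y *\<^sub>R b (p - y)))) \<le> \<epsilon> * norm h"
    proof (intro exI[of _ \<delta>] conjI allI impI)
      fix p h :: complex
      assume h: "norm h \<le> \<delta>"
      let ?r = "\<lambda>y. f y *\<^sub>R K (p + h - y) - f y *\<^sub>R K (p - y) - (Re h *\<^sub>R (f y *\<^sub>R a (p - y)) + Im h *\<^sub>R (f y *\<^sub>R b (p - y)))"
      have "(LINT y|lborel. f y *\<^sub>R K (p + h - y)) - (LINT y|lborel. f y *\<^sub>R K (p - y)) -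
          (Re h *\<^sub>R (LINT y|lborel. f y *\<^sub>R a (p - y)) + Im h *\<^sub>R (LINT y|lborel. f y *\<^sub>R b (p - y))) = (LINT y|lborel. ?r y)"
        using int by (simp del: scaleR_scaleR)
      moreover have "norm (LINT y|lborel. ?r y) \<le> (LINT y|lborel. \<bar>f y\<bar> * (\<epsilon>' * norm h))"
      proof (rule Bochner_Integration.integral_norm_bound_integral)
        show "integrable lborel ?r"
          using int by (simp del: scaleR_scaleR)
        show "integrable lborel (\<lambda>y. \<bar>f y\<bar> * (\<epsilon>' * norm h))"
          using absf by simp
        fix y
        have "?r y = f y *\<^sub>R (K ((p - y) + h) - K (p - y) - (Re h *\<^sub>R a (p - y) + Im h *\<^sub>R b (p - y)))"
          by (simp add: algebra_simps)
        then show "norm (?r y) \<le> \<bar>f y\<bar> * (\<epsilon>' * norm h)"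
          using \<delta>(2)[OF h, of "p - y"] by (simp add: mult_left_mono)
      qed
      moreover have "(LINT y|lborel. \<bar>f y\<bar> * (\<epsilon>' * norm h)) = L * \<epsilon>' * norm h"
        by (simp add: L_def)
      moreover have "L * \<epsilon>' * norm h \<le> \<epsilon> * norm h"
        using \<epsilon> L by (intro mult_right_mono) (auto simp: \<epsilon>'_def field_simps)
      ultimately show "norm ((LINT y|lborel. f y *\<^sub>R K (p + h - y)) - (LINT y|lborel. f y *\<^sub>R K (p - y)) -
          (Re h *\<^sub>R (LINT y|lborel. f y *\<^sub>R a (p - y)) + Im h *\<^sub>R (LINT y|lborel. f y *\<^sub>R b (p - y)))) \<le> \<epsilon> * norm h"
        by (metis (no_types, lifting) order_trans)
    qed (fact \<delta>(1))
  qed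
qed

text \<open>The kernel is \<open>z / (2 * pi * \<bar>z\<bar>\<^sup>2)\<close> regularised at scale \<open>d\<close>; its divergence is an approximate identity.\<close>

definition poisson :: "real \<Rightarrow> complex \<Rightarrow> real" where
  "poisson d z = d\<^sup>2 / (pi * ((norm z)\<^sup>2 + d\<^sup>2)\<^sup>2)"

definition reg_kernel :: "real \<Rightarrow> complex \<Rightarrow> complex" where
  "reg_kernel d z = (1 / (2 * pi * ((norm z)\<^sup>2 + d\<^sup>2))) *\<^sub>R z"

definition kernel_dx :: "real \<Rightarrow> complex \<Rightarrow> complex" where
  "kernel_dx d z = (1 / (2 * pi * ((norm z)\<^sup>2 + d\<^sup>2)\<^sup>2)) *\<^sub>R Complex ((norm z)\<^sup>2 + d\<^sup>2 - 2 * (Re z)\<^sup>2) (- 2 * Re z * Im z)"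

definition kernel_dy :: "real \<Rightarrow> complex \<Rightarrow> complex" where
  "kernel_dy d z = (1 / (2 * pi * ((norm z)\<^sup>2 + d\<^sup>2)\<^sup>2)) *\<^sub>R Complex (- 2 * Re z * Im z) ((norm z)\<^sup>2 + d\<^sup>2 - 2 * (Im z)\<^sup>2)"

lemma kernel_divergence:
  assumes "d > 0"
  shows "Re (kernel_dx d z) + Im (kernel_dy d z) = poisson d z"
proof -
  define c where "c = 1 / (2 * pi * ((norm z)\<^sup>2 + d\<^sup>2)\<^sup>2)"
  have "Re (kernel_dx d z) = c * ((norm z)\<^sup>2 + d\<^sup>2 - 2 * (Re z)\<^sup>2)" "Im (kernel_dy d z) = c * ((norm z)\<^sup>2 + d\<^sup>2 - 2 * (Im z)\<^sup>2)"
    by (simp_all add: kernel_dx_def kernel_dy_def c_def)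
  then have "Re (kernel_dx d z) + Im (kernel_dy d z) = c * (2 * d\<^sup>2)"
    unfolding cmod_power2 by (simp add: algebra_simps)
  then show ?thesis
    by (simp add: poisson_def c_def)
qed

lemma has_derivative_rational:
  fixes c :: real
  assumes "c > 0"
  shows "((\<lambda>t. (x + t) / (2 * pi * ((x + t)\<^sup>2 + c))) has_real_derivative (x\<^sup>2 + c - 2 * x\<^sup>2) / (2 * pi * (x\<^sup>2 + c)\<^sup>2)) (at 0)"
    and "((\<lambda>t. y / (2 * pi * ((x + t)\<^sup>2 + c))) has_real_derivative - 2 * x * y / (2 * pi * (x\<^sup>2 + c)\<^sup>2)) (at 0)"
proof -
  have N: "x\<^sup>2 + c \<noteq> 0"
    using assms zero_le_power2[of x] by linarith
  have "((\<lambda>t. (x + t) / ((x + t)\<^sup>2 + c)) has_real_derivative (1 * ((x + 0)\<^sup>2 + c) - (x + 0) * (2 * x)) / (((x + 0)\<^sup>2 + c) * ((x + 0)\<^sup>2 + c))) (at 0)"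
    by (rule DERIV_divide) (use N in \<open>auto intro!: derivative_eq_intros\<close>)
  from DERIV_cdivide[OF this, of "2 * pi"]
  show "((\<lambda>t. (x + t) / (2 * pi * ((x + t)\<^sup>2 + c))) has_real_derivative (x\<^sup>2 + c - 2 * x\<^sup>2) / (2 * pi * (x\<^sup>2 + c)\<^sup>2)) (at 0)"
    by (simp add: power2_eq_square mult_ac)
  have "((\<lambda>t. y / ((x + t)\<^sup>2 + c)) has_real_derivative (0 * ((x + 0)\<^sup>2 + c) - y * (2 * x)) / (((x + 0)\<^sup>2 + c) * ((x + 0)\<^sup>2 + c))) (at 0)"
    by (rule DERIV_divide) (use N in \<open>auto intro!: derivative_eq_intros\<close>)
  from DERIV_cdivide[OF this, of "2 * pi"]
  show "((\<lambda>t. y / (2 * pi * ((x + t)\<^sup>2 + c))) has_real_derivative - 2 * x * y / (2 * pi * (x\<^sup>2 + c)\<^sup>2)) (at 0)"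
    by (simp add: power2_eq_square mult_ac)
qed

lemma kernel_derivatives:
  assumes d: "d > 0"
  shows "((\<lambda>t. reg_kernel d (z + of_real t)) has_vector_derivative kernel_dx d z) (at 0)"
    and "((\<lambda>t. reg_kernel d (z + of_real t * \<i>)) has_vector_derivative kernel_dy d z) (at 0)"
proof -
  have pos: "(Re z)\<^sup>2 + d\<^sup>2 > 0" "(Im z)\<^sup>2 + d\<^sup>2 > 0"
    using d by (simp_all add: add_nonneg_pos)
  have k: "reg_kernel d w = Complex (Re w / (2 * pi * ((Re w)\<^sup>2 + (Im w)\<^sup>2 + d\<^sup>2))) (Im w / (2 * pi * ((Re w)\<^sup>2 + (Im w)\<^sup>2 + d\<^sup>2)))" for w
    by (simp add: reg_kernel_def complex_eq_iff cmod_power2)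
  show "((\<lambda>t. reg_kernel d (z + of_real t)) has_vector_derivative kernel_dx d z) (at 0)"
    using has_vector_derivative_Complex[OF has_derivative_rational(1)[OF pos(2), of "Re z"] has_derivative_rational(2)[OF pos(2), of "Im z" "Re z"]]
    by (simp add: k kernel_dx_def cmod_power2 complex_scaleR add_ac mult_ac)
  show "((\<lambda>t. reg_kernel d (z + of_real t * \<i>)) has_vector_derivative kernel_dy d z) (at 0)"
    using has_vector_derivative_Complex[OF has_derivative_rational(2)[OF pos(1), of "Re z" "Im z"] has_derivative_rational(1)[OF pos(1), of "Im z"]]
    by (simp add: k kernel_dy_def cmod_power2 complex_scaleR add_ac mult_ac)
qed

lemma kernel_continuous:
  assumes d: "d > 0"
  shows "continuous_on UNIV (reg_kernel d)" "continuous_on UNIV (kernel_dx d)" "continuous_on UNIV (kernel_dy d)" "continuous_on UNIV (poisson d)"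
proof -
  have "(norm z)\<^sup>2 + d\<^sup>2 \<noteq> 0" for z :: complex
    using d by (simp add: add_nonneg_eq_0_iff)
  then show "continuous_on UNIV (reg_kernel d)" "continuous_on UNIV (kernel_dx d)" "continuous_on UNIV (kernel_dy d)" "continuous_on UNIV (poisson d)"
    unfolding reg_kernel_def kernel_dx_def kernel_dy_def poisson_def Complex_eq
    by (auto intro!: continuous_intros)
qed

text \<open>Provides decay at infinity, which together with continuity makes the partial derivatives
  uniformly continuous.\<close>

lemma kernel_derivative_bound:
  assumes d: "d > 0"
  shows "norm (kernel_dx d z) \<le> 1 / ((norm z)\<^sup>2 + d\<^sup>2)" "norm (kernel_dy d z) \<le> 1 / ((norm z)\<^sup>2 + d\<^sup>2)"
proof -
  define N where "N = (norm z)\<^sup>2 + d\<^sup>2"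
  have N: "N > 0"
    using d by (simp add: N_def add_nonneg_pos)
  have xy: "(Re z)\<^sup>2 + (Im z)\<^sup>2 \<le> N"
    by (simp add: N_def cmod_power2)
  have c: "\<bar>- 2 * Re z * Im z\<bar> \<le> N"
    using xy sum_squares_bound[of "\<bar>Re z\<bar>" "\<bar>Im z\<bar>"] by (simp add: abs_mult)
  have dx: "\<bar>N - 2 * (Re z)\<^sup>2\<bar> \<le> N" "\<bar>N - 2 * (Im z)\<^sup>2\<bar> \<le> N"
    using xy N zero_le_power2[of "Re z"] zero_le_power2[of "Im z"] unfolding abs_le_iff by linarith+
  have *: "norm ((1 / (2 * pi * N\<^sup>2)) *\<^sub>R Complex u v) \<le> 1 / N" if "\<bar>u\<bar> \<le> N" "\<bar>v\<bar> \<le> N" for u v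
  proof -
    have "norm (Complex u v) \<le> \<bar>u\<bar> + \<bar>v\<bar>"
      using cmod_le[of "Complex u v"] by simp
    also have "\<dots> \<le> 2 * N"
      using that by simp
    also have "\<dots> \<le> 2 * pi * N"
      using N pi_ge_two by simp
    finally have "1 / (2 * pi * N\<^sup>2) * norm (Complex u v) \<le> 1 / (2 * pi * N\<^sup>2) * (2 * pi * N)"
      by (intro mult_left_mono) auto
    then show ?thesis
      using N by (simp add: power2_eq_square)
  qed
  show "norm (kernel_dx d z) \<le> 1 / ((norm z)\<^sup>2 + d\<^sup>2)" "norm (kernel_dy d z) \<le> 1 / ((norm z)\<^sup>2 + d\<^sup>2)"
    unfolding kernel_dx_def kernel_dy_def N_def[symmetric] by (intro * c dx)+
qed

lemma inverse_square_decay: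
  assumes d: "d > 0"
  shows "((\<lambda>z::complex. 1 / ((norm z)\<^sup>2 + d\<^sup>2)) \<longlongrightarrow> 0) at_infinity"
proof -
  have "filterlim (\<lambda>z::complex. (norm z)\<^sup>2 + d\<^sup>2) at_top at_infinity"
  proof (rule filterlim_at_top_mono[OF filterlim_norm_at_top])
    have "\<forall>\<^sub>F z::complex in at_infinity. 1 \<le> norm z"
      unfolding eventually_at_infinity by auto
    then show "\<forall>\<^sub>F z::complex in at_infinity. norm z \<le> (norm z)\<^sup>2 + d\<^sup>2"
    proof eventually_elim
      case (elim z)
      then have "norm z * 1 \<le> norm z * norm z"
        by (intro mult_left_mono) auto
      then show ?case
        unfolding power2_eq_square using zero_le_square[of d] by linarith
    qed
  qed
  from tendsto_inverse_0_at_top[OF this] show ?thesis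
    by (simp add: inverse_eq_divide)
qed

lemma kernel_derivative_uniformly_continuous:
  assumes d: "d > 0"
  shows "uniformly_continuous_on UNIV (kernel_dx d)" "uniformly_continuous_on UNIV (kernel_dy d)"
  using kernel_derivative_bound[OF d]
  by (auto intro!: uniformly_continuous_of_decay kernel_continuous d Lim_null_comparison[OF _ inverse_square_decay[OF d]])

lemma norm_kernel_le: "norm (reg_kernel d z) \<le> 1 / (2 * pi) * (1 / norm z)"
proof (cases "z = 0")
  case False
  then have "0 < norm z"
    by simp
  then have "norm z * norm z \<le> (norm z)\<^sup>2 + d\<^sup>2"
    by (simp add: power2_eq_square)
  then have "norm z / ((norm z)\<^sup>2 + d\<^sup>2) \<le> 1 / norm z"
    using \<open>0 < norm z\<close> by (simp add: divide_le_eq le_divide_eq add_pos_nonneg)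
  then have "1 / (2 * pi) * (norm z / ((norm z)\<^sup>2 + d\<^sup>2)) \<le> 1 / (2 * pi) * (1 / norm z)"
    by (rule mult_left_mono) simp
  then show ?thesis
    by (simp add: reg_kernel_def abs_mult)
qed (simp add: reg_kernel_def)

lemma poisson_nonneg: "poisson d z \<ge> 0"
  by (simp add: poisson_def)

text \<open>In the squared distance \<open>v\<close> the integrand is proportional to
  \<open>1 / (v + d^2)^2\<close> and has an elementary antiderivative. \<open>c = 0\<close> gives
  total mass 1; \<open>c = r^2\<close> gives the mass beyond distance \<open>r\<close>, which
  vanishes as \<open>d\<close> tends to 0.\<close>

lemma poisson_tail:
  assumes d: "d > 0" and c: "c \<ge> 0"
  shows "(\<integral>\<^sup>+ y. ennreal (poisson d (p - y)) * indicator {c..} ((norm (p - y))\<^sup>2) \<partial>lborel) = ennreal (d\<^sup>2 / (c + d\<^sup>2))"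
proof -
  define g where "g v = d\<^sup>2 / (pi * (v + d\<^sup>2)\<^sup>2)" for v
  have d2: "d\<^sup>2 > 0"
    using d by simp
  have [measurable]: "g \<in> borel_measurable borel"
    unfolding g_def by measurable
  have "(\<integral>\<^sup>+ y. ennreal (poisson d (p - y)) * indicator {c..} ((norm (p - y))\<^sup>2) \<partial>lborel) = (\<integral>\<^sup>+ y. ennreal (g ((norm (p - y))\<^sup>2)) * indicator {c..} ((norm (p - y))\<^sup>2) \<partial>lborel)"
    by (simp add: poisson_def g_def)
  also have "\<dots> = ennreal pi * (\<integral>\<^sup>+ v. ennreal (g v) * indicator {c..} v * indicator {0..} v \<partial>lborel)"
    by (rule nn_integral_radial) measurable
  also have "(\<integral>\<^sup>+ v. ennreal (g v) * indicator {c..} v * indicator {0..} v \<partial>lborel) = (\<integral>\<^sup>+ v. ennreal (g v) * indicator {c..} v \<partial>lborel)"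
    using c by (intro nn_integral_cong) (auto simp: indicator_def)
  also have "\<dots> = ennreal (0 - (- (d\<^sup>2 / pi) * inverse (c + d\<^sup>2)))"
  proof (rule nn_integral_FTC_atLeast)
    fix v assume "c \<le> v"
    then have "v + d\<^sup>2 > 0"
      using c d2 by linarith
    then have "((\<lambda>v. - (d\<^sup>2 / pi) * inverse (v + d\<^sup>2)) has_real_derivative - (d\<^sup>2 / pi) * (- (inverse (v + d\<^sup>2) * 1 * inverse (v + d\<^sup>2)))) (at v)"
      by (intro DERIV_cmult DERIV_inverse') (auto intro!: derivative_eq_intros)
    then show "((\<lambda>v. - (d\<^sup>2 / pi) * inverse (v + d\<^sup>2)) has_real_derivative g v) (at v)"
      by (simp add: g_def power2_eq_square divide_inverse mult_ac)
    show "0 \<le> g v"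
      by (simp add: g_def)
  next
    have "((\<lambda>v. inverse (v + d\<^sup>2)) \<longlongrightarrow> 0) at_top"
      by (rule tendsto_inverse_0_at_top, rule filterlim_at_top_mono[OF filterlim_ident]) simp
    from tendsto_mult_right_zero[OF this] show "((\<lambda>v. - (d\<^sup>2 / pi) * inverse (v + d\<^sup>2)) \<longlongrightarrow> 0) at_top" .
  qed simp
  finally show ?thesis
    using c d2 by (simp add: ennreal_mult'[symmetric] inverse_eq_divide)
qed

lemma poisson_integral:
  assumes d: "d > 0"
  shows "integrable lborel (\<lambda>y. poisson d (p - y))" "(LINT y|lborel. poisson d (p - y)) = 1"
proof -
  have [measurable]: "poisson d \<in> borel_measurable borel"
    by (rule borel_measurable_continuous_onI[OF kernel_continuous(4)[OF d]])
  have nn: "(\<integral>\<^sup>+ y. ennreal (poisson d (p - y)) \<partial>lborel) = ennreal 1"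
    using poisson_tail[OF d, of 0 p] d by simp
  show "integrable lborel (\<lambda>y. poisson d (p - y))"
    by (rule integrableI_nn_integral_finite[OF _ _ nn]) (auto simp: poisson_nonneg)
  show "(LINT y|lborel. poisson d (p - y)) = 1"
    by (rule integral_eq_nn_integral[THEN trans]) (use nn in \<open>auto simp: poisson_nonneg\<close>)
qed

lemma poisson_convolution_close:
  fixes f :: "complex \<Rightarrow> real"
  assumes f: "continuous_on UNIV f" "\<forall>y. norm y > B \<longrightarrow> f y = 0" and M: "\<And>y. \<bar>f y\<bar> \<le> M"
    and r: "r > 0" "\<forall>x x'. dist x' x < r \<longrightarrow> dist (f x') (f x) < e" and e: "e > 0"
    and d: "d > 0" "2 * M * d\<^sup>2 \<le> e * r\<^sup>2"
  shows "\<bar>(LINT y|lborel. f y * poisson d (p - y)) - f p\<bar> \<le> 2 * e"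
proof -
  have [measurable]: "f \<in> borel_measurable borel" "poisson d \<in> borel_measurable borel"
    by (rule borel_measurable_continuous_onI[OF f(1)], rule borel_measurable_continuous_onI[OF kernel_continuous(4)[OF d(1)]])
  have int: "integrable lborel (\<lambda>y. f y * poisson d (p - y))"
    using integrable_convolution[OF f kernel_continuous(4)[OF d(1)], of p] by simp
  have int': "integrable lborel (\<lambda>y. f p * poisson d (p - y))"
    using poisson_integral(1)[OF d(1), of p] by simp
  have M0: "M \<ge> 0"
    using M[of 0] by linarith
  have "(LINT y|lborel. f y * poisson d (p - y)) - f p = (LINT y|lborel. f y * poisson d (p - y) - f p * poisson d (p - y))"
    using int int' poisson_integral(2)[OF d(1), of p] by simp
  also have "ennreal \<bar>\<dots>\<bar> \<le> (\<integral>\<^sup>+ y. ennreal \<bar>f y * poisson d (p - y) - f p * poisson d (p - y)\<bar> \<partial>lborel)"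
    using integral_norm_bound_ennreal[of lborel "\<lambda>y. f y * poisson d (p - y) - f p * poisson d (p - y)"] int int' by simp
  \<comment> \<open>The indicator of \<open>{0..}\<close> is constantly 1 at a squared norm; it
    brings the near part into the form that \<open>poisson_tail\<close> evaluates.\<close>
  also have "\<dots> \<le> (\<integral>\<^sup>+ y. ennreal e * (ennreal (poisson d (p - y)) * indicator {0..} ((norm (p - y))\<^sup>2)) + ennreal (2 * M) * (ennreal (poisson d (p - y)) * indicator {r\<^sup>2..} ((norm (p - y))\<^sup>2)) \<partial>lborel)"
  proof (rule nn_integral_mono)
    fix y
    have eq: "\<bar>f y * poisson d (p - y) - f p * poisson d (p - y)\<bar> = \<bar>f y - f p\<bar> * poisson d (p - y)"
      by (simp add: left_diff_distrib[symmetric] abs_mult poisson_nonneg)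
    show "ennreal \<bar>f y * poisson d (p - y) - f p * poisson d (p - y)\<bar> \<le>
        ennreal e * (ennreal (poisson d (p - y)) * indicator {0..} ((norm (p - y))\<^sup>2)) + ennreal (2 * M) * (ennreal (poisson d (p - y)) * indicator {r\<^sup>2..} ((norm (p - y))\<^sup>2))"
    proof (cases "dist y p < r")
      case True
      then have "\<bar>f y - f p\<bar> * poisson d (p - y) \<le> e * poisson d (p - y)"
        using r(2)[rule_format, OF True] by (intro mult_right_mono poisson_nonneg) (simp add: dist_real_def)
      then show ?thesis
        unfolding eq using e by (auto simp: ennreal_mult'[symmetric] intro!: add_increasing2 ennreal_leI)
    next
      case False
      then have "r\<^sup>2 \<le> (norm (p - y))\<^sup>2"
        using r(1) by (intro power_mono) (auto simp: dist_norm norm_minus_commute)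
      moreover have "\<bar>f y - f p\<bar> * poisson d (p - y) \<le> (2 * M) * poisson d (p - y)"
        using M[of y] M[of p] by (intro mult_right_mono poisson_nonneg) linarith
      ultimately show ?thesis
        unfolding eq using M0 by (auto simp: ennreal_mult'[symmetric] intro!: add_increasing ennreal_leI)
    qed
  qed
  also have "\<dots> = ennreal e * ennreal (d\<^sup>2 / (0 + d\<^sup>2)) + ennreal (2 * M) * ennreal (d\<^sup>2 / (r\<^sup>2 + d\<^sup>2))"
    by (subst nn_integral_add) (auto simp: nn_integral_cmult poisson_tail[OF d(1)] simp del: atLeast_iff)
  also have "\<dots> = ennreal (e + 2 * M * (d\<^sup>2 / (r\<^sup>2 + d\<^sup>2)))"
    using d(1) e M0 by (simp add: ennreal_mult'[symmetric] ennreal_plus[symmetric] del: ennreal_plus)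
  finally have "\<bar>(LINT y|lborel. f y * poisson d (p - y)) - f p\<bar> \<le> e + 2 * M * (d\<^sup>2 / (r\<^sup>2 + d\<^sup>2))"
    using e M0 by (subst (asm) ennreal_le_iff) auto
  moreover have "2 * M * (d\<^sup>2 / (r\<^sup>2 + d\<^sup>2)) \<le> e"
  proof -
    have "e * r\<^sup>2 \<le> e * (r\<^sup>2 + d\<^sup>2)"
      using e by simp
    then have "2 * M * d\<^sup>2 \<le> e * (r\<^sup>2 + d\<^sup>2)"
      using d(2) by linarith
    then show ?thesis
      using r(1) by (simp add: divide_le_eq add_pos_nonneg)
  qed
  ultimately show ?thesis
    by linarith
qed

text \<open>The bound on the potential is uniform in \<open>d\<close> and \<open>e\<close>, because
  the regularised kernel is dominated by the singular one and the truncation by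
  \<open>\<bar>H\<bar>\<close>. The factors \<open>1 / (2 * pi)\<close> and
  \<open>3 / 2 * sqrt pi\<close> combine to \<open>3 / (4 * sqrt pi)\<close>.\<close>

theorem approximable_lorentz:
  assumes H: "continuous_on UNIV H" and decay: "(H \<longlongrightarrow> 0) at_infinity" and M: "\<And>p. \<bar>H p\<bar> \<le> M"
    and lorentz: "lorentz21 H \<le> 1"
  shows "approximable H (1/2)"
  unfolding approximable_def
proof (intro allI impI)
  fix e :: real
  assume e: "e > 0"
  \<comment> \<open>Soft thresholding: \<open>f\<close> stays continuous, vanishes where
    \<open>\<bar>H\<bar> \<le> e / 3\<close> and hence outside a ball, and differs from
    \<open>H\<close> by at most \<open>e / 3\<close>.\<close>
  define f where "f y = H y - max (- (e / 3)) (min (e / 3) (H y))" for y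
  have f: "continuous_on UNIV f"
    unfolding f_def by (intro continuous_intros H)
  have f_le: "\<bar>f y\<bar> \<le> \<bar>H y\<bar>" and f_close: "\<bar>f y - H y\<bar> \<le> e / 3" for y
    using e by (auto simp: f_def max_def min_def)
  have "e / 3 > 0"
    using e by simp
  from tendstoD[OF decay this] obtain B where B: "\<And>y. norm y \<ge> B \<Longrightarrow> \<bar>H y\<bar> < e / 3"
    unfolding eventually_at_infinity by (auto simp: dist_real_def)
  have f0: "\<forall>y. norm y > B \<longrightarrow> f y = 0"
  proof (intro allI impI)
    fix y :: complex assume "norm y > B"
    then show "f y = 0"
      using B[of y] by (auto simp: f_def max_def min_def)
  qed
  have "(f \<longlongrightarrow> 0) at_infinity"
    by (rule Lim_null_comparison[OF _ tendsto_rabs_zero[OF decay]]) (simp add: f_le)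
  then have "uniformly_continuous_on UNIV f"
    by (rule uniformly_continuous_of_decay[OF f])
  then obtain r where r: "r > 0" "\<forall>x x'. dist x' x < r \<longrightarrow> dist (f x') (f x) < e / 3"
    using uniformly_continuous_UNIV_dist \<open>e / 3 > 0\<close> by blast
  have fM: "\<bar>f y\<bar> \<le> M" for y
    using f_le[of y] M[of y] by linarith
  have M0: "M \<ge> 0"
    using M[of 0] by linarith
  \<comment> \<open>Makes the kernel's mass beyond distance \<open>r\<close> small against
    \<open>e\<close>; \<open>2 * M + 1\<close> avoids a division by zero.\<close>
  define d where "d = sqrt (e / 3 * r\<^sup>2 / (2 * M + 1))"
  have d: "d > 0"
    using e r(1) M0 by (simp add: d_def)
  have d2: "2 * M * d\<^sup>2 \<le> e / 3 * r\<^sup>2"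
  proof -
    have "d\<^sup>2 = e / 3 * r\<^sup>2 / (2 * M + 1)"
      using e M0 by (simp add: d_def)
    moreover have "2 * M + 1 \<noteq> 0"
      using M0 by linarith
    ultimately have "(2 * M + 1) * d\<^sup>2 = e / 3 * r\<^sup>2"
      by (metis nonzero_mult_div_cancel_left times_divide_eq_right)
    moreover have "(2 * M + 1) * d\<^sup>2 = 2 * M * d\<^sup>2 + d\<^sup>2"
      by (simp add: algebra_simps)
    moreover have "d\<^sup>2 \<ge> 0"
      by simp
    ultimately show ?thesis
      by linarith
  qed
  show "\<exists>Q G. (\<forall>p. norm (Q p) \<le> 1/2) \<and> unif_div Q G \<and> (\<forall>p. \<bar>G p - H p\<bar> \<le> e)"
  proof (rule exI[of _ "\<lambda>p. LINT y|lborel. f y *\<^sub>R reg_kernel d (p - y)"], rule exI[of _ "\<lambda>p. LINT y|lborel. f y * poisson d (p - y)"], intro conjI allI)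
    have "unif_div (\<lambda>p. LINT y|lborel. f y *\<^sub>R reg_kernel d (p - y)) (\<lambda>p. LINT y|lborel. f y * (Re (kernel_dx d (p - y)) + Im (kernel_dy d (p - y))))"
      using uniform_remainder_of_partials[OF kernel_derivatives[OF d] kernel_derivative_uniformly_continuous[OF d]]
      by (intro unif_div_convolution[OF f f0 kernel_continuous(1-3)[OF d]]) blast
    then show "unif_div (\<lambda>p. LINT y|lborel. f y *\<^sub>R reg_kernel d (p - y)) (\<lambda>p. LINT y|lborel. f y * poisson d (p - y))"
      by (simp add: kernel_divergence[OF d])
    fix p
    show "\<bar>(LINT y|lborel. f y * poisson d (p - y)) - H p\<bar> \<le> e"
      using poisson_convolution_close[OF f f0 fM r \<open>e / 3 > 0\<close> d d2, of p] f_close[of p] by linarith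
    have [measurable]: "H \<in> borel_measurable borel"
      by (rule borel_measurable_continuous_onI[OF H])
    have "ennreal (norm (LINT y|lborel. f y *\<^sub>R reg_kernel d (p - y))) \<le> (\<integral>\<^sup>+ y. ennreal (norm (f y *\<^sub>R reg_kernel d (p - y))) \<partial>lborel)"
      by (rule integral_norm_bound_ennreal[OF integrable_convolution[OF f f0 kernel_continuous(1)[OF d]]])
    also have "\<dots> \<le> (\<integral>\<^sup>+ y. ennreal (1 / (2 * pi)) * ennreal (\<bar>H y\<bar> / norm (p - y)) \<partial>lborel)"
    proof (rule nn_integral_mono)
      fix y
      have "\<bar>f y\<bar> * norm (reg_kernel d (p - y)) \<le> \<bar>H y\<bar> * (1 / (2 * pi) * (1 / norm (p - y)))"
        by (intro mult_mono f_le norm_kernel_le) auto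
      then show "ennreal (norm (f y *\<^sub>R reg_kernel d (p - y))) \<le> ennreal (1 / (2 * pi)) * ennreal (\<bar>H y\<bar> / norm (p - y))"
        by (simp add: ennreal_mult'[symmetric] mult_ac ennreal_leI)
    qed
    also have "\<dots> = ennreal (1 / (2 * pi)) * (\<integral>\<^sup>+ y. ennreal (\<bar>H y\<bar> / norm (p - y)) \<partial>lborel)"
      by (rule nn_integral_cmult) measurable
    also have "\<dots> \<le> ennreal (1 / (2 * pi)) * (ennreal (3 / 2 * sqrt pi) * lorentz21 H)"
      by (rule mult_left_mono[OF riesz_potential_le_lorentz[OF H decay M]]) simp
    also have "\<dots> \<le> ennreal (1 / (2 * pi)) * (ennreal (3 / 2 * sqrt pi) * 1)"
      by (intro mult_left_mono lorentz) simp_all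
    also have "\<dots> = ennreal (1 / (2 * pi) * (3 / 2 * sqrt pi))"
      by (simp add: ennreal_mult'[symmetric])
    finally have "norm (LINT y|lborel. f y *\<^sub>R reg_kernel d (p - y)) \<le> 1 / (2 * pi) * (3 / 2 * sqrt pi)"
      by (subst (asm) ennreal_le_iff) auto
    \<comment> \<open>Equivalent to \<open>9 / 4 \<le> pi\<close>.\<close>
    moreover have "1 / (2 * pi) * (3 / 2 * sqrt pi) \<le> 1/2"
    proof -
      have "(3 / 2)\<^sup>2 \<le> pi"
        using pi_gt3 by (simp add: power2_eq_square)
      then have "3 / 2 \<le> sqrt pi"
        by (rule real_le_rsqrt)
      then have "3 / 2 * sqrt pi \<le> sqrt pi * sqrt pi"
        by (rule mult_right_mono) simp
      then show ?thesis
        by (simp add: divide_le_eq)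
    qed
    ultimately show "norm (LINT y|lborel. f y *\<^sub>R reg_kernel d (p - y)) \<le> 1/2"
      by linarith
  qed
qed

section \<open>The two classes of curvature functions\<close>

lemma holder_imp_uniformly_continuous:
  assumes "\<alpha> > 0" "holder \<alpha> H"
  shows "uniformly_continuous_on UNIV H"
  unfolding uniformly_continuous_on_def
proof (intro allI impI)
  fix e :: real
  assume e: "e > 0"
  obtain C where C: "\<And>p q. \<bar>H p - H q\<bar> \<le> C * dist p q powr \<alpha>"
    using assms(2) unfolding holder_def by blast
  define d where "d = (e / (\<bar>C\<bar> + 1)) powr (1 / \<alpha>)"
  have pos: "e / (\<bar>C\<bar> + 1) > 0"
    using e by (simp add: add_nonneg_pos)
  have d: "d > 0"
    unfolding d_def powr_gt_zero using pos by linarith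
  have da: "d powr \<alpha> = e / (\<bar>C\<bar> + 1)"
    using assms(1) pos e by (simp add: d_def powr_powr)
  show "\<exists>d>0. \<forall>x\<in>UNIV. \<forall>x'\<in>UNIV. dist x' x < d \<longrightarrow> dist (H x') (H x) < e"
  proof (intro exI[of _ d] conjI ballI impI)
    fix x x' :: complex
    assume "dist x' x < d"
    then have "dist x' x powr \<alpha> \<le> e / (\<bar>C\<bar> + 1)"
      unfolding da[symmetric] using assms(1) by (intro powr_mono2) auto
    then have "\<bar>C\<bar> * dist x' x powr \<alpha> \<le> \<bar>C\<bar> * (e / (\<bar>C\<bar> + 1))"
      by (rule mult_left_mono) simp
    also have "\<dots> < e"
      using e by (simp add: divide_less_eq add_nonneg_pos distrib_left)
    finally have "\<bar>C\<bar> * dist x' x powr \<alpha> < e" .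
    moreover have "C * dist x' x powr \<alpha> \<le> \<bar>C\<bar> * dist x' x powr \<alpha>"
      by (intro mult_right_mono) auto
    ultimately show "dist (H x') (H x) < e"
      using C[of x' x] unfolding dist_real_def by linarith
  qed (fact d)
qed

text \<open>Far out along the ray through an interior direction \<open>p\<close>, a disc of fixed
  radius is seen from the origin under an arbitrarily small angle.\<close>

lemma cone_contains_discs:
  fixes \<omega> :: "complex set"
  assumes \<omega>: "openin (top_of_set (sphere 0 1)) \<omega>" "\<omega> \<noteq> {}" and r: "r > 0"
  shows "\<exists>c. \<forall>q\<in>cball c r. \<exists>p\<in>\<omega>. \<exists>s>0. q = of_real s * p"
proof -
  obtain p where p: "p \<in> \<omega>"
    using \<omega>(2) by blast
  obtain e where e: "e > 0" "ball p e \<inter> sphere 0 1 \<subseteq> \<omega>"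
    using \<omega>(1) p unfolding openin_contains_ball by blast
  have np: "norm p = 1"
    using openin_imp_subset[OF \<omega>(1)] p by auto
  \<comment> \<open>Chosen such that \<open>2 * r / (R - r) = e / 2\<close>; this quotient bounds
    the distance from \<open>p\<close> to the direction of any point of the disc.\<close>
  define R where "R = r + 4 * r / e"
  have R: "R - r > 0" "2 * r / (R - r) < e"
    using r e by (simp_all add: R_def)
  show ?thesis
  proof (intro exI[of _ "of_real R * p"] ballI)
    fix q assume "q \<in> cball (of_real R * p) r"
    then have qr: "norm (q - of_real R * p) \<le> r"
      by (simp add: dist_norm norm_minus_commute)
    have "\<bar>norm q - norm (of_real R * p)\<bar> \<le> r"
      using norm_triangle_ineq3[of q "of_real R * p"] qr by linarith
    moreover have "norm (of_real R * p) = R"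
      using R(1) r by (simp add: norm_mult np)
    ultimately have nq: "\<bar>norm q - R\<bar> \<le> r"
      by simp
    then have q0: "norm q \<ge> R - r" "norm q > 0"
      using R(1) by linarith+
    have "norm (q - of_real (norm q) * p) \<le> norm (q - of_real R * p) + norm (of_real R * p - of_real (norm q) * p)"
      using norm_triangle_ineq[of "q - of_real R * p" "of_real R * p - of_real (norm q) * p"] by simp
    also have "of_real R * p - of_real (norm q) * p = of_real (R - norm q) * p"
      by (simp add: algebra_simps)
    also have "norm (of_real (R - norm q) * p) = \<bar>R - norm q\<bar>"
      unfolding norm_mult np norm_of_real by simp
    also have "norm (q - of_real R * p) + \<bar>R - norm q\<bar> \<le> 2 * r"
      using qr nq by linarith
    finally have "norm (q - of_real (norm q) * p) / norm q \<le> 2 * r / (R - r)"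
      using q0 R(1) r by (intro frac_le) auto
    moreover have "q / of_real (norm q) - p = (q - of_real (norm q) * p) / of_real (norm q)"
      using q0 by (simp add: field_simps)
    then have "norm (q / of_real (norm q) - p) = norm (q - of_real (norm q) * p) / norm q"
      by (simp add: norm_divide)
    ultimately have "q / of_real (norm q) \<in> ball p e"
      using R(2) by (simp add: dist_norm norm_minus_commute)
    moreover have "q / of_real (norm q) \<in> sphere 0 1"
      using q0 by (simp add: norm_divide)
    ultimately have "q / of_real (norm q) \<in> \<omega>"
      using e(2) by blast
    moreover have "q = of_real (norm q) * (q / of_real (norm q))"
      using q0 by simp
    ultimately show "\<exists>p\<in>\<omega>. \<exists>s>0. q = of_real s * p"
      using q0(2) by blast
  qed
qed

lemma has_loops_hypA:
  assumes "hypA H"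
  obtains q where "q < 1" "has_loops H q"
proof -
  obtain \<alpha> where \<alpha>: "\<alpha> > 0" "holder \<alpha> H"
    using assms unfolding hypA_def by blast
  have per: "\<And>p m n. H (p + of_int m + \<i> * of_int n) = H p" and mean: "integral (cbox 0 (1 + \<i>)) H = 0"
    and sup: "(SUP p. \<bar>H p\<bar>) < 2 * sqrt 2"
    using assms unfolding hypA_def by auto
  define M where "M = (SUP p. \<bar>H p\<bar>)"
  obtain B where B: "\<And>p. \<bar>H p\<bar> \<le> B"
    using \<alpha>(2) unfolding holder_def bounded_iff by auto
  have M: "\<bar>H p\<bar> \<le> M" for p
    unfolding M_def using B by (intro cSUP_upper bdd_aboveI2) auto
  have uc: "uniformly_continuous_on UNIV H"
    by (rule holder_imp_uniformly_continuous[OF \<alpha>])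
  \<comment> \<open>Here the hypothesis on the supremum becomes the coercivity condition
    \<open>q < 1\<close>.\<close>
  have q: "M / (2 * sqrt 2) < 1"
    using sup by (simp add: M_def)
  have "has_loops H (M / (2 * sqrt 2))"
    by (rule has_loops_periodic[OF approximable_periodic[OF uc M per mean] q M uc per])
  then show thesis
    using that q by blast
qed

lemma has_loops_hypB:
  assumes "hypB H"
  shows "has_loops H (1/2)"
proof -
  obtain \<alpha> where \<alpha>: "\<alpha> > 0" "holder \<alpha> H"
    using assms unfolding hypB_def by blast
  obtain \<omega> where \<omega>: "\<omega> \<noteq> {}" "openin (top_of_set (sphere 0 1)) \<omega>" "\<forall>p\<in>\<omega>. \<forall>s>0. - H (of_real s * p) < 0"
    using assms unfolding hypB_def by blast
  have decay: "(H \<longlongrightarrow> 0) at_infinity" and lorentz: "lorentz21 H < ennreal ((2 / pi) powr (3/2))"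
    using assms unfolding hypB_def by auto
  obtain M where M: "\<And>p. \<bar>H p\<bar> \<le> M"
    using \<alpha>(2) unfolding holder_def bounded_iff by auto
  have uc: "uniformly_continuous_on UNIV H"
    by (rule holder_imp_uniformly_continuous[OF \<alpha>])
  note cont = uniformly_continuous_imp_continuous[OF uc]
  \<comment> \<open>The threshold is at most 1, and a Lorentz norm of at most 1 keeps the potential
    below 1/2.\<close>
  have "(2 / pi) powr (3/2) \<le> 1 powr (3/2)"
    using pi_ge_two by (intro powr_mono2) (auto simp: divide_le_eq)
  then have "ennreal ((2 / pi) powr (3/2)) \<le> 1"
    by simp
  then have "lorentz21 H \<le> 1"
    using lorentz by (meson less_le_trans less_imp_le)
  from approximable_lorentz[OF cont decay M this]
  have appr: "approximable H (1/2)" .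
  show ?thesis
  proof (rule has_loops_decaying[OF appr _ M uc decay])
    fix r :: real
    assume r: "r > 0"
    obtain c where c: "\<forall>q\<in>cball c r. \<exists>p\<in>\<omega>. \<exists>s>0. q = of_real s * p"
      using cone_contains_discs[OF \<omega>(2,1) r] by blast
    have pos: "H q > 0" if "q \<in> cball c r" for q
      using c that \<omega>(3) by force
    \<comment> \<open>On the compact disc, positivity of the continuous \<open>H\<close> improves to
      a positive lower bound, the gain \<open>g0\<close> of the test polygon.\<close>
    obtain q where q: "q \<in> cball c r" "\<forall>p\<in>cball c r. H q \<le> H p"
      using continuous_attains_inf[of "cball c r" H] continuous_on_subset[OF cont] r by auto
    then show "\<exists>c g0. g0 > 0 \<and> (\<forall>p\<in>cball c r. g0 \<le> H p)"
      using pos by blast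
  qed simp
qed

theorem theorem1p1p4:
  fixes H :: "complex \<Rightarrow> real"
  assumes "hypA H \<or> hypB H"
  shows "(\<exists>Hs \<tau> :: nat \<Rightarrow> real.
            filterlim (\<lambda>j. \<bar>Hs j\<bar>) at_top sequentially \<and> (\<forall>j. \<tau> j \<noteq> 0) \<and> \<tau> \<longlonglongrightarrow> 0
            \<and> (\<forall>j. has_loop_of_area (\<lambda>p. Hs j + H p) (\<tau> j)))
       \<and> (\<exists>Hs' \<tau>' :: nat \<Rightarrow> real.
            (\<lambda>k. \<bar>Hs' k\<bar>) \<longlonglongrightarrow> 0 \<and> (\<forall>k. \<tau>' k \<noteq> 0)
            \<and> filterlim (\<lambda>k. \<bar>\<tau>' k\<bar>) at_top sequentially
            \<and> (\<forall>k. has_loop_of_area (\<lambda>p. Hs' k + H p) (\<tau>' k)))"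
proof -
  have "holder \<alpha> H \<Longrightarrow> \<exists>M. \<forall>p. \<bar>H p\<bar> \<le> M" for \<alpha>
    unfolding holder_def bounded_iff by auto
  then obtain M where M: "\<And>p. \<bar>H p\<bar> \<le> M"
    using assms unfolding hypA_def hypB_def by meson
  have cont: "continuous_on UNIV H"
    using assms unfolding hypA_def hypB_def holder_def by blast
  obtain q where "q < 1" "has_loops H q"
    using assms
  proof
    assume "hypA H"
    then show thesis
      using has_loops_hypA that by blast
  next
    assume "hypB H"
    from has_loops_hypB[OF this] show thesis
      using that[of "1/2"] by simp
  qed
  from loops_of_has_loops[OF this(2,1) M cont] show ?thesis .
qed

end
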